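(* Let $M$ be a hyperbolic $3$-manifold with non-empty compact geodesic boundary, or some toric cusps, or both, such that the total number of boundary components and cusps of $M$ is two. Let $(P_1,P_2)$ be a configuration of peripheral components of $M$ which is a local maximum of $v(P_1)+v(P_2)$ among all such configurations. Then, up to exchanging the indices $1$ and $2$, the component $P_1$ is maximal (i.e. $v(P_1)$ is as large as possible regardless of $P_2$), and $v(P_2)$ is maximal given $P_1$.
   Context: Throughout, a hyperbolic $3$-manifold $M$ is connected, complete, of finite volume, with (possibly empty) compact totally geodesic boundary $\partial M$ and with finitely many cusps, all of toric type (no annular cusps); at least one of $\partial M$ and the set of cusps is non-empty. Let $\Sigma_1,\dots,\Sigma_b$ be the components of $\partial M$ and $T_1,\dots,T_k$ the tori corresponding to the cusps; $v$ denotes hyperbolic volume. For each $\Sigma_j$ and $d\ge 0$ let $U_j(d)$ be the $d$-collar of $\Sigma_j$ in $M$ (the points at distance at most $d$ from $\Sigma_j$); for $d=0$ it is the degenerate collar $\Sigma_j$. It has embedded interior if the normal exponential map on $\Sigma_j\times[0,d)$ is defined with values in $M$ and is an embedding. For each $T_i$ and $s>0$ let $C_i(s)$ be the cusp neighbourhood of volume $s$ at $T_i$ bounded by a horospherical cross-section; it has embedded interior if the quotient of the corresponding open horoball by the cusp group embeds in $M$. A collar $U_j(d)$ or cusp neighbourhood $C_i(s)$ with embedded interior is called a peripheral component. If $n=b+k$ is the total number of boundary components and cusps, a configuration of peripheral components $(P_1,\dots,P_n)$ is the choice of one peripheral component for each boundary component and each cusp ($n=2$ here), such that the $P_j$ have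 embedded and pairwise disjoint interiors. Configurations are parameterized by the widths $d$ of the collars and the volumes $s$ of the cusp neighbourhoods, and "local maximum" refers to the set of allowed parameters with the topology induced from $\mathbb{R}^n$. A peripheral component $P$ is called maximal if $v(P)$ is the largest possible among all peripheral components at the same boundary component or cusp, regardless of the other peripheral components (equivalently, the frontier of $P$ is tangent to itself or to $\partial M$). "$v(P_2)$ is maximal given $P_1$" means that $v(P_2)$ is the largest possible among the choices of $P_2$ with embedded interior disjoint from the interior of the given $P_1$. *)

theory Defs
  imports "HOL-Analysis.Analysis"
begin

section \<open>Hyperbolic space: the upper half-space model\<close>

type_synonym point3 = "complex \<times> real"

definition H3 :: "point3 set" where
  "H3 = {p. 0 < snd p}"

text \<open>A closed half-space of \<^term>\<open>H3\<close>, bounded by the geodesic plane \<open>Re z = 0\<close>.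
  Any two closed half-spaces are isometric, so this one serves as the model at boundary points.\<close>

definition H3_half :: "point3 set" where
  "H3_half = {p \<in> H3. 0 \<le> Re (fst p)}"

definition hdist :: "point3 \<Rightarrow> point3 \<Rightarrow> real" where
  "hdist p q = arcosh (1 + (dist p q)\<^sup>2 / (2 * snd p * snd q))"

definition hvol :: "point3 measure" where
  "hvol = density lborel (\<lambda>p. ennreal (indicator H3 p / snd p ^ 3))"

definition horoball :: "real \<Rightarrow> point3 set" where
  "horoball h = {p. h < snd p}"


section \<open>Hyperbolic 3-manifolds with geodesic boundary\<close>

text \<open>A hyperbolic manifold is a metric space, carried by a whole type, whose metric is the
  intrinsic (path) metric and which is locally isometric to hyperbolic space or, at boundary points,
  to a geodesic half-space.\<close>

definition path_length_le :: "(real \<Rightarrow> 'a::metric_space) \<Rightarrow> real \<Rightarrow> bool" where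
  "path_length_le g L \<longleftrightarrow>
     (\<forall>(t::nat \<Rightarrow> real) N. mono_on {..N} t \<and> t ` {..N} \<subseteq> {0..1} \<longrightarrow>
        (\<Sum>i<N. dist (g (t i)) (g (t (Suc i)))) \<le> L)"

definition length_metric :: "'a::metric_space itself \<Rightarrow> bool" where
  "length_metric (_ :: 'a itself) \<longleftrightarrow>
     (\<forall>x y :: 'a. \<forall>\<epsilon>>0. \<exists>g. path g \<and> pathstart g = x \<and> pathfinish g = y \<and>
        path_length_le g (dist x y + \<epsilon>))"

definition chart :: "point3 set \<Rightarrow> 'a::metric_space \<Rightarrow> real \<Rightarrow> ('a \<Rightarrow> point3) \<Rightarrow> bool" where
  "chart W x r \<phi> \<longleftrightarrow>
     0 < r \<and> \<phi> x \<in> W \<and> \<phi> ` ball x r = {q \<in> W. hdist (\<phi> x) q < r} \<and>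
     (\<forall>u\<in>ball x r. \<forall>v\<in>ball x r. hdist (\<phi> u) (\<phi> v) = dist u v)"

definition boundary_chart :: "'a::metric_space \<Rightarrow> real \<Rightarrow> ('a \<Rightarrow> point3) \<Rightarrow> bool" where
  "boundary_chart x r \<phi> \<longleftrightarrow> chart H3_half x r \<phi> \<and> Re (fst (\<phi> x)) = 0"

definition bdry :: "'a::metric_space set" where
  "bdry = {x. \<exists>r \<phi>. boundary_chart x r \<phi>}"

text \<open>Hyperbolic volume, obtained from \<^term>\<open>hvol\<close> by cutting a set into countably many
  pieces lying in charts. It is an outer measure on all subsets; on Borel sets it is the Riemannian
  volume.\<close>

definition chart_piece :: "'a::metric_space set \<Rightarrow> ('a \<Rightarrow> point3) \<Rightarrow> bool" where
  "chart_piece B \<phi> \<longleftrightarrow>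
     (\<exists>W x r. W \<in> {H3, H3_half} \<and> chart W x r \<phi> \<and> B \<subseteq> ball x r \<and> \<phi> ` B \<in> sets borel)"

definition vol :: "'a::metric_space set \<Rightarrow> ennreal" where
  "vol A = (INF (B, \<phi>) \<in> {(B, \<phi>). (\<forall>n::nat. chart_piece (B n) (\<phi> n)) \<and> A \<subseteq> (\<Union>n. B n)}.
              \<Sum>n. emeasure hvol (\<phi> n ` B n))"


section \<open>Toric cusps\<close>

text \<open>\<open>g\<close> presents an open subset of the manifold as the embedded quotient of the horoball
  at height \<open>h\<close> by a rank-two group of translations: it is a local isometry (onto small
  balls of the manifold) whose fibres are exactly the orbits of the group. Every horoball can be
  moved to one centred at infinity, so no generality is lost.\<close>

definition cusp_param :: "(point3 \<Rightarrow> 'a::metric_space) \<Rightarrow> real \<Rightarrow> bool" where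
  "cusp_param g h \<longleftrightarrow>
     0 < h \<and>
     (\<forall>p\<in>horoball h. \<exists>r>0. {q \<in> H3. hdist p q < r} \<subseteq> horoball h \<and>
        g ` {q \<in> H3. hdist p q < r} = ball (g p) r \<and>
        (\<forall>u\<in>{q \<in> H3. hdist p q < r}. \<forall>v\<in>{q \<in> H3. hdist p q < r}.
           dist (g u) (g v) = hdist u v)) \<and>
     (\<exists>a b :: complex. Im (a * cnj b) \<noteq> 0 \<and>
        (\<forall>p\<in>horoball h. \<forall>q\<in>horoball h.
           g p = g q \<longleftrightarrow> (\<exists>m n :: int. q = p + (of_int m * a + of_int n * b, 0))))"

definition cusp_nbhd :: "'a::metric_space set \<Rightarrow> bool" where
  "cusp_nbhd C \<longleftrightarrow> (\<exists>g h. cusp_param g h \<and> C = g ` horoball h)"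

text \<open>Two embedded open cusp neighbourhoods belong to the same cusp when they are quotients of
  concentric horoballs. A cusp is identified with the family of all its embedded open cusp
  neighbourhoods.\<close>

definition same_cusp :: "('a::metric_space set \<times> 'a set) set" where
  "same_cusp = {(C, D). \<exists>g l h k. cusp_param g l \<and> l \<le> h \<and> l \<le> k \<and>
                  C = g ` horoball h \<and> D = g ` horoball k}"

definition cusps :: "'a::metric_space set set set" where
  "cusps = {C. cusp_nbhd C} // same_cusp"

text \<open>The finite-volume condition below, together with compactness of the complement of finitely
  many toric cusp neighbourhoods, says that the manifold has finitely many cusps, all toric.
  Orientability is not required.\<close>

definition hyperbolic_3_manifold :: "'a::metric_space itself \<Rightarrow> bool" where
  "hyperbolic_3_manifold (_ :: 'a itself) \<longleftrightarrow>
     length_metric TYPE('a) \<and>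
     (\<forall>x::'a. x \<in> bdry \<or> (\<exists>r \<phi>. chart H3 x r \<phi>)) \<and>
     connected (UNIV :: 'a set) \<and>
     complete (UNIV :: 'a set) \<and>
     vol (UNIV :: 'a set) < \<infinity> \<and>
     compact (bdry :: 'a set) \<and>
     (\<exists>\<C> :: 'a set set. finite \<C> \<and> (\<forall>C\<in>\<C>. cusp_nbhd C) \<and> compact (- \<Union>\<C>))"


section \<open>Collars\<close>

text \<open>\<open>\<gamma>\<close> is the unit-speed geodesic on \<open>[0,d)\<close> leaving the boundary orthogonally
  at \<open>p\<close>. In the half-space model the inward normal geodesic at \<open>(\<i>y, s)\<close> is the
  Euclidean circular arc \<open>t \<mapsto> (\<i>y + s tanh t, s / cosh t)\<close>.\<close>

definition normal_geodesic :: "real \<Rightarrow> 'a::metric_space \<Rightarrow> (real \<Rightarrow> 'a) \<Rightarrow> bool" where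
  "normal_geodesic d p \<gamma> \<longleftrightarrow>
     \<gamma> 0 = p \<and>
     (\<exists>r \<phi>. boundary_chart p r \<phi> \<and>
        (\<forall>t. 0 \<le> t \<and> t < r \<and> t < d \<longrightarrow>
           \<phi> (\<gamma> t) = (fst (\<phi> p) + of_real (snd (\<phi> p) * tanh t), snd (\<phi> p) / cosh t))) \<and>
     (\<forall>t\<in>{0..<d}. \<exists>\<epsilon>>0. \<forall>s\<in>{0..<d} \<inter> ball t \<epsilon>. \<forall>s'\<in>{0..<d} \<inter> ball t \<epsilon>.
        dist (\<gamma> s) (\<gamma> s') = \<bar>s - s'\<bar>)"

definition embedded_collar :: "'a::metric_space set \<Rightarrow> real \<Rightarrow> bool" where
  "embedded_collar S d \<longleftrightarrow>
     (\<exists>E :: 'a \<Rightarrow> real \<Rightarrow> 'a. (\<forall>p\<in>S. normal_geodesic d p (E p)) \<and>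
        embedding_map (top_of_set (S \<times> {0..<d})) euclidean (\<lambda>(p, t). E p t))"


section \<open>Peripheral components and configurations\<close>

datatype 'a site = Boundary "'a set" | Cusp "'a set set"

definition sites :: "'a::metric_space site set" where
  "sites = Boundary ` components bdry \<union> Cusp ` cusps"

text \<open>The real parameter is the width for a collar and the volume for a cusp neighbourhood.
  For admissible parameters the union in the cusp case has exactly one member, and in the collar
  case \<open>pc_interior\<close> is the image of the normal exponential map on \<open>\<Sigma> \<times> [0,d)\<close>
  (empty if \<open>d = 0\<close>).\<close>

fun pc_interior :: "'a::metric_space site \<Rightarrow> real \<Rightarrow> 'a set" where
  "pc_interior (Boundary S) d = {x. infdist x S < d}"
| "pc_interior (Cusp T) s = \<Union>{C \<in> T. vol C = ennreal s}"

fun pc :: "'a::metric_space site \<Rightarrow> real \<Rightarrow> 'a set" where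
  "pc (Boundary S) d = {x. infdist x S \<le> d}"
| "pc (Cusp T) s = closure (pc_interior (Cusp T) s)"

fun peripheral :: "'a::metric_space site \<Rightarrow> real \<Rightarrow> bool" where
  "peripheral (Boundary S) d \<longleftrightarrow> 0 \<le> d \<and> embedded_collar S d"
| "peripheral (Cusp T) s \<longleftrightarrow> 0 < s \<and> (\<exists>C\<in>T. vol C = ennreal s)"

definition configuration :: "'a::metric_space site \<Rightarrow> 'a site \<Rightarrow> real \<Rightarrow> real \<Rightarrow> bool" where
  "configuration e1 e2 x1 x2 \<longleftrightarrow>
     peripheral e1 x1 \<and> peripheral e2 x2 \<and> pc_interior e1 x1 \<inter> pc_interior e2 x2 = {}"

definition maximal :: "'a::metric_space site \<Rightarrow> real \<Rightarrow> bool" where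
  "maximal e x \<longleftrightarrow>
     peripheral e x \<and> (\<forall>y. peripheral e y \<longrightarrow> vol (pc e y) \<le> vol (pc e x))"

text \<open>\<open>maximal_given e x e' x'\<close>: the component at \<open>e\<close> with parameter \<open>x\<close> is
  maximal given the one at \<open>e'\<close> with parameter \<open>x'\<close>.\<close>

definition maximal_given ::
    "'a::metric_space site \<Rightarrow> real \<Rightarrow> 'a site \<Rightarrow> real \<Rightarrow> bool" where
  "maximal_given e x e' x' \<longleftrightarrow>
     configuration e e' x x' \<and>
     (\<forall>y. configuration e e' y x' \<longrightarrow> vol (pc e y) \<le> vol (pc e x))"

end

theory Submission
  imports Defs
begin

text \<open>
  Measure collars and cusp neighbourhoods by a common width: for a collar the distance from the
  boundary, for a cusp neighbourhood of volume \<open>s\<close> half the logarithm of \<open>s\<close>, which up to a constant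
  is the signed distance of its frontier from a fixed horosphere. In terms of width, enlarging a
  component by \<open>\<tau>\<close> moves its frontier outwards by exactly \<open>\<tau>\<close>. So if two components have disjoint
  interiors, this remains true when one is enlarged by \<open>\<tau>\<close> and the other shrunk by \<open>\<tau>\<close>
  (\<open>exchange_disjoint\<close>). On the other hand volume is a strictly convex function of the width, namely
  \<open>\<alpha> (w + sinh w cosh w) / 2\<close> with \<open>\<alpha>\<close> the area of the boundary component for a collar, and
  \<open>exp (2 w)\<close> up to a factor for a cusp. If neither component of a local maximum were maximal, then
  both exchanges would be possible, and by convexity one of them would increase the total volume
  (\<open>local_max_not_both_shiftable\<close>). Hence one component is maximal. Each component is maximal given
  the other, because volume increases strictly with the width (\<open>local_max_imp_maximal_given\<close>). A
  collar of width zero cannot be shrunk; but it has empty interior, so the other component is then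
  maximal already.

  The work lies in deriving these geometric facts from the metric definitions.

  Volume is defined by an infimum over covers by chart pieces. It is computed with the help of
  \<open>hvol_isometric_image\<close>: maps between subsets of \<^term>\<open>H3\<close> that preserve distances preserve volume,
  which follows from the Vitali covering theorem because hyperbolic balls are Euclidean balls whose
  volume depends on the radius alone. As a consequence injective, locally isometric parametrisations
  compute volume (\<open>vol_locally_isometric_image\<close>).

  The statement that frontiers move at unit speed rests on \<open>radial_control\<close>, a Lipschitz estimate in
  length spaces. It requires a height function with closed slabs. For a cusp this is the logarithm
  of the height. A cusp class may contain neighbourhoods given by different parametrisations; they
  are compared through a purely metric description (\<open>horoball_image_rescaled\<close>).

  For a collar the height function is the time coordinate of the normal exponential map, and one has
  to know that this map is locally isometric to Fermi coordinates along a geodesic plane of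
  \<^term>\<open>H3\<close>. This holds near the boundary by definition. It persists along the normal geodesics
  (\<open>fermi_metric\<close>), because in the hyperboloid model geodesics are combinations of cosh and sinh, so
  the cosh of the distance between points of two geodesics is bilinear in cosh and sinh of the two
  times and is determined by its values on an arbitrarily small square.
\<close>

section \<open>Hyperbolic distance\<close>

abbreviation hball :: "point3 \<Rightarrow> real \<Rightarrow> point3 set" where
  "hball p r \<equiv> {q \<in> H3. hdist p q < r}"

lemma cosh_hdist:
  assumes "p \<in> H3" "q \<in> H3"
  shows "cosh (hdist p q) = 1 + (dist p q)\<^sup>2 / (2 * snd p * snd q)"
  using assms unfolding hdist_def H3_def by (subst cosh_arcosh_real) auto

lemma hdist_nonneg: "p \<in> H3 \<Longrightarrow> q \<in> H3 \<Longrightarrow> 0 \<le> hdist p q"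
  unfolding hdist_def H3_def by (intro arcosh_nonneg_real) auto

lemma hdist_commute: "hdist p q = hdist q p"
  by (simp add: hdist_def dist_commute mult.commute mult.left_commute)

lemma hdist_self [simp]: "hdist p p = 0"
  by (simp add: hdist_def)

lemma dist_point3_sq:
  fixes p q :: point3
  shows "(dist p q)\<^sup>2 = (cmod (fst p - fst q))\<^sup>2 + (snd p - snd q)\<^sup>2"
  by (simp add: dist_prod_def dist_norm)

lemma cosh_hdist_expand:
  assumes "p \<in> H3" "q \<in> H3"
  shows "2 * snd p * snd q * cosh (hdist p q) = (cmod (fst p - fst q))\<^sup>2 + (snd p)\<^sup>2 + (snd q)\<^sup>2"
proof -
  have "snd p > 0" "snd q > 0" using assms by (auto simp: H3_def)
  then show ?thesis
    unfolding cosh_hdist[OF assms] dist_point3_sq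
    by (simp add: field_simps power2_eq_square)
qed

lemma hdist_eq_iff_cosh:
  assumes "p \<in> H3" "q \<in> H3" "0 \<le> r"
  shows "hdist p q = r \<longleftrightarrow> cosh (hdist p q) = cosh r"
  using assms hdist_nonneg[OF assms(1,2)] by (metis arcosh_cosh_real)

lemma cosh_less_iff: "0 \<le> (a::real) \<Longrightarrow> 0 \<le> b \<Longrightarrow> cosh a < cosh b \<longleftrightarrow> a < b"
  by (meson cosh_real_nonneg_less_iff)

lemma cosh_le_iff: "0 \<le> (a::real) \<Longrightarrow> 0 \<le> b \<Longrightarrow> cosh a \<le> cosh b \<longleftrightarrow> a \<le> b"
  by (meson cosh_real_nonneg_le_iff)

lemma hdist_eq_0_iff:
  assumes "p \<in> H3" "q \<in> H3"
  shows "hdist p q = 0 \<longleftrightarrow> p = q"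
proof
  assume "hdist p q = 0"
  then have "(dist p q)\<^sup>2 / (2 * snd p * snd q) = 0" using cosh_hdist[OF assms] by simp
  then show "p = q" using assms by (auto simp: H3_def)
qed auto

text \<open>A hyperbolic ball is a Euclidean ball with a higher centre; this is what makes hyperbolic
  balls available to Euclidean covering theorems.\<close>

lemma hball_eq_ball:
  assumes "p \<in> H3" "0 < r"
  shows "hball p r = ball (fst p, snd p * cosh r) (snd p * sinh r)"
proof -
  have sp: "snd p > 0" using assms by (auto simp: H3_def)
  have sr: "sinh r > 0" using assms by simp
  have cs: "cosh r > sinh r" using sinh_less_cosh_real by blast
  have eq: "hdist p q < r \<longleftrightarrow> dist (fst p, snd p * cosh r) q < snd p * sinh r" if q: "q \<in> H3" for q
  proof -
    have sq: "snd q > 0" using q by (auto simp: H3_def)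
    have "hdist p q < r \<longleftrightarrow> cosh (hdist p q) < cosh r"
      using cosh_less_iff[of "hdist p q" r] hdist_nonneg[OF assms(1) q] assms by simp
    also have "\<dots> \<longleftrightarrow> 2 * snd p * snd q * cosh (hdist p q) < 2 * snd p * snd q * cosh r"
      using sp sq by simp
    also have "\<dots> \<longleftrightarrow> (cmod (fst p - fst q))\<^sup>2 + (snd p)\<^sup>2 + (snd q)\<^sup>2 < 2 * snd p * snd q * cosh r"
      by (simp only: cosh_hdist_expand[OF assms(1) q])
    also have "\<dots> \<longleftrightarrow> (dist (fst p, snd p * cosh r) q)\<^sup>2 < (snd p * sinh r)\<^sup>2"
    proof -
      have "(snd p * sinh r)\<^sup>2 = (snd p)\<^sup>2 * (cosh r)\<^sup>2 - (snd p)\<^sup>2"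
        by (simp add: power_mult_distrib cosh_square_eq algebra_simps)
      moreover have "(dist (fst p, snd p * cosh r) q)\<^sup>2 =
          (cmod (fst p - fst q))\<^sup>2 + ((snd p)\<^sup>2 * (cosh r)\<^sup>2 + (snd q)\<^sup>2 - 2 * snd p * snd q * cosh r)"
        unfolding dist_point3_sq by (simp add: power2_diff power_mult_distrib)
      ultimately show ?thesis by linarith
    qed
    also have "\<dots> \<longleftrightarrow> dist (fst p, snd p * cosh r) q < snd p * sinh r"
      using sp sr by (intro iffI) (auto intro: power_strict_mono dest: power2_less_imp_less)
    finally show ?thesis .
  qed
  have "q \<in> H3" if "dist (fst p, snd p * cosh r) q < snd p * sinh r" for q
  proof -
    have "\<bar>snd p * cosh r - snd q\<bar> \<le> dist (fst p, snd p * cosh r) q"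
      using dist_snd_le[of "(fst p, snd p * cosh r)" q] by (simp add: dist_real_def)
    with that have "snd q > snd p * cosh r - snd p * sinh r" by linarith
    moreover have "snd p * cosh r - snd p * sinh r > 0" using sp cs by simp
    ultimately show ?thesis by (simp add: H3_def)
  qed
  with eq show ?thesis by auto
qed

lemma open_hball: "p \<in> H3 \<Longrightarrow> open (hball p r)"
proof (cases "0 < r")
  case False
  assume "p \<in> H3"
  then have "hball p r = {}" using False hdist_nonneg[of p] by fastforce
  then show ?thesis by (simp only: open_empty)
qed (simp add: hball_eq_ball)

lemma open_H3: "open H3"
  unfolding H3_def by (intro open_Collect_less continuous_intros)

lemma dist_less_of_hdist_less:
  assumes "p \<in> H3" "q \<in> H3" "hdist p q < r"
  shows "dist p q < snd p * (exp r - 1)"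
proof -
  have r: "0 < r" using assms hdist_nonneg[of p q] by linarith
  have sp: "snd p > 0" using assms by (auto simp: H3_def)
  have "q \<in> ball (fst p, snd p * cosh r) (snd p * sinh r)"
    using hball_eq_ball[OF assms(1) r] assms by blast
  then have "dist (fst p, snd p * cosh r) q < snd p * sinh r" by simp
  moreover have "dist p (fst p, snd p * cosh r) = snd p * (cosh r - 1)"
  proof -
    have "dist p (fst p, snd p * cosh r) = \<bar>snd p - snd p * cosh r\<bar>"
      by (simp add: dist_prod_def dist_real_def)
    also have "\<dots> = snd p * (cosh r - 1)" using sp cosh_real_ge_1[of r]
      by (simp add: abs_if algebra_simps)
    finally show ?thesis .
  qed
  moreover have "dist p q \<le> dist p (fst p, snd p * cosh r) + dist (fst p, snd p * cosh r) q"
    by (rule dist_triangle)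
  moreover have "snd p * cosh r + snd p * sinh r = snd p * exp r"
    by (simp only: cosh_plus_sinh flip: distrib_left)
  ultimately show ?thesis unfolding right_diff_distrib by linarith
qed

lemma hdist_small_imp_dist_small:
  assumes "p \<in> H3" "0 < e"
  obtains d where "0 < d" "\<And>q. q \<in> H3 \<Longrightarrow> hdist p q < d \<Longrightarrow> dist p q < e"
proof
  have sp: "snd p > 0" using assms by (auto simp: H3_def)
  show "0 < ln (1 + e / snd p)" using sp assms by (intro ln_gt_zero) simp
  fix q assume "q \<in> H3" "hdist p q < ln (1 + e / snd p)"
  from dist_less_of_hdist_less[OF assms(1) this] show "dist p q < e"
    using sp assms by (simp add: add_pos_pos)
qed

lemma dist_small_imp_hdist_small:
  assumes "p \<in> H3" "0 < d"
  obtains e where "0 < e" "\<And>q. dist p q < e \<Longrightarrow> q \<in> H3 \<and> hdist p q < d"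
proof -
  have "open (hball p d)" "p \<in> hball p d"
    using open_hball assms by auto
  then obtain e where "e > 0" "ball p e \<subseteq> hball p d" by (meson openE)
  with that show ?thesis by (auto simp: subset_iff)
qed

text \<open>Among all points at two given heights, vertically aligned ones are closest. Hence the logarithm of
  the height is 1-Lipschitz; inside a cusp it plays the role of the distance to the frontier.\<close>

lemma ln_height_le_hdist:
  assumes "p \<in> H3" "q \<in> H3"
  shows "\<bar>ln (snd p) - ln (snd q)\<bar> \<le> hdist p q"
proof -
  have sp: "snd p > 0" "snd q > 0" using assms by (auto simp: H3_def)
  have "cosh (ln (snd p) - ln (snd q)) = ((snd p)\<^sup>2 + (snd q)\<^sup>2) / (2 * snd p * snd q)"
    using sp by (simp add: cosh_def exp_diff exp_minus field_simps power2_eq_square)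
  also have "\<dots> \<le> cosh (hdist p q)"
    using cosh_hdist_expand[OF assms] sp
    by (simp add: divide_simps) (simp add: algebra_simps)
  finally have "cosh \<bar>ln (snd p) - ln (snd q)\<bar> \<le> cosh (hdist p q)" by simp
  then show ?thesis using cosh_le_iff[of "\<bar>ln (snd p) - ln (snd q)\<bar>" "hdist p q"] hdist_nonneg[OF assms] by simp
qed

lemma hdist_vertical:
  assumes "0 < s" "0 < t"
  shows "hdist (z, s) (z, t) = \<bar>ln s - ln t\<bar>"
proof -
  have H: "(z, s) \<in> H3" "(z, t) \<in> H3" using assms by (auto simp: H3_def)
  have "cosh (ln s - ln t) = (s\<^sup>2 + t\<^sup>2) / (2 * s * t)"
    using assms by (simp add: cosh_def exp_diff exp_minus field_simps power2_eq_square)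
  moreover have "2 * s * t * cosh (hdist (z,s) (z,t)) = s\<^sup>2 + t\<^sup>2"
    using cosh_hdist_expand[OF H] by simp
  ultimately have "2 * s * t * cosh (hdist (z,s) (z,t)) = 2 * s * t * cosh (ln s - ln t)"
    using assms by simp
  then have "cosh (hdist (z,s) (z,t)) = cosh \<bar>ln s - ln t\<bar>"
    using assms by (simp only: mult_cancel_left cosh_real_abs) simp
  then show ?thesis using hdist_eq_iff_cosh[OF H] by simp
qed


section \<open>Distance-preserving maps into hyperbolic space\<close>

text \<open>The metric of the type \<^typ>\<open>point3\<close> is Euclidean, so preservation of distances has to be
  formulated with \<^term>\<open>hdist\<close> on the target.\<close>

definition hisometric :: "'a::metric_space set \<Rightarrow> ('a \<Rightarrow> point3) \<Rightarrow> bool" where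
  "hisometric A \<phi> \<longleftrightarrow> \<phi> ` A \<subseteq> H3 \<and> (\<forall>u\<in>A. \<forall>v\<in>A. hdist (\<phi> u) (\<phi> v) = dist u v)"

lemma hisometric_subset: "hisometric A \<phi> \<Longrightarrow> B \<subseteq> A \<Longrightarrow> hisometric B \<phi>"
  unfolding hisometric_def by blast

lemma hisometric_inj_on: "hisometric A \<phi> \<Longrightarrow> inj_on \<phi> A"
  unfolding hisometric_def inj_on_def by (metis dist_eq_0_iff hdist_self)

lemma hisometric_continuous_on:
  assumes "hisometric A \<phi>"
  shows "continuous_on A \<phi>"
proof (subst continuous_on_iff, intro ballI allI impI)
  fix x and e :: real assume x: "x \<in> A" and e: "0 < e"
  have "\<phi> x \<in> H3" using x assms by (auto simp: hisometric_def)
  from hdist_small_imp_dist_small[OF this e]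
  obtain d where d: "0 < d" "\<And>q. q \<in> H3 \<Longrightarrow> hdist (\<phi> x) q < d \<Longrightarrow> dist (\<phi> x) q < e" by metis
  show "\<exists>d>0. \<forall>x'\<in>A. dist x' x < d \<longrightarrow> dist (\<phi> x') (\<phi> x) < e"
  proof (intro exI conjI ballI impI)
    show "d > 0" by fact
    fix x' assume "x' \<in> A" "dist x' x < d"
    then have "dist (\<phi> x) (\<phi> x') < e" using assms x by (intro d(2)) (auto simp: hisometric_def dist_commute)
    then show "dist (\<phi> x') (\<phi> x) < e" by (simp add: dist_commute)
  qed
qed

text \<open>On \<^term>\<open>H3\<close> the distance \<^term>\<open>hdist\<close> induces the Euclidean topology. In this form the fact
  applies to the inverses of charts and to parametrisations of the manifold.\<close>

lemma continuous_on_from_hdist: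
  assumes "Y \<subseteq> H3" "\<And>u v. u \<in> Y \<Longrightarrow> v \<in> Y \<Longrightarrow> dist (G u) (G v) \<le> hdist u v"
  shows "continuous_on Y (G :: point3 \<Rightarrow> 'a::metric_space)"
proof (subst continuous_on_iff, intro ballI allI impI)
  fix x and e :: real assume x: "x \<in> Y" and e: "0 < e"
  have "x \<in> H3" using x assms by auto
  from dist_small_imp_hdist_small[OF this e]
  obtain d where d: "0 < d" "\<And>q. dist x q < d \<Longrightarrow> q \<in> H3 \<and> hdist x q < e" by metis
  show "\<exists>d>0. \<forall>x'\<in>Y. dist x' x < d \<longrightarrow> dist (G x') (G x) < e"
    using d x assms(2)[OF _ x] by (metis dist_commute hdist_commute order_le_less_trans)
qed

lemma hisometric_inverse:
  assumes "hisometric A \<phi>"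
  shows "continuous_on (\<phi> ` A) (inv_into A \<phi>)"
proof (rule continuous_on_from_hdist)
  show "\<phi> ` A \<subseteq> H3" using assms by (auto simp: hisometric_def)
  fix u v assume "u \<in> \<phi> ` A" "v \<in> \<phi> ` A"
  then show "dist (inv_into A \<phi> u) (inv_into A \<phi> v) \<le> hdist u v"
    using assms hisometric_inj_on[OF assms] by (auto simp: hisometric_def)
qed

lemma borel_vimage_continuous_on:
  assumes "continuous_on A f" "A \<in> sets borel" "B \<in> sets borel"
  shows "A \<inter> f -` B \<in> sets borel"
proof -
  have "f \<in> measurable (restrict_space borel A) borel"
    by (rule borel_measurable_continuous_on_restrict[OF assms(1)])
  then have "f -` B \<inter> space (restrict_space borel A) \<in> sets (restrict_space borel A)"
    using assms(3) by (rule measurable_sets)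
  then show ?thesis using assms(2)
    by (simp add: space_restrict_space sets_restrict_space_iff Int_commute)
qed

text \<open>An injective image of a Borel set need not be Borel, but here the inverse map is continuous on the
  image, and the set in question is a preimage under it.\<close>

lemma hisometric_image_borel:
  assumes "hisometric A \<phi>" "\<phi> ` A \<in> sets borel" "B \<in> sets borel"
  shows "\<phi> ` (A \<inter> B) \<in> sets borel"
proof -
  have "\<phi> ` (A \<inter> B) = \<phi> ` A \<inter> inv_into A \<phi> -` B"
    using hisometric_inj_on[OF assms(1)] by (auto simp: inv_into_f_f)
  then show ?thesis using borel_vimage_continuous_on[OF hisometric_inverse[OF assms(1)] assms(2,3)] by simp
qed


section \<open>Charts\<close>

lemma chart_hisometric:
  assumes "W \<in> {H3, H3_half}" "chart W x r \<phi>"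
  shows "hisometric (ball x r) \<phi>"
  using assms unfolding chart_def hisometric_def H3_half_def by auto

lemma chart_image:
  "chart W x r \<phi> \<Longrightarrow> \<phi> ` ball x r = {q \<in> W. hdist (\<phi> x) q < r}"
  by (simp add: chart_def)

lemma chart_image_Int:
  assumes "W \<in> {H3, H3_half}" "chart W x r \<phi>"
  shows "\<phi> ` ball x r = W \<inter> hball (\<phi> x) r"
  using assms by (auto simp: chart_def H3_half_def)

lemma chart_centre_H3:
  assumes "W \<in> {H3, H3_half}" "chart W x r \<phi>"
  shows "\<phi> x \<in> H3"
  using assms by (auto simp: chart_def H3_half_def)

lemma borel_H3_half: "H3_half \<in> sets borel"
proof -
  have "closed {p::point3. 0 \<le> Re (fst p)}"
    by (intro closed_Collect_le continuous_intros)
  then have "H3 \<inter> {p. 0 \<le> Re (fst p)} \<in> sets borel"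
    using open_H3 by (intro sets.Int borel_open borel_closed)
  moreover have "H3_half = H3 \<inter> {p. 0 \<le> Re (fst p)}" by (auto simp: H3_half_def)
  ultimately show ?thesis by (simp only:)
qed

lemma chart_image_borel:
  assumes "W \<in> {H3, H3_half}" "chart W x r \<phi>"
  shows "\<phi> ` ball x r \<in> sets borel"
proof -
  have "W \<in> sets borel" using assms(1) borel_H3_half open_H3 by auto
  then show ?thesis unfolding chart_image_Int[OF assms]
    using open_hball[OF chart_centre_H3[OF assms], of r] by auto
qed

text \<open>Hyperbolic balls are open, so a small one around \<open>\<phi> u\<close> stays inside the image of the given
  chart.\<close>

lemma chart_restrict:
  assumes "W \<in> {H3, H3_half}" "chart W x r \<phi>" "u \<in> ball x r" "0 < e"
  obtains r' where "0 < r'" "r' \<le> e" "chart W u r' \<phi>" "ball u r' \<subseteq> ball x r"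
proof -
  note iso = chart_hisometric[OF assms(1,2)]
  have uH: "\<phi> u \<in> H3" using iso assms(3) by (auto simp: hisometric_def)
  have "open (hball (\<phi> x) r)" by (rule open_hball[OF chart_centre_H3[OF assms(1,2)]])
  moreover have uin: "\<phi> u \<in> hball (\<phi> x) r" and uW: "\<phi> u \<in> W"
    using assms(3) chart_image_Int[OF assms(1,2)] by blast+
  ultimately obtain d where d: "d > 0" "ball (\<phi> u) d \<subseteq> hball (\<phi> x) r" by (meson openE)
  obtain d' where d': "0 < d'" "\<And>q. q \<in> H3 \<Longrightarrow> hdist (\<phi> u) q < d' \<Longrightarrow> dist (\<phi> u) q < d"
    using hdist_small_imp_dist_small[OF uH d(1)] by metis
  define r' where "r' = min (min d' e) (r - dist x u)"
  have r': "0 < r'" "r' \<le> e" "r' \<le> d'" "r' \<le> r - dist x u" using d' assms by (auto simp: r'_def)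
  have sub: "ball u r' \<subseteq> ball x r"
  proof
    fix y assume "y \<in> ball u r'"
    then have "dist x y < r" using r'(4) dist_triangle[of x y u] by simp
    then show "y \<in> ball x r" by simp
  qed
  have iso': "hdist (\<phi> a) (\<phi> b) = dist a b" if "a \<in> ball x r" "b \<in> ball x r" for a b
    using iso that by (auto simp: hisometric_def)
  have "\<phi> ` ball u r' = {q \<in> W. hdist (\<phi> u) q < r'}"
  proof (intro equalityI subsetI)
    fix q assume "q \<in> \<phi> ` ball u r'"
    then obtain y where y: "q = \<phi> y" "y \<in> ball u r'" by blast
    then have yx: "y \<in> ball x r" using sub by blast
    then have "q \<in> W" using y(1) chart_image_Int[OF assms(1,2)] by blast
    then show "q \<in> {q \<in> W. hdist (\<phi> u) q < r'}" using iso'[OF assms(3) yx] y by simp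
  next
    fix q assume q: "q \<in> {q \<in> W. hdist (\<phi> u) q < r'}"
    then have qH: "q \<in> H3" using assms(1) by (auto simp: H3_half_def)
    have "q \<in> ball (\<phi> u) d" using d'(2)[OF qH] q r' by auto
    then have "q \<in> \<phi> ` ball x r" using d(2) q chart_image_Int[OF assms(1,2)] by blast
    then obtain y where y: "q = \<phi> y" "y \<in> ball x r" by blast
    then have "y \<in> ball u r'" using q iso'[OF assms(3) y(2)] by simp
    then show "q \<in> \<phi> ` ball u r'" using y by blast
  qed
  then have "chart W u r' \<phi>"
    unfolding chart_def using r'(1) uW iso' sub by blast
  with r' sub that show ?thesis by blast
qed

section \<open>Hyperbolic volume is invariant under distance-preserving maps\<close>

lemma sets_hvol [simp, measurable_cong]: "sets hvol = sets borel"
  by (simp add: hvol_def)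

lemma space_hvol [simp]: "space hvol = UNIV"
  by (simp add: hvol_def)

lemma hvol_density_measurable [measurable]:
  "(\<lambda>p::point3. ennreal (indicator H3 p / snd p ^ 3)) \<in> borel_measurable borel"
proof -
  have "H3 \<in> sets borel" using open_H3 by simp
  then show ?thesis by (simp add: borel_measurable_indicator borel_prod[symmetric])
qed

lemma emeasure_hvol:
  "A \<in> sets borel \<Longrightarrow> emeasure hvol A = (\<integral>\<^sup>+p. ennreal (indicator H3 p / snd p ^ 3) * indicator A p \<partial>lborel)"
  unfolding hvol_def by (subst emeasure_density) auto

lemma hvol_null:
  assumes "N \<in> null_sets lborel"
  shows "emeasure hvol N = 0"
proof -
  have N: "N \<in> sets borel" using assms by auto
  have "AE p in lborel. ennreal (indicator H3 p / snd p ^ 3) * indicator N p = 0"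
    using AE_not_in[OF assms] by eventually_elim auto
  then have "(\<integral>\<^sup>+p. ennreal (indicator H3 p / snd p ^ 3) * indicator N p \<partial>lborel) = (\<integral>\<^sup>+p. 0 \<partial>(lborel::point3 measure))"
    by (rule nn_integral_cong_AE)
  then show ?thesis using emeasure_hvol[OF N] by simp
qed

text \<open>The similarities \<open>q \<mapsto> (z, 0) + s q\<close> preserve \<^term>\<open>hvol\<close> and act transitively on
  \<^term>\<open>H3\<close>; consequently the volume of a hyperbolic ball depends on its radius alone.\<close>

lemma hvol_scaled_ball:
  assumes s: "0 < s"
  shows "emeasure hvol (ball (z, s * c) (s * \<rho>)) = emeasure hvol (ball (0, c) \<rho>)"
proof -
  let ?T = "\<lambda>q::point3. (z, 0) + s *\<^sub>R q"
  let ?f = "\<lambda>p::point3. ennreal (indicator H3 p / snd p ^ 3) * indicator (ball (z, s * c) (s * \<rho>)) p"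
  have [measurable]: "?f \<in> borel_measurable borel"
    by (intro borel_measurable_times_ennreal hvol_density_measurable borel_measurable_indicator) simp
  have Tm [measurable]: "?T \<in> borel_measurable borel" by (intro borel_measurable_continuous_onI continuous_intros)
  have "emeasure hvol (ball (z, s * c) (s * \<rho>)) = (\<integral>\<^sup>+p. ?f p \<partial>lborel)"
    by (rule emeasure_hvol) simp
  also have "\<dots> = (\<integral>\<^sup>+p. ?f p \<partial>(density (distr lborel borel ?T) (\<lambda>_. ennreal (\<bar>s\<bar> ^ DIM(point3)))))"
    using lborel_affine[of s "(z, 0)::point3"] s by simp
  also have "\<dots> = (\<integral>\<^sup>+q. ennreal (s ^ 3) * ?f (?T q) \<partial>lborel)"
    using s by (subst nn_integral_density, simp, simp, subst nn_integral_distr) auto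
  also have "\<dots> = (\<integral>\<^sup>+q. ennreal (indicator H3 q / snd q ^ 3) * indicator (ball (0, c) \<rho>) q \<partial>lborel)"
  proof (rule nn_integral_cong)
    fix q :: point3
    have H: "?T q \<in> H3 \<longleftrightarrow> q \<in> H3" using s by (simp add: H3_def zero_less_mult_iff)
    have "dist (z, s * c) (?T q) = s * dist (0, c) q"
    proof -
      have "(z, s * c) - ?T q = s *\<^sub>R ((0, c) - q)"
        by (cases q) (simp add: algebra_simps)
      then show ?thesis using s by (metis abs_of_pos dist_norm norm_scaleR)
    qed
    then have B: "?T q \<in> ball (z, s * c) (s * \<rho>) \<longleftrightarrow> q \<in> ball (0, c) \<rho>"
      using s by simp
    show "ennreal (s ^ 3) * ?f (?T q) = ennreal (indicator H3 q / snd q ^ 3) * indicator (ball (0, c) \<rho>) q"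
    proof (cases "q \<in> H3 \<and> q \<in> ball (0,c) \<rho>")
      case True
      then have q: "0 < snd q" by (simp add: H3_def)
      have "ennreal (s ^ 3) * ennreal (1 / snd (?T q) ^ 3) = ennreal (s ^ 3 * (1 / snd (?T q) ^ 3))"
        using s q by (intro ennreal_mult[symmetric]) auto
      also have "s ^ 3 * (1 / snd (?T q) ^ 3) = 1 / snd q ^ 3"
        using s q by (simp add: power_mult_distrib)
      finally show ?thesis using True H B by (simp add: indicator_def)
    next
      case False
      then show ?thesis using H B by (auto simp: indicator_def)
    qed
  qed
  also have "\<dots> = emeasure hvol (ball (0, c) \<rho>)"
    by (rule emeasure_hvol[symmetric]) simp
  finally show ?thesis .
qed

lemma hvol_hball_eq:
  assumes "p \<in> H3" "q \<in> H3" "0 < r"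
  shows "emeasure hvol (hball p r) = emeasure hvol (hball q r)"
proof -
  have "snd p > 0" "snd q > 0" using assms by (auto simp: H3_def)
  then show ?thesis unfolding hball_eq_ball[OF assms(1,3)] hball_eq_ball[OF assms(2,3)]
    using hvol_scaled_ball by metis
qed

text \<open>Above height \<open>1 / c n\<close> the density is at most \<open>c n ^ 3\<close>. Outer regularity of Lebesgue measure
  is applied on each of these slabs, with errors that sum to \<open>e\<close>.\<close>

lemma hvol_outer_regular:
  assumes B: "B \<in> sets borel" "B \<subseteq> H3" and e: "0 < (e::real)"
  obtains U where "open U" "B \<subseteq> U" "U \<subseteq> H3" "emeasure hvol U \<le> emeasure hvol B + e"
proof -
  define c where "c n = real (Suc n)" for n
  have c: "c n > 0" for n by (simp add: c_def)
  define H where "H n = {p::point3. 1 / c n < snd p}" for n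
  have oH: "open (H n)" for n unfolding H_def by (intro open_Collect_less continuous_intros)
  have H3H: "H n \<subseteq> H3" for n
    unfolding H_def H3_def using c[of n] by (auto intro: less_trans[of 0 "1 / c n"])
  have "\<exists>V. open V \<and> B \<inter> H n \<subseteq> V \<and> emeasure lborel (V - B \<inter> H n) \<le> ennreal (e * (1/2) ^ Suc n / c n ^ 3)" for n
    using outer_regular_lborel_le[of "B \<inter> H n" "e * (1/2) ^ Suc n / c n ^ 3"] B oH[of n] e c[of n]
    by (metis borel_open divide_pos_pos mult_pos_pos sets.Int zero_less_divide_1_iff zero_less_numeral zero_less_power)
  then obtain V where V: "open (V n)" "B \<inter> H n \<subseteq> V n"
      "emeasure lborel (V n - B \<inter> H n) \<le> ennreal (e * (1/2) ^ Suc n / c n ^ 3)" for n by metis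
  define U where "U n = V n \<inter> H n" for n
  have oU: "open (U n)" for n unfolding U_def using V oH by blast
  have bound: "emeasure hvol (U n - B \<inter> H n) \<le> ennreal (e * (1/2) ^ Suc n)" for n
  proof -
    have m: "U n - B \<inter> H n \<in> sets borel" using oU[of n] oH[of n] B by auto
    have "emeasure hvol (U n - B \<inter> H n) = (\<integral>\<^sup>+p. ennreal (indicator H3 p / snd p ^ 3) * indicator (U n - B \<inter> H n) p \<partial>lborel)"
      by (rule emeasure_hvol[OF m])
    also have "\<dots> \<le> (\<integral>\<^sup>+p. ennreal (c n ^ 3) * indicator (U n - B \<inter> H n) p \<partial>lborel)"
    proof (rule nn_integral_mono)
      fix p :: point3
      show "ennreal (indicator H3 p / snd p ^ 3) * indicator (U n - B \<inter> H n) p \<le> ennreal (c n ^ 3) * indicator (U n - B \<inter> H n) p"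
      proof (cases "p \<in> U n")
        case True
        then have p: "1 / c n < snd p" by (auto simp: U_def H_def)
        then have p0: "0 < snd p" using c[of n] by (auto intro: less_trans[of 0 "1 / c n"])
        have "1 / snd p \<le> c n" using p p0 c[of n] by (simp add: field_simps)
        then have "(1 / snd p) ^ 3 \<le> c n ^ 3" using p0 by (intro power_mono) auto
        then have "indicator H3 p / snd p ^ 3 \<le> c n ^ 3" using p0 c[of n] by (auto simp: indicator_def power_divide)
        then show ?thesis by (intro mult_right_mono ennreal_leI) auto
      qed auto
    qed
    also have "\<dots> = ennreal (c n ^ 3) * emeasure lborel (U n - B \<inter> H n)"
      using m by (simp add: nn_integral_cmult_indicator)
    also have "\<dots> \<le> ennreal (c n ^ 3) * emeasure lborel (V n - B \<inter> H n)"
    proof (intro mult_left_mono emeasure_mono)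
      show "V n - B \<inter> H n \<in> sets lborel" using V(1)[of n] oH[of n] B by auto
    qed (auto simp: U_def)
    also have "\<dots> \<le> ennreal (c n ^ 3) * ennreal (e * (1/2) ^ Suc n / c n ^ 3)"
      by (intro mult_left_mono V) auto
    also have "\<dots> = ennreal (c n ^ 3 * (e * (1/2) ^ Suc n / c n ^ 3))"
      using e c[of n] by (intro ennreal_mult[symmetric]) auto
    also have "\<dots> = ennreal (e * (1/2) ^ Suc n)" using c[of n] by simp
    finally show ?thesis .
  qed
  let ?U = "\<Union>n. U n"
  have BU: "B \<subseteq> ?U"
  proof
    fix p assume "p \<in> B"
    then have "0 < snd p" using B by (auto simp: H3_def)
    then obtain n where "1 / c n < snd p" using reals_Archimedean[of "snd p"] by (auto simp: c_def inverse_eq_divide)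
    then have "p \<in> U n" using V(2)[of n] \<open>p \<in> B\<close> by (auto simp: U_def H_def)
    then show "p \<in> ?U" by blast
  qed
  have "emeasure hvol (?U - B) \<le> emeasure hvol (\<Union>n. U n - B \<inter> H n)"
  proof (rule emeasure_mono)
    have "U n - B \<inter> H n \<in> sets borel" for n using oU[of n] oH[of n] B by auto
    then show "(\<Union>n. U n - B \<inter> H n) \<in> sets hvol" by auto
  qed auto
  also have "\<dots> \<le> (\<Sum>n. emeasure hvol (U n - B \<inter> H n))"
  proof (rule emeasure_subadditive_countably)
    have "U n - B \<inter> H n \<in> sets borel" for n using oU[of n] oH[of n] B by auto
    then show "range (\<lambda>n. U n - B \<inter> H n) \<subseteq> sets hvol" by auto
  qed
  also have "\<dots> \<le> (\<Sum>n. ennreal (e * (1/2) ^ Suc n))"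
    by (intro suminf_le bound) auto
  also have "\<dots> = ennreal e"
  proof (rule suminf_ennreal_eq)
    show "(\<lambda>n. e * (1/2) ^ Suc n) sums e" using sums_mult[OF power_half_series, of e] by simp
  qed (use e in auto)
  finally have d: "emeasure hvol (?U - B) \<le> ennreal e" .
  have "emeasure hvol ?U \<le> emeasure hvol B + emeasure hvol (?U - B)"
  proof -
    have "open ?U" using oU by blast
    then have "?U - B \<in> sets hvol" "B \<in> sets hvol" using B by auto
    then have "emeasure hvol (B \<union> (?U - B)) \<le> emeasure hvol B + emeasure hvol (?U - B)"
      by (intro emeasure_subadditive)
    moreover have "B \<union> (?U - B) = ?U" using BU by blast
    ultimately show ?thesis by (simp only:)
  qed
  also have "\<dots> \<le> emeasure hvol B + e" using d by (intro add_left_mono)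
  finally have "emeasure hvol ?U \<le> emeasure hvol B + e" .
  moreover have "open ?U" using oU by blast
  moreover have "?U \<subseteq> H3" using H3H by (auto simp: U_def)
  ultimately show ?thesis using that BU by blast
qed

text \<open>By the formula for \<^term>\<open>hdist\<close>, a distance-preserving map is Lipschitz near every point for
  the Euclidean metric, with constant governed by the two heights.\<close>

lemma isometry_euclidean_Lipschitz:
  assumes "E \<subseteq> H3" "f ` E \<subseteq> H3" "\<And>u v. u \<in> E \<Longrightarrow> v \<in> E \<Longrightarrow> hdist (f u) (f v) = hdist u v" "x \<in> E"
  shows "\<exists>T B. open T \<and> x \<in> T \<and> (\<forall>y \<in> E \<inter> T. norm (f y - f x) \<le> B * norm (y - x))"
proof -
  have x: "x \<in> H3" "f x \<in> H3" using assms by auto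
  define T where "T = hball x 1"
  \<comment> \<open>The heights of \<open>y\<close> and \<open>f y\<close> differ from those of \<open>x\<close> and \<open>f x\<close> by a factor of at most \<open>exp 1\<close>.\<close>
  define B where "B = exp 1 * snd (f x) / snd x"
  have sx: "snd x > 0" "snd (f x) > 0" using x by (auto simp: H3_def)
  have "norm (f y - f x) \<le> B * norm (y - x)" if y: "y \<in> E \<inter> T" for y
  proof -
    have yH: "y \<in> H3" "f y \<in> H3" using y assms by auto
    then have sy: "snd y > 0" "snd (f y) > 0" by (auto simp: H3_def)
    have d: "hdist x y < 1" "hdist (f x) (f y) < 1" using y assms by (auto simp: T_def)
    have "ln (snd x) \<le> 1 + ln (snd y)" using ln_height_le_hdist[OF x(1) yH(1)] d by linarith
    then have "exp (ln (snd x)) \<le> exp (1 + ln (snd y))" by simp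
    then have 1: "snd x \<le> exp 1 * snd y" using sx sy by (simp add: exp_add)
    have "ln (snd (f y)) \<le> 1 + ln (snd (f x))" using ln_height_le_hdist[OF x(2) yH(2)] d by linarith
    then have "exp (ln (snd (f y))) \<le> exp (1 + ln (snd (f x)))" by simp
    then have 2: "snd (f y) \<le> exp 1 * snd (f x)" using sx sy by (simp add: exp_add)
    have "cosh (hdist (f x) (f y)) = cosh (hdist x y)" using y assms by auto
    then have "(dist (f x) (f y))\<^sup>2 / (2 * snd (f x) * snd (f y)) = (dist x y)\<^sup>2 / (2 * snd x * snd y)"
      using cosh_hdist[OF x(1) yH(1)] cosh_hdist[OF x(2) yH(2)] by simp
    then have "(dist (f x) (f y))\<^sup>2 = (dist x y)\<^sup>2 * ((snd (f x) * snd (f y)) / (snd x * snd y))"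
      using sx sy by (simp add: field_simps)
    also have "\<dots> \<le> (dist x y)\<^sup>2 * B\<^sup>2"
    proof (rule mult_left_mono)
      have "snd (f x) * snd (f y) * snd x \<le> snd (f x) * (exp 1 * snd (f x)) * (exp 1 * snd y)"
        using 1 2 sx sy by (intro mult_mono) auto
      then have "snd (f x) * snd (f y) / (snd x * snd y) \<le> exp 1 * snd (f x) * (exp 1 * snd (f x)) / (snd x * snd x)"
        using sx sy by (simp add: field_simps)
      then show "snd (f x) * snd (f y) / (snd x * snd y) \<le> B\<^sup>2"
        by (simp add: B_def power2_eq_square)
    qed auto
    also have "\<dots> = (B * dist x y)\<^sup>2" by (simp add: power_mult_distrib mult.commute)
    finally have "dist (f x) (f y) \<le> B * dist x y"
      by (rule power2_le_imp_le) (use sx in \<open>auto simp: B_def\<close>)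
    then show ?thesis by (simp add: dist_norm norm_minus_commute)
  qed
  moreover have "open T" "x \<in> T" unfolding T_def using open_hball[OF x(1)] x by auto
  ultimately show ?thesis by blast
qed

text \<open>Cover \<open>E\<close>, up to a null set, by disjoint hyperbolic balls centred in \<open>E\<close> whose total
  volume barely exceeds that of \<open>E\<close>. The image of each is contained in a hyperbolic ball of the
  same radius, which has the same volume, and Lipschitz maps preserve null sets.\<close>

lemma hvol_isometric_image_le:
  assumes E: "E \<in> sets borel" "E \<subseteq> H3" and f: "f ` E \<in> sets borel" "f ` E \<subseteq> H3"
    and iso: "\<And>u v. u \<in> E \<Longrightarrow> v \<in> E \<Longrightarrow> hdist (f u) (f v) = hdist u v"
  shows "emeasure hvol (f ` E) \<le> emeasure hvol E"
proof (rule ennreal_le_epsilon)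
  fix e :: real assume e: "0 < e"
  obtain U where U: "open U" "E \<subseteq> U" "U \<subseteq> H3" "emeasure hvol U \<le> emeasure hvol E + e"
    using hvol_outer_regular[OF E e] by metis
  let ?b = "\<lambda>i::point3 \<times> real. ball (fst (fst i), snd (fst i) * cosh (snd i)) (snd (fst i) * sinh (snd i))"
  define K where "K = {(p, r). p \<in> E \<and> 0 < r \<and> hball p r \<subseteq> U}"
  have bK: "?b i = hball (fst i) (snd i)" if "i \<in> K" for i
  proof -
    have "fst i \<in> H3" "0 < snd i" using that E by (auto simp: K_def)
    then show ?thesis by (simp add: hball_eq_ball)
  qed
  have Vit: "\<exists>i. i \<in> K \<and> x \<in> ?b i \<and> snd (fst i) * sinh (snd i) < d" if x: "x \<in> E" and d: "0 < d" for x d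
  proof -
    have xH: "x \<in> H3" using x E by blast
    then have sx: "snd x > 0" by (simp add: H3_def)
    obtain \<delta> where \<delta>: "\<delta> > 0" "ball x \<delta> \<subseteq> U" using U x by (meson openE subsetD)
    obtain r0 where r0: "0 < r0" "\<And>q. q \<in> H3 \<Longrightarrow> hdist x q < r0 \<Longrightarrow> dist x q < \<delta>"
      using hdist_small_imp_dist_small[OF xH \<delta>(1)] by metis
    define r where "r = min r0 (arsinh (d / (2 * snd x)))"
    have ra: "0 < arsinh (d / (2 * snd x))" using d sx by simp
    then have r: "0 < r" "r \<le> r0" using r0 by (auto simp: r_def)
    have "sinh r \<le> d / (2 * snd x)"
      using sinh_real_le_iff[of r "arsinh (d / (2 * snd x))"] by (simp add: r_def)
    then have "snd x * sinh r \<le> d / 2" using sx by (simp add: field_simps)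
    then have "snd x * sinh r < d" using d by linarith
    moreover have "(x, r) \<in> K" unfolding K_def using x r r0 \<delta> by auto
    moreover have "x \<in> ?b (x, r)" using bK[OF \<open>(x, r) \<in> K\<close>] xH r by simp
    ultimately show ?thesis by (intro exI[of _ "(x, r)"]) simp
  qed
  obtain C where C: "countable C" "C \<subseteq> K" "pairwise (\<lambda>i j. disjnt (?b i) (?b j)) C"
      and neg: "negligible (E - (\<Union>i \<in> C. ?b i))"
  proof (rule Vitali_covering_theorem_balls[of E K "\<lambda>i. (fst (fst i), snd (fst i) * cosh (snd i))"
        "\<lambda>i. snd (fst i) * sinh (snd i)"])
    fix x d assume "x \<in> E" "0 < (d::real)"
    then show "\<exists>i. i \<in> K \<and> x \<in> ?b i \<and> snd (fst i) * sinh (snd i) < d" by (rule Vit)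
  qed
  let ?R = "E - (\<Union>i \<in> C. ?b i)"
  have "negligible (f ` ?R)"
  proof (rule negligible_locally_Lipschitz_image[OF _ neg])
    fix x assume "x \<in> ?R"
    then have "x \<in> E" by blast
    from isometry_euclidean_Lipschitz[OF E(2) f(2) iso this]
    show "\<exists>T B. open T \<and> x \<in> T \<and> (\<forall>y \<in> ?R \<inter> T. norm (f y - f x) \<le> B * norm (y - x))" by blast
  qed simp
  then obtain N where N: "N \<in> null_sets lborel" "f ` ?R \<subseteq> N"
    unfolding negligible_iff_null_sets null_sets_completion_iff2 by blast
  let ?I = "to_nat_on C ` C"
  let ?g = "from_nat_into C"
  define X where "X n = (if n \<in> ?I then ?b (?g n) else {})" for n
  define Y where "Y n = (if n \<in> ?I then (hball (f (fst (?g n))) (snd (?g n))) else {})" for n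
  have gC: "?g n \<in> C" if "n \<in> ?I" for n using that C(1) by auto
  have Xm: "X n \<in> sets borel" for n unfolding X_def by auto
  have fH: "f (fst i) \<in> H3" "fst i \<in> H3" "0 < snd i" if "i \<in> C" for i
  proof -
    have "i \<in> K" using that C by blast
    then have "fst i \<in> E" "0 < snd i" by (auto simp: K_def)
    then show "f (fst i) \<in> H3" "fst i \<in> H3" "0 < snd i" using f E by auto
  qed
  have Ym: "Y n \<in> sets borel" for n
    unfolding Y_def using open_hball[OF fH(1)[OF gC[of n]], of "snd (?g n)"] by auto
  have XY: "emeasure hvol (Y n) = emeasure hvol (X n)" for n
  proof (cases "n \<in> ?I")
    case True
    then have "?g n \<in> K" using gC C(2) by blast
    then show ?thesis using True bK[of "?g n"] hvol_hball_eq[OF fH[OF gC[OF True]]]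
      by (simp add: X_def Y_def)
  qed (simp add: X_def Y_def)
  have disj: "disjoint_family X"
    unfolding disjoint_family_on_def
  proof (intro ballI impI)
    fix m n :: nat assume mn: "m \<noteq> n"
    show "X m \<inter> X n = {}"
    proof (cases "m \<in> ?I \<and> n \<in> ?I")
      case True
      then have "?g m \<noteq> ?g n" using mn C(1) by (metis image_iff to_nat_on_from_nat_into)
      then show ?thesis using C(3) gC True by (auto simp: X_def pairwise_def disjnt_def)
    qed (auto simp: X_def)
  qed
  have XU: "(\<Union>n. X n) \<subseteq> U"
  proof (clarify)
    fix q n assume q: "q \<in> X n"
    then have n: "n \<in> ?I" by (auto simp: X_def split: if_splits)
    then have gK: "?g n \<in> K" using gC C by blast
    have "q \<in> hball (fst (?g n)) (snd (?g n))"
      using q n bK[OF gK] by (simp add: X_def)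
    moreover have "hball (fst (?g n)) (snd (?g n)) \<subseteq> U"
      using gK by (auto simp: K_def)
    ultimately show "q \<in> U" by blast
  qed
  have cover: "f ` E \<subseteq> N \<union> (\<Union>n. Y n)"
  proof
    fix y assume "y \<in> f ` E"
    then obtain u where u: "u \<in> E" "y = f u" by blast
    show "y \<in> N \<union> (\<Union>n. Y n)"
    proof (cases "u \<in> ?R")
      case True then show ?thesis using N u by blast
    next
      case False
      then obtain i where i: "i \<in> C" "u \<in> ?b i" using u by blast
      have iK: "i \<in> K" using i C by blast
      have "hdist (fst i) u < snd i" using i bK[OF iK] by auto
      moreover have "fst i \<in> E" using iK by (auto simp: K_def)
      then have "hdist (f (fst i)) (f u) = hdist (fst i) u" using iso u(1) by blast
      ultimately have "f u \<in> Y (to_nat_on C i)"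
        using i(1) C(1) f u by (auto simp: Y_def)
      then show ?thesis using u by blast
    qed
  qed
  have "emeasure hvol (f ` E) \<le> emeasure hvol (N \<union> (\<Union>n. Y n))"
    using cover N Ym by (intro emeasure_mono) auto
  also have "\<dots> \<le> emeasure hvol N + emeasure hvol (\<Union>n. Y n)"
    using N Ym by (intro emeasure_subadditive) auto
  also have "\<dots> = emeasure hvol (\<Union>n. Y n)" using hvol_null[OF N(1)] by simp
  also have "\<dots> \<le> (\<Sum>n. emeasure hvol (Y n))" using Ym by (intro emeasure_subadditive_countably) auto
  also have "\<dots> = (\<Sum>n. emeasure hvol (X n))" by (simp add: XY)
  also have "\<dots> = emeasure hvol (\<Union>n. X n)" using Xm disj by (intro suminf_emeasure) auto
  also have "\<dots> \<le> emeasure hvol U" using XU U(1) by (intro emeasure_mono) auto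
  also have "\<dots> \<le> emeasure hvol E + e" by (rule U(4))
  finally show "emeasure hvol (f ` E) \<le> emeasure hvol E + e" .
qed

text \<open>The inequality also applies to the inverse map.\<close>

lemma hvol_isometric_image:
  assumes E: "E \<in> sets borel" "E \<subseteq> H3" and f: "f ` E \<in> sets borel" "f ` E \<subseteq> H3"
    and iso: "\<And>u v. u \<in> E \<Longrightarrow> v \<in> E \<Longrightarrow> hdist (f u) (f v) = hdist u v"
  shows "emeasure hvol (f ` E) = emeasure hvol E"
proof (rule antisym)
  show "emeasure hvol (f ` E) \<le> emeasure hvol E" by (rule hvol_isometric_image_le[OF assms])
  have inj: "inj_on f E"
    using iso hdist_eq_0_iff E f by (intro inj_onI) (metis hdist_self subsetD)
  let ?h = "inv_into E f"
  have im: "?h ` (f ` E) = E" using inj by (auto simp: inv_into_f_f image_iff)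
  have "emeasure hvol (?h ` (f ` E)) \<le> emeasure hvol (f ` E)"
    using E f iso inj by (intro hvol_isometric_image_le) (auto simp: im)
  then show "emeasure hvol E \<le> emeasure hvol (f ` E)" by (simp add: im)
qed

lemma hvol_hisometric_eq:
  assumes "hisometric B \<phi>" "hisometric B \<psi>" "\<phi> ` B \<in> sets borel" "\<psi> ` B \<in> sets borel"
  shows "emeasure hvol (\<phi> ` B) = emeasure hvol (\<psi> ` B)"
proof -
  let ?f = "\<lambda>q. \<psi> (inv_into B \<phi> q)"
  have inj: "inj_on \<phi> B" by (rule hisometric_inj_on[OF assms(1)])
  have im: "?f ` (\<phi> ` B) = \<psi> ` B" using inj by (auto simp: inv_into_f_f image_iff)
  have "emeasure hvol (?f ` (\<phi> ` B)) = emeasure hvol (\<phi> ` B)"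
    using assms inj by (intro hvol_isometric_image) (auto simp: im hisometric_def)
  then show ?thesis by (simp add: im)
qed

section \<open>Volume as a Borel measure\<close>

definition charted :: "'a::metric_space itself \<Rightarrow> bool" where
  "charted (_ :: 'a itself) \<longleftrightarrow> (\<forall>x::'a. \<exists>W r \<phi>. W \<in> {H3, H3_half} \<and> chart W x r \<phi>)"

lemma charted_at:
  assumes "charted TYPE('a::metric_space)"
  obtains W r \<phi> where "W \<in> {H3, H3_half}" "chart W (x::'a) r \<phi>"
  using assms unfolding charted_def by metis

lemma hyperbolic_3_manifold_charted:
  "hyperbolic_3_manifold TYPE('a::metric_space) \<Longrightarrow> charted TYPE('a)"
  unfolding hyperbolic_3_manifold_def charted_def bdry_def boundary_chart_def by blast

lemma chart_piece_borel:
  assumes "chart_piece B \<phi>"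
  shows "B \<in> sets borel" "\<phi> ` B \<in> sets borel" "hisometric B \<phi>"
proof -
  obtain W x r where c: "W \<in> {H3, H3_half}" "chart W x r \<phi>" "B \<subseteq> ball x r" "\<phi> ` B \<in> sets borel"
    using assms unfolding chart_piece_def by blast
  note iso = chart_hisometric[OF c(1,2)]
  have "ball x r \<inter> \<phi> -` (\<phi> ` B) = B" using hisometric_inj_on[OF iso] c(3) unfolding inj_on_def by blast
  moreover have "ball x r \<inter> \<phi> -` (\<phi> ` B) \<in> sets borel"
    by (rule borel_vimage_continuous_on[OF hisometric_continuous_on[OF iso] _ c(4)]) simp
  ultimately show "B \<in> sets borel" by (simp only:)
  show "\<phi> ` B \<in> sets borel" by fact
  show "hisometric B \<phi>" using hisometric_subset[OF iso c(3)] .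
qed

lemma chart_piece_Int:
  assumes "chart_piece B \<phi>" "A \<in> sets borel"
  shows "chart_piece (B \<inter> A) \<phi>"
proof -
  have "\<phi> ` (B \<inter> A) \<in> sets borel"
    using hisometric_image_borel chart_piece_borel[OF assms(1)] assms(2) by blast
  then show ?thesis using assms(1) unfolding chart_piece_def by blast
qed

lemma chart_piece_empty:
  assumes "charted TYPE('a::metric_space)"
  obtains \<phi> where "chart_piece ({} :: 'a set) \<phi>"
  using assms unfolding charted_def chart_piece_def by (metis empty_subsetI image_empty sets.empty_sets)

lemma vol_le_cover:
  assumes "\<And>n::nat. chart_piece (B n) (\<phi> n)" "A \<subseteq> (\<Union>n. B n)"
  shows "vol A \<le> (\<Sum>n. emeasure hvol (\<phi> n ` B n))"
  unfolding vol_def by (rule INF_lower2[of "(B, \<phi>)"]) (use assms in auto)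

lemma vol_greatest:
  assumes "\<And>B \<phi>. (\<And>n::nat. chart_piece (B n) (\<phi> n)) \<Longrightarrow> A \<subseteq> (\<Union>n. B n) \<Longrightarrow> z \<le> (\<Sum>n. emeasure hvol (\<phi> n ` B n))"
  shows "z \<le> vol A"
  unfolding vol_def by (rule INF_greatest) (use assms in auto)

lemma vol_mono: "A \<subseteq> A' \<Longrightarrow> vol A \<le> vol A'"
  by (rule vol_greatest, rule vol_le_cover) auto

lemma vol_le_piece:
  assumes "charted TYPE('a::metric_space)" "chart_piece (B :: 'a set) \<phi>"
  shows "vol B \<le> emeasure hvol (\<phi> ` B)"
proof -
  obtain \<phi>0 where 0: "chart_piece ({} :: 'a set) \<phi>0" using chart_piece_empty[OF assms(1)] .
  let ?B = "\<lambda>n::nat. if n = 0 then B else {}"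
  let ?f = "\<lambda>n::nat. if n = 0 then \<phi> else \<phi>0"
  have "vol B \<le> (\<Sum>n. emeasure hvol (?f n ` ?B n))"
    using 0 assms by (intro vol_le_cover) (auto split: if_splits)
  also have "\<dots> = (\<Sum>n\<in>{0}. emeasure hvol (?f n ` ?B n))" by (intro suminf_finite) auto
  finally show ?thesis by simp
qed

lemma vol_empty:
  assumes "charted TYPE('a::metric_space)"
  shows "vol ({} :: 'a set) = 0"
proof -
  obtain \<phi>0 where "chart_piece ({} :: 'a set) \<phi>0" using chart_piece_empty[OF assms] .
  from vol_le_piece[OF assms this] show ?thesis by simp
qed

lemma vol_countably_subadditive:
  fixes A :: "nat \<Rightarrow> 'a::metric_space set"
  shows "vol (\<Union>i. A i) \<le> (\<Sum>i. vol (A i))"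
proof (rule ennreal_le_epsilon)
  fix e :: real assume top: "(\<Sum>i. vol (A i)) < top" and e: "0 < e"
  have fin: "vol (A i) < top" for i
    by (rule ennreal_suminf_lessD[OF top])
  define good where "good i c \<longleftrightarrow> (\<forall>n::nat. chart_piece (fst c n) (snd c n)) \<and> A i \<subseteq> (\<Union>n. fst c n) \<and>
     (\<Sum>n. emeasure hvol (snd c n ` fst c n)) \<le> vol (A i) + ennreal (e * (1/2) ^ Suc i)" for i c
  have "\<exists>c. good i c" for i
  proof -
    have "0 < e * (1/2) ^ Suc i" using e by simp
    from INF_approx_ennreal[OF this vol_def[of "A i"]] fin[of i]
    obtain B \<phi> where "\<forall>n::nat. chart_piece (B n) (\<phi> n)" "A i \<subseteq> (\<Union>n. B n)"
       "(\<Sum>n. emeasure hvol (\<phi> n ` B n)) < vol (A i) + ennreal (e * (1/2) ^ Suc i)"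
      by (auto simp: less_top)
    then have "good i (B, \<phi>)" by (simp add: good_def less_imp_le)
    then show ?thesis by blast
  qed
  then have "\<exists>c. \<forall>i. good i (c i)" by (intro choice allI)
  then obtain c where c: "good i (c i)" for i by blast
  define B where "B i = fst (c i)" for i
  define \<phi> where "\<phi> i = snd (c i)" for i
  have B: "\<And>i n::nat. chart_piece (B i n) (\<phi> i n)" "\<And>i. A i \<subseteq> (\<Union>n. B i n)"
      "\<And>i. (\<Sum>n. emeasure hvol (\<phi> i n ` B i n)) \<le> vol (A i) + ennreal (e * (1/2) ^ Suc i)"
    using c by (simp_all add: good_def B_def \<phi>_def)
  let ?B = "\<lambda>k. case prod_decode k of (i, n) \<Rightarrow> B i n"
  let ?f = "\<lambda>k. case prod_decode k of (i, n) \<Rightarrow> \<phi> i n"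
  have cov: "(\<Union>i. A i) \<subseteq> (\<Union>k. ?B k)"
  proof
    fix x assume "x \<in> (\<Union>i. A i)"
    then obtain i where "x \<in> A i" by blast
    then obtain n where "x \<in> B i n" using B(2)[of i] by blast
    then have "x \<in> ?B (prod_encode (i, n))" by simp
    then show "x \<in> (\<Union>k. ?B k)" by (rule UN_I[OF UNIV_I])
  qed
  have "vol (\<Union>i. A i) \<le> (\<Sum>k. emeasure hvol (?f k ` ?B k))"
  proof (rule vol_le_cover[OF _ cov])
    show "chart_piece (?B k) (?f k)" for k by (cases "prod_decode k") (simp add: B(1))
  qed
  also have "\<dots> = (\<Sum>k. (\<lambda>(i, n). emeasure hvol (\<phi> i n ` B i n)) (prod_decode k))"
    by (intro suminf_cong) (simp add: case_prod_beta)
  also have "\<dots> = (\<Sum>i. \<Sum>n. emeasure hvol (\<phi> i n ` B i n))"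
    by (subst suminf_ennreal_2dimen[where g="\<lambda>i. \<Sum>n. emeasure hvol (\<phi> i n ` B i n)"]) (auto simp: o_def)
  also have "\<dots> \<le> (\<Sum>i. vol (A i) + ennreal (e * (1/2) ^ Suc i))"
    by (intro suminf_le B) auto
  also have "\<dots> = (\<Sum>i. vol (A i)) + (\<Sum>i. ennreal (e * (1/2) ^ Suc i))"
    by (intro suminf_add[symmetric]) auto
  also have "(\<Sum>i. ennreal (e * (1/2) ^ Suc i)) = ennreal e"
  proof (rule suminf_ennreal_eq)
    show "(\<lambda>n. e * (1/2) ^ Suc n) sums e" using sums_mult[OF power_half_series, of e] by simp
  qed (use e in auto)
  finally show "vol (\<Union>i. A i) \<le> (\<Sum>i. vol (A i)) + ennreal e" .
qed

text \<open>A Borel set splits every chart piece into two chart pieces, so it is measurable for the outer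
  measure \<^term>\<open>vol\<close> in the sense of Caratheodory.\<close>

lemma vol_split:
  assumes "A \<in> sets borel"
  shows "vol (X \<inter> A) + vol (X - A) \<le> vol X"
proof (rule vol_greatest)
  fix B :: "nat \<Rightarrow> 'a set" and \<phi>
  assume c: "\<And>n. chart_piece (B n) (\<phi> n)" and X: "X \<subseteq> (\<Union>n. B n)"
  have A': "- A \<in> sets borel" using assms by auto
  have "vol (X \<inter> A) \<le> (\<Sum>n. emeasure hvol (\<phi> n ` (B n \<inter> A)))"
    using X by (intro vol_le_cover chart_piece_Int[OF c assms]) auto
  moreover have "vol (X - A) \<le> (\<Sum>n. emeasure hvol (\<phi> n ` (B n \<inter> - A)))"
    using X by (intro vol_le_cover chart_piece_Int[OF c A']) auto
  ultimately have "vol (X \<inter> A) + vol (X - A)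
      \<le> (\<Sum>n. emeasure hvol (\<phi> n ` (B n \<inter> A))) + (\<Sum>n. emeasure hvol (\<phi> n ` (B n \<inter> - A)))"
    by (rule add_mono)
  also have "\<dots> = (\<Sum>n. emeasure hvol (\<phi> n ` (B n \<inter> A)) + emeasure hvol (\<phi> n ` (B n \<inter> - A)))"
    by (intro suminf_add) auto
  also have "\<dots> = (\<Sum>n. emeasure hvol (\<phi> n ` B n))"
  proof (rule suminf_cong)
    fix n
    have inj: "inj_on (\<phi> n) (B n)" using chart_piece_borel[OF c] hisometric_inj_on by blast
    then have "\<phi> n ` (B n \<inter> A) \<inter> \<phi> n ` (B n \<inter> - A) = {}" by (auto simp: inj_on_def)
    moreover have "\<phi> n ` (B n \<inter> A) \<union> \<phi> n ` (B n \<inter> - A) = \<phi> n ` B n" by blast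
    moreover have "\<phi> n ` (B n \<inter> A) \<in> sets hvol" "\<phi> n ` (B n \<inter> - A) \<in> sets hvol"
      using chart_piece_borel[OF chart_piece_Int[OF c assms]] chart_piece_borel[OF chart_piece_Int[OF c A']] by auto
    ultimately show "emeasure hvol (\<phi> n ` (B n \<inter> A)) + emeasure hvol (\<phi> n ` (B n \<inter> - A)) = emeasure hvol (\<phi> n ` B n)"
      using plus_emeasure by metis
  qed
  finally show "vol (X \<inter> A) + vol (X - A) \<le> (\<Sum>n. emeasure hvol (\<phi> n ` B n))" .
qed

definition volume :: "'a::metric_space measure" where
  "volume = measure_of UNIV (sets borel) vol"

lemma sets_volume [simp, measurable_cong]: "sets volume = sets borel"
  by (simp add: volume_def sets.sigma_sets_eq[of borel, simplified])

lemma emeasure_volume: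
  assumes ch: "charted TYPE('a::metric_space)" and A: "(A :: 'a set) \<in> sets borel"
  shows "emeasure volume A = vol A"
proof -
  have oms: "outer_measure_space (Pow UNIV) (vol :: 'a set \<Rightarrow> ennreal)"
    unfolding outer_measure_space_def positive_def increasing_def countably_subadditive_def
    by (simp add: vol_empty[OF ch] vol_mono vol_countably_subadditive)
  let ?L = "lambda_system UNIV (Pow UNIV) (vol :: 'a set \<Rightarrow> ennreal)"
  have ms: "measure_space UNIV ?L (vol :: 'a set \<Rightarrow> ennreal)"
    by (rule sigma_algebra.caratheodory_lemma[OF sigma_algebra_Pow oms])
  have sub: "sets borel \<subseteq> ?L"
  proof
    fix A :: "'a set" assume A: "A \<in> sets borel"
    have "vol (A \<inter> X) + vol ((UNIV - A) \<inter> X) = vol X" for X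
    proof (rule antisym)
      show "vol (A \<inter> X) + vol ((UNIV - A) \<inter> X) \<le> vol X"
      proof -
        have "A \<inter> X = X \<inter> A" "(UNIV - A) \<inter> X = X - A" by blast+
        then show ?thesis using vol_split[OF A, of X] by (simp only:)
      qed
      let ?A = "\<lambda>i::nat. if i = 0 then A \<inter> X else if i = 1 then (UNIV - A) \<inter> X else {}"
      have "vol X \<le> vol (\<Union>i. ?A i)"
      proof (rule vol_mono, rule subsetI)
        fix x assume "x \<in> X"
        then have "x \<in> ?A 0 \<or> x \<in> ?A 1" by auto
        then show "x \<in> (\<Union>i. ?A i)" by blast
      qed
      also have "\<dots> \<le> (\<Sum>i. vol (?A i))" by (rule vol_countably_subadditive)
      also have "\<dots> = (\<Sum>i\<in>{0,1}. vol (?A i))"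
        using vol_empty[OF ch] by (intro suminf_finite) auto
      finally show "vol X \<le> vol (A \<inter> X) + vol ((UNIV - A) \<inter> X)" by simp
    qed
    then show "A \<in> ?L" by (simp add: lambda_system_def)
  qed
  have "countably_additive (sets borel) (vol :: 'a set \<Rightarrow> ennreal)"
    using ms sub unfolding measure_space_def countably_additive_def by (meson order_trans subsetD)
  moreover have "positive (sets borel) (vol :: 'a set \<Rightarrow> ennreal)"
    using vol_empty[OF ch] by (simp add: positive_def)
  moreover have "sigma_algebra UNIV (sets (borel :: 'a measure))"
    using sets.sigma_algebra_axioms[of "borel :: 'a measure"] by simp
  ultimately show ?thesis unfolding volume_def using A by (intro emeasure_measure_of_sigma)
qed

text \<open>The infimum in the definition of \<^term>\<open>vol\<close> is attained by one piece: cut any competing cover along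
  \<open>B\<close>; by isometry invariance each part has the same volume in its own chart as under \<open>\<psi>\<close>.\<close>

lemma vol_isometric_piece:
  assumes ch: "charted TYPE('a::metric_space)"
    and B: "(B :: 'a set) \<in> sets borel" "W \<in> {H3, H3_half}" "chart W x r \<phi>" "B \<subseteq> ball x r"
    and \<psi>: "hisometric B \<psi>" "\<psi> ` B \<in> sets borel"
  shows "vol B = emeasure hvol (\<psi> ` B)"
proof (rule antisym)
  note iso = chart_hisometric[OF B(2,3)]
  have "\<phi> ` (ball x r \<inter> B) \<in> sets borel"
    by (rule hisometric_image_borel[OF iso chart_image_borel[OF B(2,3)] B(1)])
  then have \<phi>B: "\<phi> ` B \<in> sets borel" using B(4) by (simp add: Int_absorb1)
  have cp: "chart_piece B \<phi>" unfolding chart_piece_def using B \<phi>B by blast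
  have "vol B \<le> emeasure hvol (\<phi> ` B)" by (rule vol_le_piece[OF ch cp])
  also have "\<dots> = emeasure hvol (\<psi> ` B)"
    by (rule hvol_hisometric_eq[OF hisometric_subset[OF iso B(4)] \<psi>(1) \<phi>B \<psi>(2)])
  finally show "vol B \<le> emeasure hvol (\<psi> ` B)" .
  show "emeasure hvol (\<psi> ` B) \<le> vol B"
  proof (rule vol_greatest)
    fix C \<phi>' assume c: "\<And>n::nat. chart_piece (C n) (\<phi>' n)" and cov: "B \<subseteq> (\<Union>n. C n)"
    have m: "\<psi> ` (B \<inter> C n) \<in> sets borel" for n
      by (rule hisometric_image_borel[OF \<psi> chart_piece_borel(1)[OF c]])
    have eq: "\<psi> ` B = (\<Union>n. \<psi> ` (B \<inter> C n))" using cov by blast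
    have r: "range (\<lambda>n. \<psi> ` (B \<inter> C n)) \<subseteq> sets hvol" using m by (simp add: image_subset_iff)
    have "emeasure hvol (\<psi> ` B) = emeasure hvol (\<Union>n. \<psi> ` (B \<inter> C n))" by (rule arg_cong[OF eq])
    also have "\<dots> \<le> (\<Sum>n. emeasure hvol (\<psi> ` (B \<inter> C n)))" by (rule emeasure_subadditive_countably[OF r])
    also have "\<dots> \<le> (\<Sum>n. emeasure hvol (\<phi>' n ` C n))"
    proof (intro suminf_le)
      fix n
      have cp: "chart_piece (C n \<inter> B) (\<phi>' n)" by (rule chart_piece_Int[OF c B(1)])
      have "emeasure hvol (\<psi> ` (B \<inter> C n)) = emeasure hvol (\<phi>' n ` (B \<inter> C n))"
        using chart_piece_borel[OF cp] m[of n] hisometric_subset[OF \<psi>(1), of "B \<inter> C n"]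
        by (intro hvol_hisometric_eq) (auto simp: Int_commute)
      also have "\<dots> \<le> emeasure hvol (\<phi>' n ` C n)"
        using chart_piece_borel[OF c] by (intro emeasure_mono) auto
      finally show "emeasure hvol (\<psi> ` (B \<inter> C n)) \<le> emeasure hvol (\<phi>' n ` C n)" .
    qed auto
    finally show "emeasure hvol (\<psi> ` B) \<le> (\<Sum>n. emeasure hvol (\<phi>' n ` C n))" .
  qed
qed

text \<open>By the Lindeloef property the parameter domain is cut into countably many Borel pieces on each of
  which \<open>G\<close> is an isometry into a single chart. Fundamental domains of cusps and Fermi coordinates
  along the boundary are both parametrisations of this kind.\<close>

lemma vol_locally_isometric_image:
  fixes G :: "point3 \<Rightarrow> 'a::metric_space"
  assumes ch: "charted TYPE('a)"
    and Y: "Y \<in> sets borel" "Y \<subseteq> H3" "inj_on G Y"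
    and loc: "\<And>p. p \<in> Y \<Longrightarrow> \<exists>V. open V \<and> p \<in> V \<and>
        (\<forall>u\<in>Y \<inter> V. \<forall>v\<in>Y \<inter> V. dist (G u) (G v) = hdist u v) \<and>
        (\<forall>Q\<in>sets borel. G ` (Y \<inter> V \<inter> Q) \<in> sets borel)"
  shows "vol (G ` Y) = emeasure hvol Y" "G ` Y \<in> sets borel"
proof -
  define good where "good V \<longleftrightarrow> open V \<and>
        (\<forall>u\<in>Y \<inter> V. \<forall>v\<in>Y \<inter> V. dist (G u) (G v) = hdist u v) \<and>
        (\<forall>Q\<in>sets borel. G ` (Y \<inter> V \<inter> Q) \<in> sets borel) \<and>
        (\<exists>W x r \<phi>. W \<in> {H3, H3_half} \<and> chart W x r \<phi> \<and> G ` (Y \<inter> V) \<subseteq> ball x r)" for V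
  have "\<exists>V. good V \<and> p \<in> V" if p: "p \<in> Y" for p
  proof -
    obtain V where "open V \<and> p \<in> V \<and>
        (\<forall>u\<in>Y \<inter> V. \<forall>v\<in>Y \<inter> V. dist (G u) (G v) = hdist u v) \<and>
        (\<forall>Q\<in>sets borel. G ` (Y \<inter> V \<inter> Q) \<in> sets borel)" using loc[OF p] ..
    then have V: "open V" "p \<in> V" "\<forall>u\<in>Y \<inter> V. \<forall>v\<in>Y \<inter> V. dist (G u) (G v) = hdist u v"
        "\<forall>Q\<in>sets borel. G ` (Y \<inter> V \<inter> Q) \<in> sets borel" by simp_all
    obtain W r \<phi> where c: "W \<in> {H3, H3_half}" "chart W (G p) r \<phi>" using charted_at[OF ch] .
    have pH: "p \<in> H3" using p Y by blast
    let ?V = "V \<inter> hball p r"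
    have o: "open (hball p r)" by (rule open_hball[OF pH])
    have "G ` (Y \<inter> ?V \<inter> Q) \<in> sets borel" if "Q \<in> sets borel" for Q
    proof -
      have "hball p r \<inter> Q \<in> sets borel" using o that by auto
      with V(4) have "G ` (Y \<inter> V \<inter> (hball p r \<inter> Q)) \<in> sets borel" by blast
      then show ?thesis by (simp add: Int_assoc)
    qed
    moreover have "G ` (Y \<inter> ?V) \<subseteq> ball (G p) r"
    proof
      fix y assume "y \<in> G ` (Y \<inter> ?V)"
      then obtain u where u: "u \<in> Y" "u \<in> V" "hdist p u < r" "y = G u" by blast
      have "dist (G p) (G u) = hdist p u" using V(2,3) p u(1,2) by blast
      then show "y \<in> ball (G p) r" using u by simp
    qed
    moreover have "open ?V" using V(1) o by (rule open_Int)
    moreover have "\<forall>u\<in>Y \<inter> ?V. \<forall>v\<in>Y \<inter> ?V. dist (G u) (G v) = hdist u v" using V(3) by blast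
    ultimately have "good ?V" unfolding good_def using c by blast
    moreover have "p \<in> ?V" using V(2) pH c(2) by (simp add: chart_def)
    ultimately show ?thesis by blast
  qed
  then have Ysub: "Y \<subseteq> \<Union>{V. good V}" by auto
  obtain F where F: "F \<subseteq> {V. good V}" "countable F" "\<Union>F = \<Union>{V. good V}"
    using Lindelof[of "{V. good V}"] by (auto simp: good_def)
  have g0: "good {}"
  proof -
    obtain W r \<phi> where "W \<in> {H3, H3_half}" "chart W (undefined::'a) r \<phi>" using charted_at[OF ch] .
    then have "\<exists>W (x::'a) r \<phi>. W \<in> {H3, H3_half} \<and> chart W x r \<phi> \<and> G ` (Y \<inter> {}) \<subseteq> ball x r" by blast
    then show ?thesis unfolding good_def by simp
  qed
  let ?F = "insert {} F"
  define V where "V = from_nat_into ?F"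
  have rV: "range V = ?F" unfolding V_def using F(2) by (intro range_from_nat_into) auto
  have gV: "good (V n)" for n
  proof -
    have "V n \<in> insert {} F" using rV by (metis rangeI)
    then show ?thesis using F(1) g0 by auto
  qed
  have oV: "open (V n)" for n using gV[of n] by (simp add: good_def)
  define Z where "Z n = Y \<inter> disjointed V n" for n
  have dV: "disjointed V n \<in> sets borel" for n
    using oV by (auto simp: disjointed_def)
  have Zm: "Z n \<in> sets borel" for n unfolding Z_def using Y dV by auto
  have ZV: "Z n \<subseteq> V n" "Z n \<subseteq> Y" for n using disjointed_subset[of V n] by (auto simp: Z_def)
  have Zdisj: "disjoint_family Z"
    using disjoint_family_disjointed[of V] by (auto simp: Z_def disjoint_family_on_def)
  have "(\<Union>n. disjointed V n) = \<Union>?F" using rV by (simp add: UN_disjointed_eq)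
  then have ZU: "(\<Union>n. Z n) = Y" using Ysub F(3) by (auto simp: Z_def)
  have GZ: "G ` Z n \<in> sets borel" for n
  proof -
    have "G ` (Y \<inter> V n \<inter> disjointed V n) \<in> sets borel" using gV[of n] dV[of n] unfolding good_def by (elim conjE) (rule bspec)
    moreover have "Y \<inter> V n \<inter> disjointed V n = Z n" using disjointed_subset[of V n] by (auto simp: Z_def)
    ultimately show ?thesis by simp
  qed
  have piece: "vol (G ` Z n) = emeasure hvol (Z n)" for n
  proof -
    obtain W x r \<phi> where c: "W \<in> {H3, H3_half}" "chart W x r \<phi>" "G ` (Y \<inter> V n) \<subseteq> ball x r"
      using gV[of n] unfolding good_def by (elim conjE exE) (rule that)
    have inj: "inj_on G (Z n)" using Y(3) ZV(2) by (rule inj_on_subset)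
    have im: "inv_into (Z n) G ` G ` Z n = Z n" using inj by (auto simp: inv_into_f_f image_iff)
    have d: "dist (G u) (G v) = hdist u v" if "u \<in> Z n" "v \<in> Z n" for u v
    proof -
      have "\<forall>u\<in>Y \<inter> V n. \<forall>v\<in>Y \<inter> V n. dist (G u) (G v) = hdist u v"
        using gV[of n] unfolding good_def by (elim conjE)
      then show ?thesis using that ZV[of n] by (meson IntI subsetD)
    qed
    have "hisometric (G ` Z n) (inv_into (Z n) G)"
    proof -
      have "Z n \<subseteq> H3" using ZV(2)[of n] Y(2) by (rule subset_trans)
      then show ?thesis unfolding hisometric_def using im inj d by auto
    qed
    moreover have "G ` Z n \<subseteq> ball x r" using c(3) ZV[of n] by blast
    ultimately have "vol (G ` Z n) = emeasure hvol (inv_into (Z n) G ` G ` Z n)"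
      using c GZ Zm by (intro vol_isometric_piece[OF ch]) (auto simp: im)
    then show ?thesis by (simp add: im)
  qed
  have GY: "G ` Y = (\<Union>n. G ` Z n)" using ZU by blast
  then show GYm: "G ` Y \<in> sets borel" using GZ by auto
  have "disjoint_family (\<lambda>n. G ` Z n)"
    using Zdisj Y(3) ZV(2) unfolding disjoint_family_on_def inj_on_def by blast
  then have "(\<Sum>n. emeasure volume (G ` Z n)) = emeasure volume (G ` Y)"
    unfolding GY using GZ by (intro suminf_emeasure) auto
  then have "vol (G ` Y) = (\<Sum>n. emeasure hvol (Z n))"
    using emeasure_volume[OF ch] GZ GYm piece by simp
  also have "\<dots> = emeasure hvol Y"
    unfolding ZU[symmetric] using Zm Zdisj by (intro suminf_emeasure) auto
  finally show "vol (G ` Y) = emeasure hvol Y" .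
qed

section \<open>Lipschitz functions on length spaces\<close>

text \<open>The Lebesgue number argument common to the two Lipschitz estimates below.\<close>

lemma local_relation_subdivision:
  fixes a b :: real
  assumes "a \<le> b"
    and loc: "\<And>t. t \<in> {a..b} \<Longrightarrow> \<exists>\<epsilon>>0. \<forall>s\<in>{a..b} \<inter> ball t \<epsilon>. \<forall>s'\<in>{a..b} \<inter> ball t \<epsilon>. R s s'"
  obtains N :: nat where "0 < N" "\<And>i. i < N \<Longrightarrow> R (a + (b - a) * i / N) (a + (b - a) * Suc i / N)"
proof -
  obtain \<epsilon> where \<epsilon>: "\<And>t. t \<in> {a..b} \<Longrightarrow> 0 < \<epsilon> t"
      "\<And>t s s'. t \<in> {a..b} \<Longrightarrow> s \<in> {a..b} \<inter> ball t (\<epsilon> t) \<Longrightarrow> s' \<in> {a..b} \<inter> ball t (\<epsilon> t) \<Longrightarrow> R s s'"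
    using loc by metis
  let ?C = "(\<lambda>t. ball t (\<epsilon> t)) ` {a..b}"
  obtain \<delta> where \<delta>: "0 < \<delta>" "\<And>T. T \<subseteq> {a..b} \<Longrightarrow> diameter T < \<delta> \<Longrightarrow> \<exists>B\<in>?C. T \<subseteq> B"
  proof (rule Lebesgue_number_lemma[of "{a..b}" ?C])
    show "?C \<noteq> {}" using assms(1) by auto
    show "{a..b} \<subseteq> \<Union>?C" using \<epsilon>(1) by force
  qed auto
  obtain N0 :: nat where N0: "(b - a) / \<delta> < real N0" using reals_Archimedean2 by blast
  define N where "N = Suc N0"
  have N: "0 < N" "(b - a) / N < \<delta>"
  proof -
    have "(b - a) / \<delta> < real N" using N0 by (simp add: N_def)
    then show "(b - a) / N < \<delta>" using \<delta>(1) by (simp add: N_def field_simps)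
  qed (simp add: N_def)
  have "R (a + (b - a) * i / N) (a + (b - a) * Suc i / N)" if i: "i < N" for i
  proof -
    let ?s = "a + (b - a) * i / N" and ?s' = "a + (b - a) * Suc i / N"
    have ss: "?s' = ?s + (b - a) / N" using N by (simp add: field_simps)
    have le: "?s \<le> ?s'" unfolding ss using assms(1) N by simp
    have lo: "a \<le> ?s" using assms(1) by simp
    have "(b - a) * Suc i / N \<le> (b - a) * N / N"
      using assms(1) i by (intro divide_right_mono mult_left_mono) auto
    then have hi: "?s' \<le> b" using N by simp
    have "diameter {?s..?s'} < \<delta>" using le ss N(2) by (simp add: diameter_closed_interval)
    moreover have "{?s..?s'} \<subseteq> {a..b}" using lo hi by auto
    ultimately obtain B where "B \<in> ?C" "{?s..?s'} \<subseteq> B" using \<delta>(2) by blast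
    then obtain t where t: "t \<in> {a..b}" "{?s..?s'} \<subseteq> ball t (\<epsilon> t)" by blast
    have "?s \<in> {a..b} \<inter> ball t (\<epsilon> t)" "?s' \<in> {a..b} \<inter> ball t (\<epsilon> t)"
    proof -
      have "?s \<in> {?s..?s'}" "?s' \<in> {?s..?s'}" using le by simp_all
      then have "?s \<in> ball t (\<epsilon> t)" "?s' \<in> ball t (\<epsilon> t)" using t(2) by (blast intro: subsetD)+
      then show "?s \<in> {a..b} \<inter> ball t (\<epsilon> t)" "?s' \<in> {a..b} \<inter> ball t (\<epsilon> t)" using le lo hi by simp_all
    qed
    then show ?thesis using \<epsilon>(2)[OF t(1)] by blast
  qed
  with N that show ?thesis by blast
qed

lemma dist_le_sum_chain:
  fixes f :: "nat \<Rightarrow> 'a::metric_space"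
  shows "dist (f 0) (f N) \<le> (\<Sum>i<N. dist (f i) (f (Suc i)))"
proof (induction N)
  case (Suc N)
  have "dist (f 0) (f (Suc N)) \<le> dist (f 0) (f N) + dist (f N) (f (Suc N))" by (rule dist_triangle)
  then show ?case using Suc by simp
qed simp

lemma local_Lipschitz_curve:
  fixes \<gamma> :: "real \<Rightarrow> 'a::metric_space"
  assumes "a \<le> b"
    and "\<And>t. t \<in> {a..b} \<Longrightarrow> \<exists>\<epsilon>>0. \<forall>s\<in>{a..b} \<inter> ball t \<epsilon>. \<forall>s'\<in>{a..b} \<inter> ball t \<epsilon>. dist (\<gamma> s) (\<gamma> s') \<le> \<bar>s - s'\<bar>"
  shows "dist (\<gamma> a) (\<gamma> b) \<le> b - a"
proof -
  obtain N :: nat where N: "0 < N" "\<And>i. i < N \<Longrightarrow>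
      dist (\<gamma> (a + (b - a) * i / N)) (\<gamma> (a + (b - a) * Suc i / N)) \<le> \<bar>(a + (b - a) * i / N) - (a + (b - a) * Suc i / N)\<bar>"
    using local_relation_subdivision[OF assms] by metis
  let ?f = "\<lambda>i::nat. \<gamma> (a + (b - a) * i / N)"
  have "dist (?f 0) (?f N) \<le> (\<Sum>i<N. dist (?f i) (?f (Suc i)))" by (rule dist_le_sum_chain)
  also have "\<dots> \<le> (\<Sum>i<N. (b - a) / N)"
  proof (rule sum_mono)
    fix i assume "i \<in> {..<N}"
    then have "dist (?f i) (?f (Suc i)) \<le> \<bar>(a + (b - a) * i / N) - (a + (b - a) * Suc i / N)\<bar>" using N by simp
    also have "(a + (b - a) * i / N) - (a + (b - a) * Suc i / N) = - ((b - a) / N)" using N by (simp add: field_simps)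
    finally show "dist (?f i) (?f (Suc i)) \<le> (b - a) / N" using assms(1) by simp
  qed
  finally show ?thesis using N by simp
qed

text \<open>Sum the local estimates along a path from \<open>x\<close> to \<open>y\<close> whose length exceeds the distance by at
  most \<open>e\<close>.\<close>

lemma length_metric_local_Lipschitz:
  fixes f :: "'a::metric_space \<Rightarrow> real"
  assumes len: "length_metric TYPE('a)"
    and loc: "\<And>x. \<exists>\<epsilon>>0. \<forall>u\<in>ball x \<epsilon>. \<forall>v\<in>ball x \<epsilon>. \<bar>f u - f v\<bar> \<le> dist u v"
  shows "\<bar>f x - f y\<bar> \<le> dist x y"
proof (rule field_le_epsilon)
  fix e :: real assume "0 < e"
  then obtain g where g: "path g" "pathstart g = x" "pathfinish g = y" "path_length_le g (dist x y + e)"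
    using len unfolding length_metric_def by blast
  have *: "\<exists>\<epsilon>>0. \<forall>s\<in>{0..1} \<inter> ball t \<epsilon>. \<forall>s'\<in>{0..1} \<inter> ball t \<epsilon>. \<bar>f (g s) - f (g s')\<bar> \<le> dist (g s) (g s')"
    if t: "t \<in> {0..1}" for t :: real
  proof -
    obtain \<epsilon> where \<epsilon>: "0 < \<epsilon>" "\<forall>u\<in>ball (g t) \<epsilon>. \<forall>v\<in>ball (g t) \<epsilon>. \<bar>f u - f v\<bar> \<le> dist u v" using loc by blast
    obtain \<delta> where \<delta>: "0 < \<delta>" "\<forall>s\<in>{0..1}. dist s t < \<delta> \<longrightarrow> dist (g s) (g t) < \<epsilon>"
      using g(1) t \<epsilon>(1) unfolding path_def continuous_on_iff by blast
    have "g s \<in> ball (g t) \<epsilon>" if "s \<in> {0..1} \<inter> ball t \<delta>" for s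
      using that \<delta>(2) by (auto simp: dist_commute)
    then show ?thesis using \<delta>(1) \<epsilon>(2) by blast
  qed
  obtain N :: nat where N: "0 < N" "\<And>i. i < N \<Longrightarrow>
      \<bar>f (g (0 + (1 - 0 :: real) * i / N)) - f (g (0 + (1 - 0 :: real) * Suc i / N))\<bar> \<le> dist (g (0 + (1 - 0 :: real) * i / N)) (g (0 + (1 - 0 :: real) * Suc i / N))"
  proof (rule local_relation_subdivision[of 0 1 "\<lambda>s s'. \<bar>f (g s) - f (g s')\<bar> \<le> dist (g s) (g s')"])
    fix t :: real assume "t \<in> {0..1}"
    then show "\<exists>\<epsilon>>0. \<forall>s\<in>{0..1} \<inter> ball t \<epsilon>. \<forall>s'\<in>{0..1} \<inter> ball t \<epsilon>. \<bar>f (g s) - f (g s')\<bar> \<le> dist (g s) (g s')"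
      by (rule *)
  next
    show "(0::real) \<le> 1" by simp
  qed (rule that)
  let ?t = "\<lambda>i::nat. real i / N"
  have "\<bar>f x - f y\<bar> = dist (f (g (?t 0))) (f (g (?t N)))"
    using g N by (simp add: pathstart_def pathfinish_def dist_real_def)
  also have "\<dots> \<le> (\<Sum>i<N. dist (f (g (?t i))) (f (g (?t (Suc i)))))" by (rule dist_le_sum_chain)
  also have "\<dots> \<le> (\<Sum>i<N. dist (g (?t i)) (g (?t (Suc i))))"
    using N(2) by (intro sum_mono) (simp add: dist_real_def)
  also have "\<dots> \<le> dist x y + e"
  proof -
    have "mono_on {..N} ?t" using N by (intro mono_onI divide_right_mono) auto
    moreover have "?t ` {..N} \<subseteq> {0..1}" using N by auto
    ultimately show ?thesis using g(4) unfolding path_length_le_def by blast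
  qed
  finally show "\<bar>f x - f y\<bar> \<le> dist x y + e" .
qed

text \<open>A height function \<open>R\<close> on an open set controls how far a point must travel to leave the set. The
  reason is that the tent function of width \<open>\<eta>'\<close> around the starting height is supported in a
  closed slab, so that extended by zero it is locally 1-Lipschitz on the whole space. The lemma is
  applied to the logarithm of the height in a cusp and to the distance from the boundary in a
  collar.\<close>

lemma radial_control:
  fixes R :: "'a::metric_space \<Rightarrow> real"
  assumes len: "length_metric TYPE('a)" and U: "open U" "x0 \<in> U"
    and R: "\<And>x. x \<in> U \<Longrightarrow> \<exists>\<epsilon>>0. \<forall>u\<in>ball x \<epsilon>. \<forall>v\<in>ball x \<epsilon>. u \<in> U \<and> v \<in> U \<longrightarrow> \<bar>R u - R v\<bar> \<le> dist u v"
    and cl: "\<And>\<eta>'. 0 < \<eta>' \<Longrightarrow> \<eta>' < \<eta> \<Longrightarrow> closed {x \<in> U. \<bar>R x - R x0\<bar> \<le> \<eta>'}"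
    and d: "dist x0 x < \<eta>"
  shows "x \<in> U" "\<bar>R x - R x0\<bar> \<le> dist x0 x"
proof -
  have key: "x \<in> U \<and> \<bar>R x - R x0\<bar> \<le> dist x0 x" 
  proof -
    define \<eta>' where "\<eta>' = (dist x0 x + \<eta>) / 2"
    have \<eta>': "dist x0 x < \<eta>'" "\<eta>' < \<eta>" "0 < \<eta>'"
    proof -
      have "0 < \<eta>" using d zero_le_dist[of x0 x] by linarith
      then show "dist x0 x < \<eta>'" "\<eta>' < \<eta>" "0 < \<eta>'" using d by (auto simp: \<eta>'_def add_nonneg_pos)
    qed
    define f where "f y = (if y \<in> U then max 0 (\<eta>' - \<bar>R y - R x0\<bar>) else 0)" for y
    let ?K = "{x \<in> U. \<bar>R x - R x0\<bar> \<le> \<eta>'}"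
    have f0: "f y = 0" if "y \<notin> ?K" for y using that by (auto simp: f_def)
    have "\<bar>f x0 - f x\<bar> \<le> dist x0 x"
    proof (rule length_metric_local_Lipschitz[OF len])
      fix y
      show "\<exists>\<epsilon>>0. \<forall>u\<in>ball y \<epsilon>. \<forall>v\<in>ball y \<epsilon>. \<bar>f u - f v\<bar> \<le> dist u v"
      proof (cases "y \<in> U")
        case True
        obtain \<epsilon> where \<epsilon>: "\<epsilon> > 0" "\<forall>u\<in>ball y \<epsilon>. \<forall>v\<in>ball y \<epsilon>. u \<in> U \<and> v \<in> U \<longrightarrow> \<bar>R u - R v\<bar> \<le> dist u v"
          using R[OF True] by blast
        obtain \<epsilon>' where \<epsilon>': "\<epsilon>' > 0" "ball y \<epsilon>' \<subseteq> U" using U(1) True by (meson openE)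
        have "\<bar>f u - f v\<bar> \<le> dist u v" if "u \<in> ball y (min \<epsilon> \<epsilon>')" "v \<in> ball y (min \<epsilon> \<epsilon>')" for u v
        proof -
          have "u \<in> ball y \<epsilon>" "v \<in> ball y \<epsilon>" "u \<in> ball y \<epsilon>'" "v \<in> ball y \<epsilon>'" using that by auto
          then have "u \<in> U" "v \<in> U" "\<bar>R u - R v\<bar> \<le> dist u v" using \<epsilon>(2) \<epsilon>'(2) by blast+
          then show ?thesis unfolding f_def by (auto simp: max_def abs_if split: if_splits)
        qed
        then show ?thesis using \<epsilon>(1) \<epsilon>'(1) by (intro exI[of _ "min \<epsilon> \<epsilon>'"]) auto
      next
        case False
        have "open (- ?K)" using cl[OF \<eta>'(3,2)] by (simp add: open_Compl)
        moreover have "y \<in> - ?K" using False by simp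
        ultimately obtain \<epsilon> where "\<epsilon> > 0" "ball y \<epsilon> \<subseteq> - ?K" by (meson openE)
        then have "\<forall>u\<in>ball y \<epsilon>. f u = 0" using f0 by blast
        then show ?thesis using \<open>\<epsilon> > 0\<close> by (intro exI[of _ \<epsilon>]) auto
      qed
    qed
    moreover have "f x0 = \<eta>'" using U(2) \<eta>'(3) by (simp add: f_def)
    ultimately have "f x \<ge> \<eta>' - dist x0 x" by linarith
    moreover have "\<eta>' - dist x0 x > 0" using \<eta>'(1) by simp
    ultimately show ?thesis unfolding f_def by (auto split: if_splits)
  qed
  then show "x \<in> U" "\<bar>R x - R x0\<bar> \<le> dist x0 x" by auto
qed

section \<open>Varying a peripheral component by its width\<close>

text \<open>All that the variational argument uses about one site near a non-extremal parameter \<open>x\<close>: a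
  reparametrisation \<open>\<sigma>\<close> by width, such that the volume \<open>f\<close> is strictly midpoint convex as a function
  of the width, and a change of the width by \<open>\<tau>\<close> moves the frontier by \<open>\<tau>\<close>. This makes collars
  and cusp neighbourhoods interchangeable in the variational argument.\<close>

definition shiftable :: "'a::metric_space site \<Rightarrow> real \<Rightarrow> bool" where
  "shiftable e x \<longleftrightarrow> (\<exists>\<sigma> f \<eta>. 0 < \<eta> \<and> \<sigma> 0 = x \<and> (\<sigma> \<longlongrightarrow> x) (at 0) \<and>
     (\<forall>\<tau>. \<bar>\<tau>\<bar> < \<eta> \<longrightarrow> peripheral e (\<sigma> \<tau>) \<and> 0 \<le> f \<tau> \<and> vol (pc e (\<sigma> \<tau>)) = ennreal (f \<tau>)) \<and>
     (\<forall>\<tau>. 0 < \<tau> \<and> \<tau> < \<eta> \<longrightarrow> 2 * f 0 < f \<tau> + f (- \<tau>) \<and>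
        (\<forall>u\<in>pc_interior e (\<sigma> \<tau>). \<exists>v\<in>pc_interior e x. dist u v < \<tau>) \<and>
        (\<forall>u\<in>pc_interior e (\<sigma> (- \<tau>)). \<forall>v. dist u v < \<tau> \<longrightarrow> v \<in> pc_interior e x)))"

section \<open>Cusp neighbourhoods\<close>

lemma horoball_subset_H3: "0 < k \<Longrightarrow> horoball k \<subseteq> H3"
  by (auto simp: horoball_def H3_def)

lemma open_horoball: "open (horoball k)"
  unfolding horoball_def by (intro open_Collect_less continuous_intros)

lemma cusp_param_pos: "cusp_param g l \<Longrightarrow> 0 < l"
  by (simp add: cusp_param_def)

lemma cusp_param_ball:
  assumes g: "cusp_param g l" and k: "l \<le> k" and p: "p \<in> horoball k"
  obtains r where "0 < r" "hball p r \<subseteq> horoball k" "g ` hball p r = ball (g p) r"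
    "\<forall>u\<in>hball p r. \<forall>v\<in>hball p r. dist (g u) (g v) = hdist u v"
proof -
  have pl: "p \<in> horoball l" using p k by (auto simp: horoball_def)
  have pH: "p \<in> H3" using pl cusp_param_pos[OF g] by (auto simp: horoball_def H3_def)
  obtain r0 where r0: "0 < r0" "g ` hball p r0 = ball (g p) r0"
      "\<forall>u\<in>hball p r0. \<forall>v\<in>hball p r0. dist (g u) (g v) = hdist u v"
    using g pl unfolding cusp_param_def by blast
  obtain \<delta> where \<delta>: "0 < \<delta>" "ball p \<delta> \<subseteq> horoball k" using open_horoball p by (meson openE)
  obtain r1 where r1: "0 < r1" "\<And>q. q \<in> H3 \<Longrightarrow> hdist p q < r1 \<Longrightarrow> dist p q < \<delta>"
    using hdist_small_imp_dist_small[OF pH \<delta>(1)] by metis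
  let ?r = "min r0 r1"
  show thesis
  proof (rule that[of ?r])
    show "0 < ?r" using r0 r1 by simp
    show "hball p ?r \<subseteq> horoball k"
    proof
      fix q assume "q \<in> hball p ?r"
      then have "dist p q < \<delta>" using r1(2) by simp
      then show "q \<in> horoball k" using \<delta>(2) by auto
    qed
    have iso: "dist (g u) (g v) = hdist u v" if "u \<in> hball p ?r" "v \<in> hball p ?r" for u v
    proof -
      have "u \<in> hball p r0" "v \<in> hball p r0" using that by simp_all
      then show ?thesis using r0(3) by blast
    qed
    show "\<forall>u\<in>hball p ?r. \<forall>v\<in>hball p ?r. dist (g u) (g v) = hdist u v" using iso by blast
    show "g ` hball p ?r = ball (g p) ?r"
    proof (intro equalityI subsetI)
      fix x assume "x \<in> g ` hball p ?r"
      then obtain u where u: "x = g u" "u \<in> hball p ?r" by blast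
      have "dist (g p) (g u) = hdist p u" using iso[of p u] u pH r0(1) r1(1) by simp
      then show "x \<in> ball (g p) ?r" using u by simp
    next
      fix x assume x: "x \<in> ball (g p) ?r"
      then have "x \<in> g ` hball p r0" using r0(2) by simp
      then obtain u where u: "x = g u" "u \<in> hball p r0" by blast
      have "p \<in> hball p r0" using r0(1) pH by simp
      then have "dist (g p) (g u) = hdist p u" using r0(3) u(2) by blast
      then have "u \<in> hball p ?r" using x u by simp
      then show "x \<in> g ` hball p ?r" using u by blast
    qed
  qed
qed

lemma cusp_param_open:
  assumes "cusp_param g l" "l \<le> k"
  shows "open (g ` horoball k)"
proof (subst open_contains_ball, intro ballI)
  fix x assume "x \<in> g ` horoball k"
  then obtain p where p: "p \<in> horoball k" "x = g p" by blast
  obtain r where r: "0 < r" "hball p r \<subseteq> horoball k" "g ` hball p r = ball (g p) r"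
    by (rule cusp_param_ball[OF assms p(1)])
  then have "ball x r \<subseteq> g ` horoball k" using p(2) image_mono[OF r(2), of g] by simp
  then show "\<exists>e>0. ball x e \<subseteq> g ` horoball k" using r(1) by blast
qed

lemma cusp_param_continuous_on:
  assumes "cusp_param g l"
  shows "continuous_on (horoball l) g"
proof (rule continuous_at_imp_continuous_on, rule ballI)
  fix p assume p: "p \<in> horoball l"
  have pH: "p \<in> H3" using p horoball_subset_H3[OF cusp_param_pos[OF assms]] by blast
  obtain r where r: "0 < r" "hball p r \<subseteq> horoball l" "g ` hball p r = ball (g p) r"
      "\<forall>u\<in>hball p r. \<forall>v\<in>hball p r. dist (g u) (g v) = hdist u v"
    by (rule cusp_param_ball[OF assms order_refl p])
  have c: "continuous_on (hball p r) g" by (rule continuous_on_from_hdist) (use r(4) in auto)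
  have "p \<in> hball p r" using r(1) pH by simp
  then show "continuous (at p) g"
    by (rule bspec[OF iffD1[OF continuous_on_eq_continuous_at[OF open_hball[OF pH]] c]])
qed

lemma cusp_param_lattice:
  assumes "cusp_param g l"
  obtains a b :: complex where "Im (a * cnj b) \<noteq> 0"
    "\<forall>p\<in>horoball l. \<forall>q\<in>horoball l.
           g p = g q \<longleftrightarrow> (\<exists>m n :: int. q = p + (of_int m * a + of_int n * b, 0))"
proof -
  from assms have "\<exists>a b :: complex. Im (a * cnj b) \<noteq> 0 \<and> (\<forall>p\<in>horoball l. \<forall>q\<in>horoball l.
           g p = g q \<longleftrightarrow> (\<exists>m n :: int. q = p + (of_int m * a + of_int n * b, 0)))"
    unfolding cusp_param_def by (elim conjE)
  then obtain a b :: complex where ab: "Im (a * cnj b) \<noteq> 0" "\<forall>p\<in>horoball l. \<forall>q\<in>horoball l.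
           g p = g q \<longleftrightarrow> (\<exists>m n :: int. q = p + (of_int m * a + of_int n * b, 0))"
    by (elim exE conjE) (rule that)
  show thesis by (rule that[OF ab])
qed

lemma cusp_param_height_eq:
  assumes "cusp_param g l" "p \<in> horoball l" "q \<in> horoball l" "g p = g q"
  shows "snd p = snd q"
proof -
  obtain a b :: complex where "Im (a * cnj b) \<noteq> 0" "\<forall>p\<in>horoball l. \<forall>q\<in>horoball l.
           g p = g q \<longleftrightarrow> (\<exists>m n :: int. q = p + (of_int m * a + of_int n * b, 0))"
    by (rule cusp_param_lattice[OF assms(1)])
  then obtain m n :: int where "q = p + (of_int m * a + of_int n * b, 0)"
    using assms(2-) by metis
  then show ?thesis by simp
qed

text \<open>The real coordinates of \<open>z\<close> in the basis \<open>a, b\<close>, by Cramer's rule.\<close>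

definition lcoord1 :: "complex \<Rightarrow> complex \<Rightarrow> complex \<Rightarrow> real" where
  "lcoord1 a b z = Im (z * cnj b) / Im (a * cnj b)"

definition lcoord2 :: "complex \<Rightarrow> complex \<Rightarrow> complex \<Rightarrow> real" where
  "lcoord2 a b z = Im (a * cnj z) / Im (a * cnj b)"

definition parallelogram :: "complex \<Rightarrow> complex \<Rightarrow> complex set" where
  "parallelogram a b = {z. lcoord1 a b z \<in> {0..<1} \<and> lcoord2 a b z \<in> {0..<1}}"

lemma lattice_coordinates:
  assumes "Im (a * cnj b) \<noteq> 0"
  shows "z = of_real (lcoord1 a b z) * a + of_real (lcoord2 a b z) * b"
proof -
  let ?D = "Im (a * cnj b)"
  have "of_real ?D * z = of_real (Im (z * cnj b)) * a + of_real (Im (a * cnj z)) * b"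
    by (rule complex_eqI) (simp_all add: algebra_simps)
  then have "z = (of_real (Im (z * cnj b)) * a + of_real (Im (a * cnj z)) * b) / of_real ?D"
    using assms by (metis nonzero_mult_div_cancel_left of_real_eq_0_iff)
  then show ?thesis by (simp add: add_divide_distrib lcoord1_def lcoord2_def)
qed

lemma lattice_coordinates_of_combination:
  assumes "Im (a * cnj b) \<noteq> 0"
  shows "lcoord1 a b (of_real s * a + of_real t * b) = s"
    "lcoord2 a b (of_real s * a + of_real t * b) = t"
proof -
  have "Im ((of_real s * a + of_real t * b) * cnj b) = s * Im (a * cnj b)"
    "Im (a * cnj (of_real s * a + of_real t * b)) = t * Im (a * cnj b)"
    by (simp_all add: algebra_simps)
  then show "lcoord1 a b (of_real s * a + of_real t * b) = s"
    "lcoord2 a b (of_real s * a + of_real t * b) = t"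
    using assms by (simp_all only: lcoord1_def lcoord2_def) simp_all
qed

lemma parallelogram_meets_orbit:
  assumes "Im (a * cnj b) \<noteq> 0"
  obtains m n :: int where "z + (of_int m * a + of_int n * b) \<in> parallelogram a b"
proof -
  define s where "s = lcoord1 a b z"
  define t where "t = lcoord2 a b z"
  have z: "z = of_real s * a + of_real t * b"
    unfolding s_def t_def by (rule lattice_coordinates[OF assms])
  have "z + (of_int (- floor s) * a + of_int (- floor t) * b) = of_real (s - floor s) * a + of_real (t - floor t) * b"
    by (subst z) (simp add: ring_distribs)
  moreover have "s - floor s \<in> {0..<1}" "t - floor t \<in> {0..<1}"
    using floor_correct[of s] floor_correct[of t] by (auto simp: algebra_simps)
  ultimately have "z + (of_int (- floor s) * a + of_int (- floor t) * b) \<in> parallelogram a b"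
    unfolding parallelogram_def mem_Collect_eq
    by (simp only: lattice_coordinates_of_combination[OF assms])
  then show ?thesis by (rule that)
qed

lemma parallelogram_orbit_unique:
  assumes D: "Im (a * cnj b) \<noteq> 0" and "z \<in> parallelogram a b" "z + (of_int m * a + of_int n * b) \<in> parallelogram a b"
  shows "m = 0" "n = 0"
proof -
  let ?w = "of_int m * a + of_int n * b"
  have w: "lcoord1 a b ?w = of_int m" "lcoord2 a b ?w = of_int n"
    using lattice_coordinates_of_combination[OF D, of "of_int m" "of_int n"] by simp_all
  have "lcoord1 a b (z + ?w) = lcoord1 a b z + lcoord1 a b ?w"
    "lcoord2 a b (z + ?w) = lcoord2 a b z + lcoord2 a b ?w"
    unfolding lcoord1_def lcoord2_def
    by (simp_all only: distrib_left distrib_right complex_cnj_add plus_complex.sel add_divide_distrib)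
  with w assms(2,3) have "\<bar>of_int m :: real\<bar> < 1" "\<bar>of_int n :: real\<bar> < 1"
    unfolding parallelogram_def by auto
  then show "m = 0" "n = 0" by simp_all
qed

lemma parallelogram_bounded:
  assumes "Im (a * cnj b) \<noteq> 0"
  shows "parallelogram a b \<subseteq> cball 0 (cmod a + cmod b)"
proof
  fix z assume z: "z \<in> parallelogram a b"
  let ?s = "lcoord1 a b z" and ?t = "lcoord2 a b z"
  have st: "\<bar>?s\<bar> \<le> 1" "\<bar>?t\<bar> \<le> 1" using z by (auto simp: parallelogram_def)
  have "cmod z = cmod (of_real ?s * a + of_real ?t * b)"
    by (rule arg_cong[OF lattice_coordinates[OF assms]])
  also have "\<dots> \<le> cmod (of_real ?s * a) + cmod (of_real ?t * b)" by (rule norm_triangle_ineq)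
  also have "\<dots> = \<bar>?s\<bar> * cmod a + \<bar>?t\<bar> * cmod b" by (simp only: norm_mult norm_of_real)
  also have "\<dots> \<le> 1 * cmod a + 1 * cmod b" using st by (intro add_mono mult_right_mono) auto
  finally show "z \<in> cball 0 (cmod a + cmod b)" by simp
qed

lemma parallelogram_borel: "parallelogram a b \<in> sets borel"
proof -
  have m: "{z. f z \<in> {0..<1}} \<in> sets borel" if "continuous_on UNIV f" for f :: "complex \<Rightarrow> real"
    using borel_vimage_continuous_on[OF that, of "{0..<1}"] by (simp add: vimage_def)
  have "continuous_on UNIV (lcoord1 a b)" "continuous_on UNIV (lcoord2 a b)"
    unfolding lcoord1_def lcoord2_def divide_inverse by (intro continuous_intros)+
  from this[THEN m] show ?thesis
    unfolding parallelogram_def Collect_conj_eq by (rule sets.Int)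
qed

lemma emeasure_parallelogram:
  assumes "Im (a * cnj b) \<noteq> 0"
  obtains A where "0 < A" "emeasure lborel (parallelogram a b) = ennreal A"
proof -
  let ?P = "parallelogram a b"
  have "emeasure lborel ?P \<le> emeasure lborel (cball 0 (cmod a + cmod b) :: complex set)"
    using parallelogram_bounded[OF assms] by (intro emeasure_mono) auto
  also have "\<dots> < \<infinity>" using emeasure_bounded_finite[OF bounded_cball] by blast
  finally have fin: "emeasure lborel ?P < \<infinity>" .
  let ?O = "{z. 0 < lcoord1 a b z} \<inter> {z. lcoord1 a b z < 1} \<inter> {z. 0 < lcoord2 a b z} \<inter> {z. lcoord2 a b z < 1}"
  have "open ?O" unfolding lcoord1_def lcoord2_def divide_inverse
    by (intro open_Int open_Collect_less continuous_intros)
  moreover have "of_real (1/2) * a + of_real (1/2) * b \<in> ?O"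
    unfolding Int_iff mem_Collect_eq lattice_coordinates_of_combination[OF assms] by simp
  ultimately have "\<not> negligible ?O" using open_not_negligible by blast
  moreover have "?O \<subseteq> ?P" by (auto simp: parallelogram_def)
  ultimately have "\<not> negligible ?P" using negligible_subset by blast
  then have "?P \<notin> null_sets lborel" using null_sets_completionI negligible_iff_null_sets by blast
  then have "emeasure lborel ?P \<noteq> 0" using parallelogram_borel by (auto simp: null_sets_def)
  then obtain A where "emeasure lborel ?P = ennreal A" "0 \<le> A" "A \<noteq> 0"
    using fin by (cases "emeasure lborel ?P") auto
  then show ?thesis using that by fastforce
qed

text \<open>Modulo the lattice every point lies over the fundamental parallelogram.\<close>

lemma cusp_slab_compact:
  assumes g: "cusp_param g l" and k: "l < k1"
  shows "compact (g ` {p. k1 \<le> snd p \<and> snd p \<le> k2})"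
proof -
  obtain a b :: complex where ab: "Im (a * cnj b) \<noteq> 0" "\<forall>p\<in>horoball l. \<forall>q\<in>horoball l.
           g p = g q \<longleftrightarrow> (\<exists>m n :: int. q = p + (of_int m * a + of_int n * b, 0))"
    by (rule cusp_param_lattice[OF g])
  let ?K = "cball 0 (cmod a + cmod b) \<times> {k1..k2}"
  have sub: "?K \<subseteq> horoball l" using k by (auto simp: horoball_def)
  have "compact (g ` ?K)"
    by (intro compact_continuous_image continuous_on_subset[OF cusp_param_continuous_on[OF g] sub] compact_Times) auto
  moreover have "g ` {p. k1 \<le> snd p \<and> snd p \<le> k2} = g ` ?K"
  proof (intro equalityI subsetI)
    fix x assume "x \<in> g ` {p. k1 \<le> snd p \<and> snd p \<le> k2}"
    then obtain z s where zs: "x = g (z, s)" "k1 \<le> s" "s \<le> k2" by auto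
    obtain m n :: int where mn: "z + (of_int m * a + of_int n * b) \<in> parallelogram a b"
      using parallelogram_meets_orbit[OF ab(1)] by metis
    let ?q = "(z, s) + (of_int m * a + of_int n * b, 0)"
    have "g (z, s) = g ?q"
    proof -
      have "(z, s) \<in> horoball l" "?q \<in> horoball l" using zs k by (auto simp: horoball_def)
      then show ?thesis using ab(2) by blast
    qed
    moreover have "?q \<in> ?K" using mn parallelogram_bounded[OF ab(1)] zs by auto
    ultimately show "x \<in> g ` ?K" using zs(1) by (intro image_eqI[of x g ?q]) simp_all
  qed auto
  ultimately show ?thesis by simp
qed

text \<open>The fibres of \<open>g\<close> are orbits of horizontal translations, so the height descends to the manifold,
  and its logarithm serves as the function \<open>R\<close> of \<open>radial_control\<close>.\<close>

lemma cusp_radial_control: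
  assumes len: "length_metric TYPE('a::metric_space)" and g: "cusp_param (g :: point3 \<Rightarrow> 'a) l"
    and p: "p \<in> horoball l" and d: "dist (g p) x < \<eta>" and \<eta>: "l \<le> snd p * exp (- \<eta>)"
  obtains q where "q \<in> horoball l" "x = g q" "\<bar>ln (snd q) - ln (snd p)\<bar> \<le> dist (g p) x"
proof -
  let ?U = "g ` horoball l"
  have l: "0 < l" by (rule cusp_param_pos[OF g])
  define R where "R x = ln (snd (inv_into (horoball l) g x))" for x
  have Rg: "R (g q) = ln (snd q)" if "q \<in> horoball l" for q
  proof -
    have "inv_into (horoball l) g (g q) \<in> horoball l" "g (inv_into (horoball l) g (g q)) = g q"
      using that by (auto intro: inv_into_into f_inv_into_f)
    then show ?thesis unfolding R_def using cusp_param_height_eq[OF g _ that] by simp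
  qed
  have sp: "0 < snd p" using p l by (simp add: horoball_def)
  have "x \<in> ?U \<and> \<bar>R x - R (g p)\<bar> \<le> dist (g p) x"
  proof (intro conjI)
    have oU: "open ?U" by (rule cusp_param_open[OF g order_refl])
    have gpU: "g p \<in> ?U" using p by blast
    have R: "\<exists>\<epsilon>>0. \<forall>u\<in>ball y \<epsilon>. \<forall>v\<in>ball y \<epsilon>. u \<in> ?U \<and> v \<in> ?U \<longrightarrow> \<bar>R u - R v\<bar> \<le> dist u v" if "y \<in> ?U" for y
    proof -
      obtain q where q: "q \<in> horoball l" "y = g q" using \<open>y \<in> ?U\<close> by blast
      obtain r where r: "0 < r" "hball q r \<subseteq> horoball l" "g ` hball q r = ball (g q) r"
          "\<forall>u\<in>hball q r. \<forall>v\<in>hball q r. dist (g u) (g v) = hdist u v"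
        by (rule cusp_param_ball[OF g order_refl q(1)])
      have "\<bar>R u - R v\<bar> \<le> dist u v" if "u \<in> ball y r" "v \<in> ball y r" for u v
      proof -
        have "u \<in> g ` hball q r" "v \<in> g ` hball q r" using that q(2) r(3) by simp_all
        then obtain u' v' where uv: "u = g u'" "v = g v'" "u' \<in> hball q r" "v' \<in> hball q r" by blast
        have "u' \<in> horoball l" "v' \<in> horoball l" using uv r(2) by blast+
        then have "R u = ln (snd u')" "R v = ln (snd v')" using uv Rg by simp_all
        moreover have "dist u v = hdist u' v'" using r(4) uv by blast
        moreover have "\<bar>ln (snd u') - ln (snd v')\<bar> \<le> hdist u' v'"
          using uv by (intro ln_height_le_hdist) auto
        ultimately show ?thesis by simp
      qed
      then show ?thesis using r(1) by blast
    qed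
    have cl: "closed {x \<in> ?U. \<bar>R x - R (g p)\<bar> \<le> \<eta>'}" if e: "0 < \<eta>'" "\<eta>' < \<eta>" for \<eta>'
    proof -
      have "snd p * exp (- \<eta>) < snd p * exp (- \<eta>')" using sp e by simp
      then have k: "l < snd p * exp (- \<eta>')" using \<eta> by linarith
      have "{x \<in> ?U. \<bar>R x - R (g p)\<bar> \<le> \<eta>'} = g ` {q. snd p * exp (- \<eta>') \<le> snd q \<and> snd q \<le> snd p * exp \<eta>'}"
      proof -
        have iff: "\<bar>R (g q) - R (g p)\<bar> \<le> \<eta>' \<longleftrightarrow> snd p * exp (- \<eta>') \<le> snd q \<and> snd q \<le> snd p * exp \<eta>'"
          if q: "q \<in> horoball l" for q
        proof -
          have sq: "0 < snd q" using q l by (simp add: horoball_def)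
          have "\<bar>R (g q) - R (g p)\<bar> \<le> \<eta>' \<longleftrightarrow> ln (snd p) + - \<eta>' \<le> ln (snd q) \<and> ln (snd q) \<le> ln (snd p) + \<eta>'"
            unfolding Rg[OF q] Rg[OF p] by linarith
          also have "\<dots> \<longleftrightarrow> exp (ln (snd p) + - \<eta>') \<le> exp (ln (snd q)) \<and> exp (ln (snd q)) \<le> exp (ln (snd p) + \<eta>')"
            by (simp only: exp_le_cancel_iff)
          also have "\<dots> \<longleftrightarrow> snd p * exp (- \<eta>') \<le> snd q \<and> snd q \<le> snd p * exp \<eta>'"
            unfolding exp_add using sp sq by simp
          finally show ?thesis .
        qed
        show ?thesis
        proof (intro equalityI subsetI)
          fix y assume "y \<in> {x \<in> ?U. \<bar>R x - R (g p)\<bar> \<le> \<eta>'}"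
          then show "y \<in> g ` {q. snd p * exp (- \<eta>') \<le> snd q \<and> snd q \<le> snd p * exp \<eta>'}"
            using iff by blast
        next
          fix y assume "y \<in> g ` {q. snd p * exp (- \<eta>') \<le> snd q \<and> snd q \<le> snd p * exp \<eta>'}"
          then obtain q where q: "y = g q" "snd p * exp (- \<eta>') \<le> snd q" "snd q \<le> snd p * exp \<eta>'" by blast
          then have "q \<in> horoball l" using k by (simp add: horoball_def)
          then show "y \<in> {x \<in> ?U. \<bar>R x - R (g p)\<bar> \<le> \<eta>'}" using iff q by blast
        qed
      qed
      then show ?thesis by (simp only: compact_imp_closed[OF cusp_slab_compact[OF g k]])
    qed
    show "x \<in> ?U" using radial_control(1)[OF len oU gpU R cl d] by blast
    show "\<bar>R x - R (g p)\<bar> \<le> dist (g p) x" using radial_control(2)[OF len oU gpU R cl d] by blast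
  qed
  then obtain q where "q \<in> horoball l" "x = g q" "\<bar>R x - R (g p)\<bar> \<le> dist (g p) x" by blast
  then show ?thesis using that Rg p by simp
qed

lemma cusp_vertical_dist:
  assumes g: "cusp_param g l" and s: "l < s" "s \<le> t"
  shows "dist (g (z, s)) (g (z, t)) \<le> ln t - ln s"
proof -
  have l: "0 < l" by (rule cusp_param_pos[OF g])
  let ?\<gamma> = "\<lambda>u. g (z, exp u)"
  have "dist (?\<gamma> (ln s)) (?\<gamma> (ln t)) \<le> ln t - ln s"
  proof (rule local_Lipschitz_curve)
    show "ln s \<le> ln t" using s l by simp
    fix u assume u: "u \<in> {ln s..ln t}"
    have "exp (ln s) \<le> exp u" using u by simp
    then have p: "(z, exp u) \<in> horoball l" using s l by (simp add: horoball_def)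
    obtain r where r: "0 < r" "hball (z, exp u) r \<subseteq> horoball l" "g ` hball (z, exp u) r = ball (g (z, exp u)) r"
      "\<forall>u'\<in>hball (z, exp u) r. \<forall>v\<in>hball (z, exp u) r. dist (g u') (g v) = hdist u' v"
      by (rule cusp_param_ball[OF g order_refl p])
    have h: "hdist (z, exp v) (z, exp w) = \<bar>v - w\<bar>" for v w
      using hdist_vertical[of "exp v" "exp w" z] by simp
    have in_ball: "(z, exp v) \<in> hball (z, exp u) r" if "v \<in> ball u r" for v
      using that h[of u v] by (simp add: H3_def dist_real_def)
    show "\<exists>\<epsilon>>0. \<forall>s'\<in>{ln s..ln t} \<inter> ball u \<epsilon>. \<forall>s''\<in>{ln s..ln t} \<inter> ball u \<epsilon>. dist (?\<gamma> s') (?\<gamma> s'') \<le> \<bar>s' - s''\<bar>"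
    proof (intro exI[of _ r] conjI ballI)
      fix v w assume "v \<in> {ln s..ln t} \<inter> ball u r" "w \<in> {ln s..ln t} \<inter> ball u r"
      then have vw: "(z, exp v) \<in> hball (z, exp u) r" "(z, exp w) \<in> hball (z, exp u) r"
        using in_ball by simp_all
      have "dist (?\<gamma> v) (?\<gamma> w) = hdist (z, exp v) (z, exp w)"
        by (rule bspec[OF bspec[OF r(4) vw(1)] vw(2)])
      then show "dist (?\<gamma> v) (?\<gamma> w) \<le> \<bar>v - w\<bar>" using h by simp
    qed (rule r(1))
  qed
  then show ?thesis using s l by simp
qed

section \<open>Metric description and volume of cusp neighbourhoods\<close>

text \<open>Vertical segments realise the distance to the horosphere at height \<open>h\<close>, and radial control shows
  that nothing else is as close.\<close>

lemma cusp_dilation: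
  assumes len: "length_metric TYPE('a::metric_space)" and g: "cusp_param (g :: point3 \<Rightarrow> 'a) l"
    and k: "l \<le> k" "k < h"
  shows "g ` horoball k = {x. \<exists>y\<in>g ` horoball h. dist x y < ln (h / k)}"
proof (intro equalityI subsetI)
  have l: "0 < l" by (rule cusp_param_pos[OF g])
  have hk: "ln (h / k) = ln h - ln k" using l k by (simp add: ln_div)
  {
    fix x assume "x \<in> g ` horoball k"
    then obtain z s where zs: "x = g (z, s)" "k < s" by (auto simp: horoball_def)
    show "x \<in> {x. \<exists>y\<in>g ` horoball h. dist x y < ln (h / k)}"
    proof (cases "h < s")
      case True
      then have "x \<in> g ` horoball h" using zs by (auto simp: horoball_def)
      moreover have "dist x x < ln (h / k)" using l k by simp
      ultimately show ?thesis by blast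
    next
      case False
      define \<delta> where "\<delta> = (ln s - ln k) / 2"
      have d: "0 < \<delta>" using zs l k by (simp add: \<delta>_def)
      have hd: "h < h * exp \<delta>" using d l k by simp
      have "dist (g (z, s)) (g (z, h * exp \<delta>)) \<le> ln (h * exp \<delta>) - ln s"
        using zs k False hd by (intro cusp_vertical_dist[OF g]) auto
      also have "ln (h * exp \<delta>) = ln h + \<delta>" using l k by (simp add: ln_mult)
      also have "ln h + \<delta> - ln s < ln (h / k)" using d unfolding hk \<delta>_def by (simp add: field_simps)
      finally have "dist x (g (z, h * exp \<delta>)) < ln (h / k)" using zs by simp
      moreover have "(z, h * exp \<delta>) \<in> horoball h" using hd by (simp add: horoball_def)
      ultimately show ?thesis by blast
    qed
  }
  {
    fix x assume "x \<in> {x. \<exists>y\<in>g ` horoball h. dist x y < ln (h / k)}"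
    then obtain q where q: "q \<in> horoball h" "dist x (g q) < ln (h / k)" by blast
    have sq: "h < snd q" using q by (simp add: horoball_def)
    have ql: "q \<in> horoball l" using sq k by (simp add: horoball_def)
    have "k * h \<le> k * snd q" using sq l k by (intro mult_left_mono) auto
    then have "k \<le> snd q * exp (- ln (h / k))" using l k by (simp add: exp_minus field_simps)
    then have "l \<le> snd q * exp (- ln (h / k))" using k by simp
    then obtain q' where q': "q' \<in> horoball l" "x = g q'" "\<bar>ln (snd q') - ln (snd q)\<bar> \<le> dist (g q) x"
      using q(2) by (elim cusp_radial_control[OF len g ql, rotated -1]) (simp add: dist_commute)
    have pos: "0 < snd q'" using q' l by (simp add: horoball_def)
    have "ln (snd q') > ln (snd q) - ln (h / k)" using q'(3) q(2) dist_commute[of x "g q"] by linarith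
    moreover have "ln (snd q) > ln h" using sq l k by simp
    ultimately have "ln k < ln (snd q')" using hk by simp
    then have "k < snd q'" using pos l k by simp
    then show "x \<in> g ` horoball k" using q' by (auto simp: horoball_def)
  }
qed

text \<open>A point at height at most \<open>k\<close> is at distance at most \<open>ln (k / h)\<close> from the complement of the
  neighbourhood of height \<open>h\<close>. The parametrisation may end at height \<open>h\<close>, so the nearby point of the
  complement is obtained from completeness.\<close>

lemma cusp_erosion:
  assumes len: "length_metric TYPE('a::metric_space)" and compl: "complete (UNIV :: 'a set)"
    and g: "cusp_param (g :: point3 \<Rightarrow> 'a) l" and k: "l \<le> h" "h \<le> k"
  shows "g ` horoball k = {x. \<exists>\<eta>>ln (k / h). ball x \<eta> \<subseteq> g ` horoball h}"
proof (intro equalityI subsetI)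
  have l: "0 < l" by (rule cusp_param_pos[OF g])
  {
    fix x assume "x \<in> g ` horoball k"
    then obtain p where p: "x = g p" "k < snd p" by (auto simp: horoball_def)
    have pl: "p \<in> horoball l" using p k by (simp add: horoball_def)
    have eq: "snd p * exp (- ln (snd p / h)) = h" using p l k by (simp add: exp_minus)
    have "ball x (ln (snd p / h)) \<subseteq> g ` horoball h"
    proof
      fix y assume "y \<in> ball x (ln (snd p / h))"
      then have d: "dist (g p) y < ln (snd p / h)" using p by simp
      obtain q where q: "q \<in> horoball l" "y = g q" "\<bar>ln (snd q) - ln (snd p)\<bar> \<le> dist (g p) y"
        by (rule cusp_radial_control[OF len g pl d]) (use k in \<open>simp add: eq\<close>)
      have pos: "0 < snd q" using q l by (simp add: horoball_def)
      have "ln (snd p / h) = ln (snd p) - ln h" using p l k by (simp add: ln_div)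
      then have "ln h < ln (snd q)" using q(3) d by linarith
      then have "h < snd q" using pos l k by simp
      then show "y \<in> g ` horoball h" using q by (auto simp: horoball_def)
    qed
    moreover have "ln (k / h) < ln (snd p / h)" using p l k by (simp add: divide_strict_right_mono)
    ultimately show "x \<in> {x. \<exists>\<eta>>ln (k / h). ball x \<eta> \<subseteq> g ` horoball h}" by blast
  }
  {
    fix x assume "x \<in> {x. \<exists>\<eta>>ln (k / h). ball x \<eta> \<subseteq> g ` horoball h}"
    then obtain \<eta> where \<eta>: "ln (k / h) < \<eta>" "ball x \<eta> \<subseteq> g ` horoball h" by blast
    have "0 \<le> ln (k / h)" using l k by simp
    then have "x \<in> g ` horoball h" using \<eta> by auto
    then obtain z s where zs: "x = g (z, s)" "h < s" by (auto simp: horoball_def)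
    show "x \<in> g ` horoball k"
    proof (rule ccontr)
      assume "x \<notin> g ` horoball k"
      then have sk: "s \<le> k" using zs by (force simp: horoball_def)
      \<comment> \<open>Descend vertically towards height \<open>h\<close>; the limit lies in the ball but not in the cusp
        neighbourhood.\<close>
      define t where "t n = h + (s - h) / real (Suc n)" for n
      have th: "h < t n" "t n \<le> s" for n
      proof -
        show "h < t n" using zs by (simp add: t_def)
        have "(s - h) / real (Suc n) \<le> (s - h) / 1" using zs by (intro divide_left_mono) auto
        then show "t n \<le> s" by (simp add: t_def)
      qed
      have "(\<lambda>n. (s - h) / real (Suc n)) \<longlonglongrightarrow> 0" by (rule LIMSEQ_Suc[OF lim_const_over_n])
      then have "t \<longlonglongrightarrow> h + 0" unfolding t_def by (intro tendsto_intros)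
      then have lt: "(\<lambda>n. ln (t n)) \<longlonglongrightarrow> ln h" using l k by (intro tendsto_ln) auto
      define u where "u n = g (z, t n)" for n
      have du: "dist (u m) (u n) \<le> \<bar>ln (t m) - ln (t n)\<bar>" for m n
      proof (cases "t m \<le> t n")
        case True
        have "l < t m" using th(1)[of m] k by simp
        from cusp_vertical_dist[OF g this True, of z] show ?thesis by (simp add: u_def)
      next
        case False
        have "l < t n" using th(1)[of n] k by simp
        from cusp_vertical_dist[OF g this, of "t m" z] False show ?thesis by (simp add: u_def dist_commute)
      qed
      have "Cauchy (\<lambda>n. ln (t n))" using lt by (rule LIMSEQ_imp_Cauchy)
      then have "Cauchy u"
        unfolding Cauchy_def dist_real_def by (meson du order_le_less_trans)
      then obtain y where y: "u \<longlonglongrightarrow> y" using compl unfolding complete_def by blast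
      have "dist x (u n) \<le> ln (k / h)" for n
      proof -
        have "dist (u n) x \<le> ln s - ln (t n)"
          unfolding u_def zs(1) using th(1)[of n] th(2)[of n] k by (intro cusp_vertical_dist[OF g]) auto
        moreover have "ln h \<le> ln (t n)" "ln s \<le> ln k" using th(1)[of n] sk zs(2) l k by auto
        moreover have "ln (k / h) = ln k - ln h" using l k by (simp add: ln_div)
        ultimately show ?thesis by (simp add: dist_commute)
      qed
      then have "dist x y \<le> ln (k / h)"
        using tendsto_dist[OF tendsto_const[of x] y] by (intro LIMSEQ_le_const2) auto
      then have "y \<in> g ` horoball h" using \<eta> by auto
      then obtain q where q: "y = g q" "h < snd q" by (auto simp: horoball_def)
      have ql: "q \<in> horoball l" using q k by (simp add: horoball_def)
      define \<delta> where "\<delta> = (ln (snd q) - ln h) / 2"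
      have d: "0 < \<delta>" using q l k by (simp add: \<delta>_def)
      have "ln h \<le> ln (snd q) + - \<delta>" using d by (simp add: \<delta>_def field_simps)
      then have "exp (ln h) \<le> exp (ln (snd q) + - \<delta>)" by (simp only: exp_le_cancel_iff)
      then have hl: "l \<le> snd q * exp (- \<delta>)" unfolding exp_add using q l k by simp
      have "\<forall>\<^sub>F n in sequentially. dist (u n) y < \<delta>" using y d by (rule tendstoD)
      moreover have "\<forall>\<^sub>F n in sequentially. dist (ln (t n)) (ln h) < \<delta>" using lt d by (rule tendstoD)
      ultimately have "\<forall>\<^sub>F n in sequentially. dist (u n) y < \<delta> \<and> dist (ln (t n)) (ln h) < \<delta>"
        by (rule eventually_conj)
      then obtain n where n: "dist (u n) y < \<delta>" "dist (ln (t n)) (ln h) < \<delta>"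
        using eventually_happens'[OF sequentially_bot] by blast
      have dn: "dist (g q) (u n) < \<delta>" using n(1) q(1) by (simp add: dist_commute)
      obtain q' where q': "q' \<in> horoball l" "u n = g q'" "\<bar>ln (snd q') - ln (snd q)\<bar> \<le> dist (g q) (u n)"
        by (rule cusp_radial_control[OF len g ql dn hl])
      have "(z, t n) \<in> horoball l" using th(1)[of n] k by (simp add: horoball_def)
      then have "snd q' = t n" using cusp_param_height_eq[OF g q'(1), of "(z, t n)"] q'(2) by (simp add: u_def)
      then have "\<bar>ln (t n) - ln (snd q)\<bar> < \<delta>" using q'(3) dn by simp
      then show False using n(2) unfolding \<delta>_def dist_real_def by (simp add: field_simps abs_if split: if_splits)
    qed
  }
qed

text \<open>A concentric cusp neighbourhood is recovered from \<open>C\<close> and the ratio \<open>\<rho>\<close> of the two heights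
  by the metric alone, hence does not depend on the parametrisation that exhibits it.\<close>

definition rescaled_cusp :: "'a::metric_space set \<Rightarrow> real \<Rightarrow> 'a set" where
  "rescaled_cusp C \<rho> = (if 1 < \<rho> then {x. \<exists>y\<in>C. dist x y < ln \<rho>} else {x. \<exists>\<eta>>- ln \<rho>. ball x \<eta> \<subseteq> C})"

lemma horoball_image_rescaled:
  assumes len: "length_metric TYPE('a::metric_space)" and compl: "complete (UNIV :: 'a set)"
    and g: "cusp_param (g :: point3 \<Rightarrow> 'a) l" and k: "l \<le> h" "l \<le> k"
  shows "g ` horoball k = rescaled_cusp (g ` horoball h) (h / k)"
proof -
  have l: "0 < l" by (rule cusp_param_pos[OF g])
  show ?thesis
  proof (cases "k < h")
    case True
    then have "1 < h / k" using l k by simp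
    then show ?thesis using cusp_dilation[OF len g k(2) True] by (simp only: rescaled_cusp_def if_True)
  next
    case False
    then have hk: "h \<le> k" by simp
    then have "\<not> 1 < h / k" using l k by simp
    moreover have "- ln (h / k) = ln (k / h)" using l k by (simp add: ln_div)
    ultimately show ?thesis using cusp_erosion[OF len compl g k(1) hk] by (simp only: rescaled_cusp_def if_False)
  qed
qed

lemma closure_horoball_image:
  assumes len: "length_metric TYPE('a::metric_space)" and g: "cusp_param (g :: point3 \<Rightarrow> 'a) l"
    and k: "l \<le> k" "k < h"
  shows "closure (g ` horoball h) \<subseteq> g ` horoball k"
proof
  fix x assume x: "x \<in> closure (g ` horoball h)"
  have "0 < ln (h / k)" using cusp_param_pos[OF g] k by simp
  then obtain y where "y \<in> g ` horoball h" "dist y x < ln (h / k)"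
    using x unfolding closure_approachable by blast
  then show "x \<in> g ` horoball k" unfolding cusp_dilation[OF len g k] by (auto simp: dist_commute)
qed

lemma nn_integral_inverse_cube:
  assumes "0 < k"
  shows "(\<integral>\<^sup>+s. ennreal (1 / s ^ 3) * indicator {k<..} s \<partial>lborel) = ennreal (1 / (2 * k\<^sup>2))"
proof -
  have "(\<integral>\<^sup>+s. ennreal (1 / s ^ 3) * indicator {k<..} s \<partial>lborel) = (\<integral>\<^sup>+s. ennreal (1 / s ^ 3) * indicator {k..} s \<partial>lborel)"
  proof (rule nn_integral_cong_AE)
    have "AE s in lborel. s \<noteq> k" by (rule AE_lborel_singleton)
    then show "AE s in lborel. ennreal (1 / s ^ 3) * indicator {k<..} s = ennreal (1 / s ^ 3) * indicator {k..} s"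
      by eventually_elim (auto simp: indicator_def)
  qed
  also have "\<dots> = ennreal (0 - (- 1 / (2 * k\<^sup>2)))"
  proof (rule nn_integral_FTC_atLeast)
    show "((\<lambda>s. - 1 / (2 * s\<^sup>2)) has_real_derivative 1 / s ^ 3) (at s)" if "k \<le> s" for s :: real
      using that assms by (auto intro!: derivative_eq_intros simp: field_simps power2_eq_square power3_eq_cube)
    show "((\<lambda>s::real. - 1 / (2 * s\<^sup>2)) \<longlongrightarrow> 0) at_top"
      by (intro tendsto_divide_0[OF tendsto_const] filterlim_at_top_imp_at_infinity
            filterlim_tendsto_pos_mult_at_top[OF tendsto_const] filterlim_pow_at_top filterlim_ident) auto
    show "(\<lambda>s::real. 1 / s ^ 3) \<in> borel_measurable borel" by measurable
  qed (use assms in auto)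
  finally show ?thesis by simp
qed

lemma hvol_vertical_prism:
  assumes P: "P \<in> sets borel" and k: "0 < k"
  shows "emeasure hvol (P \<times> {k<..}) = emeasure lborel P * ennreal (1 / (2 * k\<^sup>2))"
proof -
  let ?f = "\<lambda>p::point3. ennreal (indicator H3 p / snd p ^ 3) * indicator (P \<times> {k<..}) p"
  have PB: "P \<times> {k<..} \<in> sets borel" using P by (intro borel_Times) auto
  have fm: "?f \<in> borel_measurable (lborel \<Otimes>\<^sub>M lborel)"
    unfolding lborel_prod using PB
    by (intro borel_measurable_times_ennreal borel_measurable_indicator) simp_all
  have "emeasure hvol (P \<times> {k<..}) = (\<integral>\<^sup>+p. ?f p \<partial>(lborel \<Otimes>\<^sub>M lborel))"
    unfolding lborel_prod by (rule emeasure_hvol[OF PB])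
  also have "\<dots> = (\<integral>\<^sup>+z. \<integral>\<^sup>+s. ?f (z, s) \<partial>lborel \<partial>lborel)"
    by (rule lborel.nn_integral_fst[OF fm, symmetric])
  also have "\<dots> = (\<integral>\<^sup>+z. ennreal (1 / (2 * k\<^sup>2)) * indicator P z \<partial>lborel)"
  proof (rule nn_integral_cong)
    fix z :: complex
    have "(\<integral>\<^sup>+s. ?f (z, s) \<partial>lborel) = (\<integral>\<^sup>+s. (ennreal (1 / s ^ 3) * indicator {k<..} s) * indicator P z \<partial>lborel)"
      using k by (intro nn_integral_cong) (auto simp: indicator_def H3_def)
    also have "\<dots> = (\<integral>\<^sup>+s. ennreal (1 / s ^ 3) * indicator {k<..} s \<partial>lborel) * indicator P z"
      by (rule nn_integral_multc) simp
    finally show "(\<integral>\<^sup>+s. ?f (z, s) \<partial>lborel) = ennreal (1 / (2 * k\<^sup>2)) * indicator P z"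
      by (simp only: nn_integral_inverse_cube[OF k])
  qed
  also have "\<dots> = ennreal (1 / (2 * k\<^sup>2)) * emeasure lborel P"
    using P by (intro nn_integral_cmult_indicator) simp
  finally show ?thesis by (simp only: mult.commute)
qed

text \<open>The half-open prism over a fundamental parallelogram parametrises the neighbourhood injectively.\<close>

lemma vol_horoball_image:
  assumes ch: "charted TYPE('a::metric_space)" and g: "cusp_param (g :: point3 \<Rightarrow> 'a) l"
  obtains c where "0 < c" "\<forall>k\<ge>l. vol (g ` horoball k) = ennreal (c / k\<^sup>2)"
proof -
  have l: "0 < l" by (rule cusp_param_pos[OF g])
  obtain a b :: complex where ab: "Im (a * cnj b) \<noteq> 0" "\<forall>p\<in>horoball l. \<forall>q\<in>horoball l.
           g p = g q \<longleftrightarrow> (\<exists>m n :: int. q = p + (of_int m * a + of_int n * b, 0))"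
    by (rule cusp_param_lattice[OF g])
  let ?P = "parallelogram a b"
  obtain A where A: "0 < A" "emeasure lborel ?P = ennreal A" by (rule emeasure_parallelogram[OF ab(1)])
  have "vol (g ` horoball k) = ennreal (A / 2 / k\<^sup>2)" if k: "l \<le> k" for k
  proof -
    let ?Y = "?P \<times> {k<..}"
    have Yl: "?Y \<subseteq> horoball l" using k by (auto simp: horoball_def)
    have Yk: "?Y \<subseteq> horoball k" by (auto simp: horoball_def)
    have YB: "?Y \<in> sets borel" using parallelogram_borel by (intro borel_Times) auto
    have im: "g ` ?Y = g ` horoball k"
    proof (intro equalityI subsetI)
      fix x assume "x \<in> g ` horoball k"
      then obtain z s where zs: "x = g (z, s)" "k < s" by (auto simp: horoball_def)
      obtain m n :: int where mn: "z + (of_int m * a + of_int n * b) \<in> ?P"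
        by (rule parallelogram_meets_orbit[OF ab(1)])
      let ?q = "(z, s) + (of_int m * a + of_int n * b, 0)"
      have "(z, s) \<in> horoball l" "?q \<in> horoball l" using zs k by (auto simp: horoball_def)
      then have "g (z, s) = g ?q" using ab(2) by blast
      moreover have "?q \<in> ?Y" using mn zs by auto
      ultimately show "x \<in> g ` ?Y" using zs(1) by (intro image_eqI[of x g ?q]) simp_all
    qed (use Yk in blast)
    have inj: "inj_on g ?Y"
    proof (rule inj_onI)
      fix p q assume pq: "p \<in> ?Y" "q \<in> ?Y" "g p = g q"
      have "p \<in> horoball l" "q \<in> horoball l" using pq Yl by blast+
      then obtain m n :: int where mn: "q = p + (of_int m * a + of_int n * b, 0)" using ab(2) pq(3) by blast
      have "fst p \<in> ?P" "fst p + (of_int m * a + of_int n * b) \<in> ?P" using pq(1,2) mn by auto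
      from parallelogram_orbit_unique[OF ab(1) this] show "p = q" using mn by (simp add: prod_eq_iff)
    qed
    have "vol (g ` ?Y) = emeasure hvol ?Y"
    proof (rule vol_locally_isometric_image(1)[OF ch YB _ inj])
      show "?Y \<subseteq> H3" using Yl horoball_subset_H3[OF l] by (rule subset_trans)
      fix p assume "p \<in> ?Y"
      then have pl: "p \<in> horoball l" using Yl by blast
      have pH: "p \<in> H3" using pl horoball_subset_H3[OF l] by blast
      obtain r where r: "0 < r" "hball p r \<subseteq> horoball l" "g ` hball p r = ball (g p) r"
          "\<forall>u\<in>hball p r. \<forall>v\<in>hball p r. dist (g u) (g v) = hdist u v"
        by (rule cusp_param_ball[OF g order_refl pl])
      let ?V = "hball p r"
      have injV: "inj_on g ?V"
      proof (rule inj_onI)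
        fix u v assume uv: "u \<in> ?V" "v \<in> ?V" "g u = g v"
        have "hdist u v = dist (g u) (g v)" using bspec[OF bspec[OF r(4) uv(1)] uv(2)] by simp
        then show "u = v" using hdist_eq_0_iff[of u v] uv by simp
      qed
      have iso: "hisometric (g ` ?V) (inv_into ?V g)"
        unfolding hisometric_def using injV r(4) by auto
      have "g ` (?Y \<inter> ?V \<inter> Q) \<in> sets borel" if Q: "Q \<in> sets borel" for Q
      proof -
        have "g ` ?V \<inter> inv_into ?V g -` (?Y \<inter> Q) \<in> sets borel"
          using Q YB r(3) by (intro borel_vimage_continuous_on[OF hisometric_continuous_on[OF iso]]) auto
        moreover have "g ` ?V \<inter> inv_into ?V g -` (?Y \<inter> Q) = g ` (?Y \<inter> ?V \<inter> Q)"
          using injV by (auto simp: inv_into_f_f)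
        ultimately show ?thesis by (simp only:)
      qed
      moreover have "\<forall>u\<in>?Y \<inter> ?V. \<forall>v\<in>?Y \<inter> ?V. dist (g u) (g v) = hdist u v" using r(4) by blast
      moreover have "open ?V" by (rule open_hball[OF pH])
      moreover have "p \<in> ?V" using pH r(1) by simp
      ultimately show "\<exists>V. open V \<and> p \<in> V \<and> (\<forall>u\<in>?Y \<inter> V. \<forall>v\<in>?Y \<inter> V. dist (g u) (g v) = hdist u v) \<and>
          (\<forall>Q\<in>sets borel. g ` (?Y \<inter> V \<inter> Q) \<in> sets borel)"
        by (intro exI[of _ ?V] conjI ballI) blast+
    qed
    also have "\<dots> = emeasure lborel ?P * ennreal (1 / (2 * k\<^sup>2))"
      using l k by (intro hvol_vertical_prism parallelogram_borel) auto
    also have "\<dots> = ennreal (A * (1 / (2 * k\<^sup>2)))" unfolding A(2) using A(1) by (intro ennreal_mult[symmetric]) auto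
    also have "A * (1 / (2 * k\<^sup>2)) = A / 2 / k\<^sup>2" by simp
    finally show ?thesis by (simp only: im)
  qed
  then show ?thesis using that[of "A / 2"] A(1) by simp
qed

lemma cusp_class_eq:
  assumes "T \<in> cusps"
  obtains C where "\<forall>D. D \<in> T \<longleftrightarrow> (C, D) \<in> same_cusp"
  using assms unfolding cusps_def by (auto elim!: quotientE)

lemma cusp_param_restrict:
  assumes g: "cusp_param g l" and k: "l \<le> k"
  shows "cusp_param g k"
proof -
  have l: "0 < l" by (rule cusp_param_pos[OF g])
  obtain a b :: complex where ab: "Im (a * cnj b) \<noteq> 0" "\<forall>p\<in>horoball l. \<forall>q\<in>horoball l.
           g p = g q \<longleftrightarrow> (\<exists>m n :: int. q = p + (of_int m * a + of_int n * b, 0))"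
    by (rule cusp_param_lattice[OF g])
  have sub: "horoball k \<subseteq> horoball l" using k by (auto simp: horoball_def)
  have 1: "\<exists>r>0. hball p r \<subseteq> horoball k \<and> g ` hball p r = ball (g p) r \<and>
      (\<forall>u\<in>hball p r. \<forall>v\<in>hball p r. dist (g u) (g v) = hdist u v)" if p: "p \<in> horoball k" for p
  proof -
    obtain r where "0 < r" "hball p r \<subseteq> horoball k" "g ` hball p r = ball (g p) r"
      "\<forall>u\<in>hball p r. \<forall>v\<in>hball p r. dist (g u) (g v) = hdist u v"
      by (rule cusp_param_ball[OF g k p])
    then show ?thesis by (intro exI[of _ r] conjI)
  qed
  have 2: "\<forall>p\<in>horoball k. \<forall>q\<in>horoball k. g p = g q \<longleftrightarrow> (\<exists>m n :: int. q = p + (of_int m * a + of_int n * b, 0))"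
    by (intro ballI) (rule bspec[OF bspec[OF ab(2)]], (erule subsetD[OF sub])+)
  show ?thesis unfolding cusp_param_def
  proof (intro conjI)
    show "0 < k" using l k by simp
    show "\<forall>p\<in>horoball k. \<exists>r>0. hball p r \<subseteq> horoball k \<and> g ` hball p r = ball (g p) r \<and>
      (\<forall>u\<in>hball p r. \<forall>v\<in>hball p r. dist (g u) (g v) = hdist u v)" using 1 by (rule ballI)
    show "\<exists>a b. Im (a * cnj b) \<noteq> 0 \<and> (\<forall>p\<in>horoball k. \<forall>q\<in>horoball k. g p = g q \<longleftrightarrow> (\<exists>m n :: int. q = p + (of_int m * a + of_int n * b, 0)))"
      by (rule exI[of _ a], rule exI[of _ b], rule conjI[OF ab(1) 2])
  qed
qed

text \<open>Volume is proportional to the inverse square of the height. Relative to a fixed member \<open>C\<close> of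
  the class it therefore determines the ratio of heights, and \<open>horoball_image_rescaled\<close> then
  determines the neighbourhood, whichever parametrisation exhibits it. Hence one \<open>g\<close> serves for all
  volumes up to \<open>y\<close>.\<close>

lemma cusp_family:
  assumes len: "length_metric TYPE('a::metric_space)" and compl: "complete (UNIV :: 'a set)"
    and ch: "charted TYPE('a)"
    and T: "(T :: 'a set set) \<in> cusps" and y: "peripheral (Cusp T) y"
  obtains g k where "cusp_param g k"
    "\<forall>s. 0 < s \<and> s \<le> y \<longrightarrow> vol (g ` horoball (k * sqrt (y / s))) = ennreal s \<and>
       pc_interior (Cusp T) s = g ` horoball (k * sqrt (y / s)) \<and> peripheral (Cusp T) s"
proof -
  obtain C where "\<forall>D. D \<in> T \<longleftrightarrow> (C, D) \<in> same_cusp" by (rule cusp_class_eq[OF T])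
  then have C: "D \<in> T \<longleftrightarrow> (C, D) \<in> same_cusp" for D by blast
  have y0: "0 < y" using y by simp
  have form: "\<exists>g l h k. cusp_param g l \<and> l \<le> h \<and> l \<le> k \<and> C = g ` horoball h \<and> D = g ` horoball k" if "D \<in> T" for D
    using that unfolding C same_cusp_def by simp
  have ratio: "D = rescaled_cusp C (sqrt (s / enn2real (vol C)))" if D: "D \<in> T" "vol D = ennreal s" "0 < s" for D s
  proof -
    obtain g l h k where g: "cusp_param g l" "l \<le> h" "l \<le> k" "C = g ` horoball h" "D = g ` horoball k"
      using form[OF D(1)] by (elim exE conjE) (rule that)
    have l: "0 < l" by (rule cusp_param_pos[OF g(1)])
    obtain c where c: "0 < c" "\<forall>k\<ge>l. vol (g ` horoball k) = ennreal (c / k\<^sup>2)" by (rule vol_horoball_image[OF ch g(1)])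
    have vC: "vol C = ennreal (c / h\<^sup>2)" using c(2) g by simp
    have "ennreal (c / k\<^sup>2) = ennreal s" using c(2) g D by simp
    then have s: "s = c / k\<^sup>2" using c(1) D(3) by simp
    have "s / enn2real (vol C) = (h / k)\<^sup>2"
      unfolding vC s using c(1) l g(2,3) by (simp add: power_divide)
    then have "sqrt (s / enn2real (vol C)) = h / k" using l g(2,3) by simp
    then show ?thesis using horoball_image_rescaled[OF len compl g(1-3)] g(4,5) by simp
  qed
  obtain D where D: "D \<in> T" "vol D = ennreal y" using y by auto
  obtain g l h k where g: "cusp_param g l" "l \<le> h" "l \<le> k" "C = g ` horoball h" "D = g ` horoball k"
    using form[OF D(1)] by (elim exE conjE) (rule that)
  have l: "0 < l" by (rule cusp_param_pos[OF g(1)])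
  obtain c where c: "0 < c" "\<forall>k\<ge>l. vol (g ` horoball k) = ennreal (c / k\<^sup>2)" by (rule vol_horoball_image[OF ch g(1)])
  have "ennreal (c / k\<^sup>2) = ennreal y" using c(2) g D by simp
  then have cy: "c / k\<^sup>2 = y" using c(1) y0 by simp
  have main: "vol (g ` horoball (k * sqrt (y / s))) = ennreal s \<and>
       pc_interior (Cusp T) s = g ` horoball (k * sqrt (y / s)) \<and> peripheral (Cusp T) s" if s: "0 < s" "s \<le> y" for s
  proof -
    let ?k = "k * sqrt (y / s)"
    have "1 \<le> y / s" using s by simp
    then have "1 \<le> sqrt (y / s)" by simp
    then have "k * 1 \<le> ?k" using l g(3) by (intro mult_left_mono) auto
    then have kl: "l \<le> ?k" using g(3) by simp
    have "c / ?k\<^sup>2 = s" using cy s y0 l g(3) by (simp add: power_mult_distrib field_simps)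
    then have v: "vol (g ` horoball ?k) = ennreal s" using c(2) kl by simp
    have "(C, g ` horoball ?k) \<in> same_cusp" unfolding same_cusp_def using g kl by blast
    then have T': "g ` horoball ?k \<in> T" unfolding C .
    have "{D \<in> T. vol D = ennreal s} = {g ` horoball ?k}"
    proof (intro equalityI subsetI)
      fix E assume "E \<in> {D \<in> T. vol D = ennreal s}"
      then have "E = rescaled_cusp C (sqrt (s / enn2real (vol C)))" using s by (intro ratio) auto
      also have "\<dots> = g ` horoball ?k" using ratio[OF T' v s(1)] by (rule sym)
      finally show "E \<in> {g ` horoball ?k}" by simp
    qed (use T' v in simp)
    then show ?thesis using v T' s by auto
  qed
  show thesis by (rule that[OF cusp_param_restrict[OF g(1,3)]]) (use main in blast)
qed

text \<open>The closed neighbourhood lies in every slightly larger open one, whose volume is as close to \<open>s\<close> as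
  desired.\<close>

lemma cusp_vol_pc:
  assumes len: "length_metric TYPE('a::metric_space)" and compl: "complete (UNIV :: 'a set)"
    and ch: "charted TYPE('a)"
    and T: "(T :: 'a set set) \<in> cusps" and y: "peripheral (Cusp T) y" and s: "0 < s" "s < y"
  shows "vol (pc (Cusp T) s) = ennreal s"
proof -
  obtain g k where g: "cusp_param g k"
    "\<forall>s. 0 < s \<and> s \<le> y \<longrightarrow> vol (g ` horoball (k * sqrt (y / s))) = ennreal s \<and>
       pc_interior (Cusp T) s = g ` horoball (k * sqrt (y / s)) \<and> peripheral (Cusp T) s"
    by (rule cusp_family[OF len compl ch T y])
  have k: "0 < k" by (rule cusp_param_pos[OF g(1)])
  let ?h = "\<lambda>s. k * sqrt (y / s)"
  have pcs: "pc (Cusp T) s = closure (g ` horoball (?h s))" using g(2) s by simp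
  show ?thesis
  proof (rule antisym)
    have "vol (g ` horoball (?h s)) \<le> vol (pc (Cusp T) s)" unfolding pcs by (intro vol_mono closure_subset)
    then show "ennreal s \<le> vol (pc (Cusp T) s)" using g(2) s by simp
    have upper: "vol (pc (Cusp T) s) \<le> ennreal s'" if s': "s < s'" "s' \<le> y" for s'
    proof -
      have "y / s' < y / s" "1 \<le> y / s'" using s s' by (auto intro: divide_strict_left_mono)
      then have "?h s' < ?h s" "k * 1 \<le> ?h s'" using k by (auto intro: mult_left_mono)
      then have "pc (Cusp T) s \<subseteq> g ` horoball (?h s')"
        unfolding pcs by (intro closure_horoball_image[OF len g(1)]) auto
      then have "vol (pc (Cusp T) s) \<le> vol (g ` horoball (?h s'))" by (rule vol_mono)
      then show ?thesis using g(2) s s' by simp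
    qed
    show "vol (pc (Cusp T) s) \<le> ennreal s"
    proof (rule ennreal_le_epsilon)
      fix e :: real assume e: "0 < e"
      have "vol (pc (Cusp T) s) \<le> ennreal (min (s + e) y)" using e s by (intro upper) auto
      also have "\<dots> \<le> ennreal (s + e)" by (intro ennreal_leI) auto
      finally show "vol (pc (Cusp T) s) \<le> ennreal s + ennreal e" using s e by simp
    qed
  qed
qed

lemma cusp_shiftable:
  assumes len: "length_metric TYPE('a::metric_space)" and compl: "complete (UNIV :: 'a set)"
    and ch: "charted TYPE('a)"
    and T: "(T :: 'a set set) \<in> cusps" and y: "peripheral (Cusp T) y" and x: "0 < x" "x < y"
  shows "shiftable (Cusp T) x"
proof -
  obtain g k where g: "cusp_param g k"
    "\<forall>s. 0 < s \<and> s \<le> y \<longrightarrow> vol (g ` horoball (k * sqrt (y / s))) = ennreal s \<and>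
       pc_interior (Cusp T) s = g ` horoball (k * sqrt (y / s)) \<and> peripheral (Cusp T) s"
    by (rule cusp_family[OF len compl ch T y])
  have k: "0 < k" by (rule cusp_param_pos[OF g(1)])
  \<comment> \<open>Volume is proportional to \<open>height ^ -2\<close>, so the hyperbolic width is half the logarithm of the volume.\<close>
  define \<sigma> where "\<sigma> \<tau> = x * exp (2 * \<tau>)" for \<tau>
  define \<eta> where "\<eta> = ln (y / x) / 2"
  define \<kappa> where "\<kappa> = k * sqrt (y / x)"
  have y0: "0 < y" using x by simp
  have \<eta>: "0 < \<eta>" using x by (simp add: \<eta>_def)
  have \<sigma>y: "0 < \<sigma> \<tau> \<and> \<sigma> \<tau> < y" if "\<bar>\<tau>\<bar> < \<eta>" for \<tau>
  proof -
    have "2 * \<tau> < ln (y / x)" using that by (simp add: \<eta>_def)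
    then have "exp (2 * \<tau>) < exp (ln (y / x))" by (simp only: exp_less_cancel_iff)
    then have "exp (2 * \<tau>) < y / x" using x by simp
    then show ?thesis using x by (simp add: \<sigma>_def field_simps)
  qed
  have level: "k * sqrt (y / \<sigma> \<tau>) = \<kappa> * exp (- \<tau>)" for \<tau>
  proof -
    have "y / \<sigma> \<tau> = y / x * (exp (- \<tau>))\<^sup>2"
      using x by (simp add: \<sigma>_def exp_minus field_simps flip: exp_double)
    then have "sqrt (y / \<sigma> \<tau>) = sqrt (y / x) * exp (- \<tau>)"
      by (simp only: real_sqrt_mult real_sqrt_abs abs_exp_cancel)
    then show ?thesis by (simp add: \<kappa>_def)
  qed
  have int: "pc_interior (Cusp T) (\<sigma> \<tau>) = g ` horoball (\<kappa> * exp (- \<tau>))" if "\<bar>\<tau>\<bar> < \<eta>" for \<tau>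
    using g(2) \<sigma>y[OF that] level[of \<tau>] by simp
  have \<sigma>0: "\<sigma> 0 = x" by (simp add: \<sigma>_def)
  have int0: "pc_interior (Cusp T) x = g ` horoball \<kappa>" using int[of 0] \<eta> \<sigma>0 by simp
  have \<kappa>: "0 < \<kappa>" using k x y0 by (simp add: \<kappa>_def)
  have low: "k \<le> \<kappa> * exp (- \<tau>)" if "\<bar>\<tau>\<bar> < \<eta>" for \<tau>
  proof -
    have "1 \<le> sqrt (y / \<sigma> \<tau>)" using \<sigma>y[OF that] by simp
    then have "k * 1 \<le> k * sqrt (y / \<sigma> \<tau>)" using k by (intro mult_left_mono) auto
    then show ?thesis by (simp only: level mult_1_right)
  qed
  have low0: "k \<le> \<kappa>" using low[of 0] \<eta> by simp
  show ?thesis unfolding shiftable_def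
  proof (rule exI[of _ \<sigma>], rule exI[of _ \<sigma>], rule exI[of _ \<eta>], intro conjI allI impI ballI)
    show "0 < \<eta>" by (rule \<eta>)
    show "\<sigma> 0 = x" by (rule \<sigma>0)
    have "isCont \<sigma> 0" unfolding \<sigma>_def by (intro continuous_intros)
    then show "\<sigma> \<midarrow>0\<rightarrow> x" unfolding isCont_def \<sigma>0 .
  next
    fix \<tau> assume \<tau>: "\<bar>\<tau>\<bar> < \<eta>"
    show "peripheral (Cusp T) (\<sigma> \<tau>)" using g(2) \<sigma>y[OF \<tau>] by (simp del: peripheral.simps)
    show "0 \<le> \<sigma> \<tau>" using \<sigma>y[OF \<tau>] by simp
    show "vol (pc (Cusp T) (\<sigma> \<tau>)) = ennreal (\<sigma> \<tau>)"
      using \<sigma>y[OF \<tau>] by (intro cusp_vol_pc[OF len compl ch T y]) auto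
  next
    fix \<tau> assume \<tau>: "0 < \<tau> \<and> \<tau> < \<eta>"
    have "0 < (exp \<tau> - exp (- \<tau>))\<^sup>2" using \<tau> by simp
    also have "\<dots> = exp (2 * \<tau>) + exp (2 * - \<tau>) - 2"
    proof -
      have "exp \<tau> * exp (- \<tau>) = 1" by (simp add: exp_minus)
      then show ?thesis using exp_double[of \<tau>] exp_double[of "- \<tau>"] by (simp add: power2_diff)
    qed
    finally have "x * 2 < x * (exp (2 * \<tau>) + exp (2 * - \<tau>))" using x by (intro mult_strict_left_mono) auto
    then show "2 * \<sigma> 0 < \<sigma> \<tau> + \<sigma> (- \<tau>)" by (simp add: \<sigma>_def algebra_simps)
  next
    fix \<tau> u assume \<tau>: "0 < \<tau> \<and> \<tau> < \<eta>" and u: "u \<in> pc_interior (Cusp T) (\<sigma> \<tau>)"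
    have t: "\<bar>\<tau>\<bar> < \<eta>" using \<tau> by simp
    have "\<kappa> * exp (- \<tau>) < \<kappa>" using \<kappa> \<tau> by simp
    from cusp_dilation[OF len g(1) low[OF t] this]
    have "u \<in> {x. \<exists>y\<in>g ` horoball \<kappa>. dist x y < ln (\<kappa> / (\<kappa> * exp (- \<tau>)))}" using u int[OF t] by (simp only:)
    moreover have "\<kappa> / (\<kappa> * exp (- \<tau>)) = exp \<tau>" using \<kappa> by (simp add: exp_minus inverse_eq_divide)
    then have "ln (\<kappa> / (\<kappa> * exp (- \<tau>))) = \<tau>" by (simp only: ln_exp)
    ultimately show "\<exists>v\<in>pc_interior (Cusp T) x. dist u v < \<tau>" unfolding int0 by simp
  next
    fix \<tau> u v assume \<tau>: "0 < \<tau> \<and> \<tau> < \<eta>" and u: "u \<in> pc_interior (Cusp T) (\<sigma> (- \<tau>))" and d: "dist u v < \<tau>"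
    have t: "\<bar>- \<tau>\<bar> < \<eta>" using \<tau> by simp
    have lt: "\<kappa> < \<kappa> * exp (- (- \<tau>))" using \<kappa> \<tau> by simp
    have "u \<in> g ` horoball (\<kappa> * exp (- (- \<tau>)))" using u int[OF t] by (simp only:)
    moreover have "ln (\<kappa> * exp (- (- \<tau>)) / \<kappa>) = \<tau>" using \<kappa> by simp
    ultimately have "v \<in> {x. \<exists>y\<in>g ` horoball (\<kappa> * exp (- (- \<tau>))). dist x y < ln (\<kappa> * exp (- (- \<tau>)) / \<kappa>)}"
      using d by (auto simp: dist_commute)
    then show "v \<in> pc_interior (Cusp T) x"
      using cusp_dilation[OF len g(1) low0 lt] by (simp only: int0)
  qed
qed

lemma cusp_mono:
  assumes len: "length_metric TYPE('a::metric_space)" and compl: "complete (UNIV :: 'a set)"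
    and ch: "charted TYPE('a)"
    and T: "(T :: 'a set set) \<in> cusps" and y: "peripheral (Cusp T) y" and x: "0 < x" "x \<le> y"
  shows "peripheral (Cusp T) x" "pc_interior (Cusp T) x \<subseteq> pc_interior (Cusp T) y" "pc (Cusp T) x \<subseteq> pc (Cusp T) y"
proof -
  obtain g k where g: "cusp_param g k"
    "\<forall>s. 0 < s \<and> s \<le> y \<longrightarrow> vol (g ` horoball (k * sqrt (y / s))) = ennreal s \<and>
       pc_interior (Cusp T) s = g ` horoball (k * sqrt (y / s)) \<and> peripheral (Cusp T) s"
    by (rule cusp_family[OF len compl ch T y])
  have k: "0 < k" by (rule cusp_param_pos[OF g(1)])
  show "peripheral (Cusp T) x" using g(2) x by (simp del: peripheral.simps)
  have "1 \<le> sqrt (y / x)" using x by simp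
  then have "k * 1 \<le> k * sqrt (y / x)" using k by (intro mult_left_mono) auto
  then have "horoball (k * sqrt (y / x)) \<subseteq> horoball (k * sqrt (y / y))" using x by (auto simp: horoball_def)
  then have "g ` horoball (k * sqrt (y / x)) \<subseteq> g ` horoball (k * sqrt (y / y))" by (rule image_mono)
  moreover have "pc_interior (Cusp T) x = g ` horoball (k * sqrt (y / x))"
    "pc_interior (Cusp T) y = g ` horoball (k * sqrt (y / y))" using g(2) x by (simp_all del: pc_interior.simps)
  ultimately show "pc_interior (Cusp T) x \<subseteq> pc_interior (Cusp T) y" by (simp only:)
  then show "pc (Cusp T) x \<subseteq> pc (Cusp T) y" unfolding pc.simps by (rule closure_mono)
qed

section \<open>The hyperboloid model and geodesics\<close>

text \<open>\<open>mink p\<close> is the point of the hyperboloid in Minkowski space corresponding to \<open>p\<close>, and \<open>mform\<close>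
  is the negated Minkowski form in light-cone coordinates. Along unit-speed geodesics \<open>mink\<close> is a
  combination of cosh and sinh, which makes the continuation of geodesics and of the distances between
  them a matter of linear algebra.\<close>

definition mink :: "point3 \<Rightarrow> real \<times> complex \<times> real" where
  "mink p = (1 / snd p, fst p /\<^sub>R snd p, ((cmod (fst p))\<^sup>2 + (snd p)\<^sup>2) / snd p)"

definition mform :: "real \<times> complex \<times> real \<Rightarrow> real \<times> complex \<times> real \<Rightarrow> real" where
  "mform v w = (fst v * snd (snd w) + snd (snd v) * fst w) / 2 - inner (fst (snd v)) (fst (snd w))"

lemma mform_linear:
  "mform (v + v') w = mform v w + mform v' w" "mform v (w + w') = mform v w + mform v w'"
  "mform (v - v') w = mform v w - mform v' w" "mform v (w - w') = mform v w - mform v w'"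
  "mform (c *\<^sub>R v) w = c * mform v w" "mform v (c *\<^sub>R w) = c * mform v w"
  unfolding mform_def by (simp_all add: inner_simps field_simps)

lemma mform_mink:
  assumes "p \<in> H3" "q \<in> H3"
  shows "mform (mink p) (mink q) = cosh (hdist p q)"
proof -
  have s: "0 < snd p" "0 < snd q" using assms by (auto simp: H3_def)
  have n: "(cmod (fst p - fst q))\<^sup>2 = (cmod (fst p))\<^sup>2 + (cmod (fst q))\<^sup>2 - 2 * inner (fst p) (fst q)"
    by (simp add: power2_norm_eq_inner inner_simps inner_commute)
  have "2 * snd p * snd q * mform (mink p) (mink q) = (cmod (fst p - fst q))\<^sup>2 + (snd p)\<^sup>2 + (snd q)\<^sup>2"
    unfolding n mform_def mink_def using s by (simp add: field_simps power2_eq_square)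
  then have "2 * snd p * snd q * mform (mink p) (mink q) = 2 * snd p * snd q * cosh (hdist p q)"
    using cosh_hdist_expand[OF assms] by simp
  then show ?thesis using s by (simp only: mult_cancel_left) auto
qed

lemma mink_inj:
  assumes "p \<in> H3" "q \<in> H3" "mink p = mink q"
  shows "p = q"
  using assms by (auto simp: mink_def H3_def prod_eq_iff)

text \<open>With \<open>v = (u, \<zeta>, w)\<close> and \<open>b = (z, s)\<close> the two hypotheses combine to
  \<open>\<bar>u z - \<zeta>\<bar>\<^sup>2 + (u s)\<^sup>2 = 0\<close>, a case of the reversed Cauchy-Schwarz inequality for timelike vectors.\<close>

lemma null_orthogonal_eq_0:
  assumes "b \<in> H3" "mform v (mink b) = 0" "mform v v = 0"
  shows "v = 0"
proof -
  obtain u \<zeta> w where v: "v = (u, \<zeta>, w)" by (cases v) auto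
  have s: "0 < snd b" using assms by (auto simp: H3_def)
  have 1: "u * ((cmod (fst b))\<^sup>2 + (snd b)\<^sup>2) + w = 2 * inner \<zeta> (fst b)"
  proof -
    have "snd b * (u * ((cmod (fst b))\<^sup>2 + (snd b)\<^sup>2) + w) = snd b * (2 * inner \<zeta> (fst b))"
      using assms(2) s unfolding v mform_def mink_def by (simp add: field_simps)
    then show ?thesis using s by (simp only: mult_cancel_left) auto
  qed
  have 2: "u * w = (cmod \<zeta>)\<^sup>2"
    using assms(3) unfolding v mform_def by (simp add: power2_norm_eq_inner)
  have "(cmod (u *\<^sub>R fst b - \<zeta>))\<^sup>2 = u\<^sup>2 * (cmod (fst b))\<^sup>2 + (cmod \<zeta>)\<^sup>2 - u * (2 * inner \<zeta> (fst b))"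
    unfolding power2_norm_eq_inner
    by (simp add: inner_simps inner_commute power2_eq_square algebra_simps)
  also have "\<dots> = - (u * snd b)\<^sup>2"
    unfolding 1[symmetric] 2[symmetric] by (simp add: algebra_simps power2_eq_square)
  finally have "(cmod (u *\<^sub>R fst b - \<zeta>))\<^sup>2 + (u * snd b)\<^sup>2 = 0" by simp
  then have "u * snd b = 0" by (simp add: sum_power2_eq_zero_iff)
  then have u: "u = 0" using s by simp
  then have z: "\<zeta> = 0" using 2 by simp
  then show ?thesis using 1 u v by (simp add: zero_prod_def)
qed

text \<open>The difference of the two sides is null and orthogonal to the timelike vector \<open>mink b\<close>.\<close>

lemma collinear_mink:
  assumes H: "a \<in> H3" "b \<in> H3" "c \<in> H3"
    and d: "hdist a b = \<alpha>" "hdist b c = \<beta>" "hdist a c = \<alpha> + \<beta>"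
  shows "sinh (\<alpha> + \<beta>) *\<^sub>R mink b = sinh \<beta> *\<^sub>R mink a + sinh \<alpha> *\<^sub>R mink c"
proof -
  let ?S = "sinh (\<alpha> + \<beta>)"
  let ?v = "sinh \<beta> *\<^sub>R mink a + sinh \<alpha> *\<^sub>R mink c - ?S *\<^sub>R mink b"
  have f: "mform (mink a) (mink a) = 1" "mform (mink b) (mink b) = 1" "mform (mink c) (mink c) = 1"
    "mform (mink a) (mink b) = cosh \<alpha>" "mform (mink b) (mink a) = cosh \<alpha>"
    "mform (mink c) (mink b) = cosh \<beta>" "mform (mink b) (mink c) = cosh \<beta>"
    "mform (mink a) (mink c) = cosh (\<alpha> + \<beta>)" "mform (mink c) (mink a) = cosh (\<alpha> + \<beta>)"
    using H d by (simp_all add: mform_mink hdist_commute[of b a] hdist_commute[of c b] hdist_commute[of c a])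
  have 0: "mform ?v (mink b) = 0"
    unfolding mform_linear f by (simp add: sinh_add algebra_simps)
  have "mform ?v ?v = 0"
  proof -
    have "mform ?v ?v = (sinh \<beta>)\<^sup>2 + (sinh \<alpha>)\<^sup>2 + 2 * sinh \<alpha> * sinh \<beta> * cosh (\<alpha> + \<beta>) + ?S\<^sup>2
        - 2 * ?S * (sinh \<beta> * cosh \<alpha> + sinh \<alpha> * cosh \<beta>)"
      unfolding mform_linear f by (simp add: algebra_simps power2_eq_square)
    also have "sinh \<beta> * cosh \<alpha> + sinh \<alpha> * cosh \<beta> = ?S" by (simp add: sinh_add mult.commute)
    also have "(sinh \<beta>)\<^sup>2 + (sinh \<alpha>)\<^sup>2 + 2 * sinh \<alpha> * sinh \<beta> * cosh (\<alpha> + \<beta>) + ?S\<^sup>2 - 2 * ?S * ?S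
       = (sinh \<beta>)\<^sup>2 + (sinh \<alpha>)\<^sup>2 + 2 * (sinh \<alpha>)\<^sup>2 * (sinh \<beta>)\<^sup>2 - (sinh \<alpha>)\<^sup>2 * (cosh \<beta>)\<^sup>2 - (cosh \<alpha>)\<^sup>2 * (sinh \<beta>)\<^sup>2"
      by (simp add: sinh_add cosh_add algebra_simps power2_eq_square)
    also have "\<dots> = 0" unfolding cosh_square_eq by (simp add: algebra_simps)
    finally show ?thesis .
  qed
  from null_orthogonal_eq_0[OF H(2) 0 this] show ?thesis by simp
qed

text \<open>These are the solutions of \<open>f'' = f\<close>, the equation of geodesics on the hyperboloid.\<close>

definition hyp_affine_on :: "real set \<Rightarrow> (real \<Rightarrow> 'v::real_vector) \<Rightarrow> bool" where
  "hyp_affine_on I f \<longleftrightarrow> (\<exists>P Q. \<forall>s\<in>I. f s = cosh s *\<^sub>R P + sinh s *\<^sub>R Q)"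

lemma hyp_affine_unique:
  fixes P Q P' Q' :: "'v::real_vector"
  assumes "s \<noteq> t" "cosh s *\<^sub>R P + sinh s *\<^sub>R Q = cosh s *\<^sub>R P' + sinh s *\<^sub>R Q'"
    "cosh t *\<^sub>R P + sinh t *\<^sub>R Q = cosh t *\<^sub>R P' + sinh t *\<^sub>R Q'"
  shows "P = P'" "Q = Q'"
proof -
  define D where "D = P - P'"
  define F where "F = Q - Q'"
  have 1: "cosh s *\<^sub>R D + sinh s *\<^sub>R F = 0" "cosh t *\<^sub>R D + sinh t *\<^sub>R F = 0"
    using assms(2,3) by (simp_all add: D_def F_def algebra_simps)
  have "sinh (t - s) *\<^sub>R D = sinh t *\<^sub>R (cosh s *\<^sub>R D + sinh s *\<^sub>R F) - sinh s *\<^sub>R (cosh t *\<^sub>R D + sinh t *\<^sub>R F)"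
    by (simp add: sinh_diff algebra_simps)
  then have "sinh (t - s) *\<^sub>R D = 0" by (simp only: 1) simp
  then have D: "D = 0" using assms(1) by simp
  have "sinh (t - s) *\<^sub>R F = cosh s *\<^sub>R (cosh t *\<^sub>R D + sinh t *\<^sub>R F) - cosh t *\<^sub>R (cosh s *\<^sub>R D + sinh s *\<^sub>R F)"
    by (simp add: sinh_diff algebra_simps)
  then have "sinh (t - s) *\<^sub>R F = 0" by (simp only: 1) simp
  then have "F = 0" using assms(1) by simp
  then show "P = P'" "Q = Q'" using D by (simp_all add: D_def F_def)
qed

text \<open>Any three points of the curve are collinear, so two of them determine all others linearly.\<close>

lemma isometric_curve_hyp_affine:
  assumes J: "a \<in> J" "b \<in> J" "a < b"
    and \<gamma>: "\<And>s. s \<in> J \<Longrightarrow> \<gamma> s \<in> H3" "\<And>s t. s \<in> J \<Longrightarrow> t \<in> J \<Longrightarrow> hdist (\<gamma> s) (\<gamma> t) = \<bar>s - t\<bar>"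
  shows "hyp_affine_on J (\<lambda>s. mink (\<gamma> s))"
proof -
  have S: "0 < sinh (b - a)" using J by simp
  have three: "sinh (z - x) *\<^sub>R mink (\<gamma> y) = sinh (z - y) *\<^sub>R mink (\<gamma> x) + sinh (y - x) *\<^sub>R mink (\<gamma> z)"
    if "x \<in> J" "y \<in> J" "z \<in> J" "x \<le> y" "y \<le> z" for x y z
    using collinear_mink[of "\<gamma> x" "\<gamma> y" "\<gamma> z" "y - x" "z - y"] \<gamma> that by simp
  have rel: "sinh (b - a) *\<^sub>R mink (\<gamma> s) = sinh (b - s) *\<^sub>R mink (\<gamma> a) + sinh (s - a) *\<^sub>R mink (\<gamma> b)" if s: "s \<in> J" for s
  proof -
    consider "s \<le> a" | "a \<le> s \<and> s \<le> b" | "b \<le> s" by linarith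
    then show ?thesis
    proof cases
      case 1
      have "sinh (s - a) = - sinh (a - s)" using sinh_minus[of "a - s"] by simp
      then show ?thesis using three[of s a b] 1 s J by simp
    next
      case 2
      then show ?thesis using three[of a s b] s J by simp
    next
      case 3
      have "sinh (b - s) = - sinh (s - b)" using sinh_minus[of "s - b"] by simp
      then show ?thesis using three[of a b s] 3 s J by simp
    qed
  qed
  let ?P = "(sinh b / sinh (b - a)) *\<^sub>R mink (\<gamma> a) - (sinh a / sinh (b - a)) *\<^sub>R mink (\<gamma> b)"
  let ?Q = "(cosh a / sinh (b - a)) *\<^sub>R mink (\<gamma> b) - (cosh b / sinh (b - a)) *\<^sub>R mink (\<gamma> a)"
  have "mink (\<gamma> s) = cosh s *\<^sub>R ?P + sinh s *\<^sub>R ?Q" if s: "s \<in> J" for s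
  proof -
    have "mink (\<gamma> s) = (1 / sinh (b - a)) *\<^sub>R (sinh (b - a) *\<^sub>R mink (\<gamma> s))" using S by simp
    also have "\<dots> = (sinh (b - s) / sinh (b - a)) *\<^sub>R mink (\<gamma> a) + (sinh (s - a) / sinh (b - a)) *\<^sub>R mink (\<gamma> b)"
      unfolding rel[OF s] by (simp add: scaleR_right_distrib)
    also have "\<dots> = cosh s *\<^sub>R ?P + sinh s *\<^sub>R ?Q"
      unfolding sinh_diff[of b s] sinh_diff[of s a] by (simp add: algebra_simps diff_divide_distrib)
    finally show ?thesis .
  qed
  then show ?thesis unfolding hyp_affine_on_def by blast
qed

text \<open>Two points determine the coefficients, hence these are locally constant. The hypothesis \<open>right\<close>
  provides two points in every neighbourhood.\<close>

lemma hyp_affine_on_connected: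
  fixes f :: "real \<Rightarrow> 'v::real_vector"
  assumes I: "connected I" and right: "\<And>x. x \<in> I \<Longrightarrow> \<exists>\<delta>>0. {x..<x + \<delta>} \<subseteq> I"
    and loc: "\<And>x. x \<in> I \<Longrightarrow> \<exists>\<epsilon>>0. hyp_affine_on (I \<inter> ball x \<epsilon>) f"
  shows "hyp_affine_on I f"
proof (cases "I = {}")
  case True
  then show ?thesis by (simp add: hyp_affine_on_def)
next
  case False
  then obtain a where a: "a \<in> I" by blast
  obtain \<epsilon> where \<epsilon>: "0 < \<epsilon>" "hyp_affine_on (I \<inter> ball a \<epsilon>) f" using loc[OF a] by blast
  then obtain P Q where PQ: "\<forall>s\<in>I \<inter> ball a \<epsilon>. f s = cosh s *\<^sub>R P + sinh s *\<^sub>R Q"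
    unfolding hyp_affine_on_def by blast
  define Pr where "Pr t \<longleftrightarrow> (\<exists>\<epsilon>>0. \<forall>s\<in>I \<inter> ball t \<epsilon>. f s = cosh s *\<^sub>R P + sinh s *\<^sub>R Q)" for t
  have "Pr b" if b: "b \<in> I" for b
  proof (rule connected_induction_simple[OF I a b])
    show "Pr a" unfolding Pr_def using \<epsilon>(1) PQ by blast
    fix c assume c: "c \<in> I"
    obtain \<epsilon>' where e': "0 < \<epsilon>'" "hyp_affine_on (I \<inter> ball c \<epsilon>') f" using loc[OF c] by blast
    then obtain P' Q' where PQ': "\<forall>s\<in>I \<inter> ball c \<epsilon>'. f s = cosh s *\<^sub>R P' + sinh s *\<^sub>R Q'"
      unfolding hyp_affine_on_def by blast
    have step: "Pr y" if x: "x \<in> I \<inter> ball c \<epsilon>'" and y: "y \<in> I \<inter> ball c \<epsilon>'" and Px: "Pr x" for x y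
    proof -
      obtain e1 where e1: "0 < e1" "\<forall>s\<in>I \<inter> ball x e1. f s = cosh s *\<^sub>R P + sinh s *\<^sub>R Q" using Px unfolding Pr_def by blast
      obtain e2 where e2: "0 < e2" "ball x e2 \<subseteq> ball c \<epsilon>'" using x by (meson IntD2 openE open_ball)
      obtain e3 where e3: "0 < e3" "{x..<x + e3} \<subseteq> I" using right x by blast
      define t where "t = x + min e1 (min e2 e3) / 2"
      have t: "x < t" "t < x + e1" "t < x + e2" "t < x + e3" using e1(1) e2(1) e3(1) by (auto simp: t_def min_def)
      have tI: "t \<in> I" using t e3(2) by auto
      have t1: "t \<in> ball x e1" "t \<in> ball x e2" using t by (auto simp: dist_real_def)
      have x1: "x \<in> ball x e1" using e1(1) by simp
      have fx: "f x = cosh x *\<^sub>R P + sinh x *\<^sub>R Q" "f x = cosh x *\<^sub>R P' + sinh x *\<^sub>R Q'"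
        using e1(2) PQ' x x1 by blast+
      have ft: "f t = cosh t *\<^sub>R P + sinh t *\<^sub>R Q" "f t = cosh t *\<^sub>R P' + sinh t *\<^sub>R Q'"
        using e1(2) PQ' tI t1 e2(2) by blast+
      have "P = P'" "Q = Q'"
        using hyp_affine_unique[OF less_imp_neq[OF t(1)] trans[OF fx(1)[symmetric] fx(2)] trans[OF ft(1)[symmetric] ft(2)]]
        by simp_all
      moreover obtain e4 where e4: "0 < e4" "ball y e4 \<subseteq> ball c \<epsilon>'" using y by (meson IntD2 openE open_ball)
      ultimately have "\<forall>s\<in>I \<inter> ball y e4. f s = cosh s *\<^sub>R P + sinh s *\<^sub>R Q" using PQ' by blast
      then show "Pr y" unfolding Pr_def using e4(1) by blast
    qed
    show "\<exists>T. openin (top_of_set I) T \<and> c \<in> T \<and> (\<forall>x\<in>T. \<forall>y\<in>T. Pr x \<longrightarrow> Pr y)"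
    proof (intro exI[of _ "I \<inter> ball c \<epsilon>'"] conjI ballI impI)
      show "openin (top_of_set I) (I \<inter> ball c \<epsilon>')" by (rule openin_open_Int) simp
      show "c \<in> I \<inter> ball c \<epsilon>'" using c e'(1) by simp
    qed (rule step)
  qed
  then have "\<forall>s\<in>I. f s = cosh s *\<^sub>R P + sinh s *\<^sub>R Q" unfolding Pr_def by force
  then show ?thesis unfolding hyp_affine_on_def by blast
qed

section \<open>Fermi coordinates along a geodesic plane\<close>

text \<open>\<open>fermi q t\<close> is the point at time \<open>t\<close> on the unit-speed geodesic orthogonal to the plane
  \<open>Re z = 0\<close> at \<open>q\<close>. The next two functions are its inverse: the nearest-point projection to the plane
  and the signed distance from it.\<close>

definition fermi :: "point3 \<Rightarrow> real \<Rightarrow> point3" where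
  "fermi q t = (fst q + of_real (snd q * tanh t), snd q / cosh t)"

definition fermi_foot :: "point3 \<Rightarrow> point3" where
  "fermi_foot p = (\<i> * of_real (Im (fst p)), sqrt ((Re (fst p))\<^sup>2 + (snd p)\<^sup>2))"

definition fermi_time :: "point3 \<Rightarrow> real" where
  "fermi_time p = arsinh (Re (fst p) / snd p)"

definition wall :: "point3 set" where
  "wall = {q \<in> H3. Re (fst q) = 0}"

lemma wall_H3: "q \<in> wall \<Longrightarrow> q \<in> H3"
  by (simp add: wall_def)

lemma fermi_H3: "q \<in> H3 \<Longrightarrow> fermi q t \<in> H3"
  by (simp add: fermi_def H3_def)

lemma fermi_0 [simp]: "fermi q 0 = q"
  by (simp add: fermi_def)

lemma tanh_square_plus: "(tanh t)\<^sup>2 + 1 / (cosh t)\<^sup>2 = (1::real)"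
proof -
  have "(cosh t)\<^sup>2 \<noteq> 0" by simp
  moreover have "(sinh t)\<^sup>2 + 1 = (cosh t)\<^sup>2" by (simp add: cosh_square_eq)
  ultimately have "((sinh t)\<^sup>2 + 1) / (cosh t)\<^sup>2 = 1" by simp
  then show ?thesis by (simp only: tanh_def power_divide add_divide_distrib)
qed

lemma mink_fermi:
  assumes "q \<in> wall"
  shows "mink (fermi q t) = cosh t *\<^sub>R mink q + sinh t *\<^sub>R (0, 1, 0)"
proof -
  have s: "0 < snd q" and r: "Re (fst q) = 0" using assms by (auto simp: wall_def H3_def)
  have c: "cosh t > 0" by simp
  have 1: "(fst q + of_real (snd q * tanh t)) /\<^sub>R (snd q / cosh t) = cosh t *\<^sub>R (fst q /\<^sub>R snd q) + sinh t *\<^sub>R 1"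
    using s c by (intro complex_eqI) (simp_all add: tanh_def field_simps)
  have "(cmod (fst q + of_real (snd q * tanh t)))\<^sup>2 = (snd q * tanh t)\<^sup>2 + (cmod (fst q))\<^sup>2"
    using r by (simp add: cmod_power2)
  then have "(cmod (fst q + of_real (snd q * tanh t)))\<^sup>2 + (snd q / cosh t)\<^sup>2
      = (cmod (fst q))\<^sup>2 + (snd q)\<^sup>2 * ((tanh t)\<^sup>2 + 1 / (cosh t)\<^sup>2)"
    by (simp add: power_mult_distrib power_divide algebra_simps)
  also have "(tanh t)\<^sup>2 + 1 / (cosh t)\<^sup>2 = 1" by (rule tanh_square_plus)
  finally have 2: "((cmod (fst q + of_real (snd q * tanh t)))\<^sup>2 + (snd q / cosh t)\<^sup>2) / (snd q / cosh t)
      = cosh t * (((cmod (fst q))\<^sup>2 + (snd q)\<^sup>2) / snd q)"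
    using s c by (simp add: field_simps)
  show ?thesis unfolding mink_def fermi_def fst_conv snd_conv 1 2 by simp
qed

lemma cosh_hdist_fermi:
  assumes "p \<in> wall" "q \<in> wall"
  shows "cosh (hdist (fermi p s) (fermi q t)) = cosh s * cosh t * cosh (hdist p q) - sinh s * sinh t"
proof -
  have H: "p \<in> H3" "q \<in> H3" using assms wall_H3 by auto
  have n: "mform (mink p) (0, 1, 0) = 0" "mform (0, 1, 0) (mink q) = 0" "mform (0, 1, 0) (0, 1, 0) = - 1"
    using assms by (simp_all add: mform_def mink_def wall_def inner_complex_def)
  have "cosh (hdist (fermi p s) (fermi q t)) = mform (mink (fermi p s)) (mink (fermi q t))"
    by (rule mform_mink[OF fermi_H3[OF H(1)] fermi_H3[OF H(2)], symmetric])
  also have "\<dots> = cosh s * cosh t * mform (mink p) (mink q) - sinh s * sinh t"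
    unfolding mink_fermi[OF assms(1)] mink_fermi[OF assms(2)] mform_linear n by simp
  finally show ?thesis by (simp only: mform_mink[OF H])
qed

lemma fermi_foot_wall: "p \<in> H3 \<Longrightarrow> fermi_foot p \<in> wall"
  by (auto simp: fermi_foot_def wall_def H3_def add_nonneg_pos)

lemma fermi_foot_time:
  assumes "p \<in> H3"
  shows "fermi (fermi_foot p) (fermi_time p) = p"
proof -
  let ?x = "Re (fst p)" and ?h = "snd p"
  let ?s = "sqrt (?x\<^sup>2 + ?h\<^sup>2)"
  have h: "0 < ?h" using assms by (simp add: H3_def)
  have s: "0 < ?s" using h by (simp add: add_nonneg_pos)
  have "(?x / ?h)\<^sup>2 + 1 = (?x\<^sup>2 + ?h\<^sup>2) / ?h\<^sup>2" using h by (simp add: field_simps)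
  then have c: "cosh (fermi_time p) = ?s / ?h"
    using h by (simp add: fermi_time_def cosh_arsinh_real real_sqrt_divide)
  have t: "tanh (fermi_time p) = ?x / ?s"
    unfolding tanh_def c using h s by (simp add: fermi_time_def)
  have 1: "?s * (?x / ?s) = ?x" "?s / (?s / ?h) = ?h" using s h by simp_all
  have "fermi (fermi_foot p) (fermi_time p) = (\<i> * of_real (Im (fst p)) + of_real (?s * (?x / ?s)), ?s / (?s / ?h))"
    unfolding fermi_def fermi_foot_def fst_conv snd_conv t c ..
  also have "\<dots> = (\<i> * of_real (Im (fst p)) + of_real ?x, ?h)" by (simp only: 1)
  also have "\<dots> = p" by (simp add: prod_eq_iff complex_eq_iff)
  finally show ?thesis .
qed

lemma fermi_time_fermi:
  assumes "q \<in> wall"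
  shows "fermi_time (fermi q t) = t"
proof -
  have s: "0 < snd q" and r: "Re (fst q) = 0" using assms by (auto simp: wall_def H3_def)
  have "Re (fst (fermi q t)) / snd (fermi q t) = sinh t"
    using s r by (simp add: fermi_def tanh_def)
  then show ?thesis by (simp add: fermi_time_def arsinh_sinh_real)
qed

lemma fermi_foot_fermi:
  assumes "q \<in> wall"
  shows "fermi_foot (fermi q t) = q"
proof -
  have s: "0 < snd q" and r: "Re (fst q) = 0" using assms by (auto simp: wall_def H3_def)
  have c: "cosh t > 0" by simp
  have "(Re (fst (fermi q t)))\<^sup>2 + (snd (fermi q t))\<^sup>2 = (snd q)\<^sup>2 * ((tanh t)\<^sup>2 + 1 / (cosh t)\<^sup>2)"
    using r by (simp add: fermi_def power_mult_distrib power_divide algebra_simps)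
  also have "(tanh t)\<^sup>2 + 1 / (cosh t)\<^sup>2 = 1" by (rule tanh_square_plus)
  finally have "sqrt ((Re (fst (fermi q t)))\<^sup>2 + (snd (fermi q t))\<^sup>2) = snd q" using s by simp
  moreover have "\<i> * of_real (Im (fst (fermi q t))) = fst q"
    using r by (simp add: fermi_def complex_eq_iff)
  ultimately show ?thesis by (simp add: fermi_foot_def)
qed

lemma continuous_on_fermi_foot: "continuous_on A fermi_foot"
  unfolding fermi_foot_def by (intro continuous_intros)

lemma continuous_on_fermi_time: "A \<subseteq> H3 \<Longrightarrow> continuous_on A fermi_time"
  unfolding fermi_time_def
  by (rule continuous_on_compose2[OF continuous_on_arsinh[of UNIV]], rule continuous_on_divide)
    (auto simp: H3_def intro!: continuous_intros)

lemma continuous_on_fermi: "continuous_on A (\<lambda>(q, t). fermi q t)"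
  unfolding fermi_def case_prod_beta by (intro continuous_intros) auto

lemma fermi_time_nonneg_iff: "p \<in> H3 \<Longrightarrow> 0 \<le> fermi_time p \<longleftrightarrow> 0 \<le> Re (fst p)"
  using sinh_real_le_iff[of 0 "fermi_time p"] by (simp add: fermi_time_def H3_def zero_le_divide_iff)

text \<open>A point of the half-space is determined by its distances to the points of the wall near a given
  point. This characterises the normal geodesic metrically, hence independently of the chart.\<close>

lemma fermi_characterization:
  assumes y: "y \<in> H3_half" and q: "q \<in> wall" and t: "0 \<le> t" and e: "0 < \<epsilon>"
    and eq: "\<And>q'. q' \<in> wall \<Longrightarrow> hdist q q' < \<epsilon> \<Longrightarrow> cosh (hdist y q') = cosh t * cosh (hdist q q')"
  shows "y = fermi q t"
proof -
  have yH: "y \<in> H3" using y by (simp add: H3_half_def)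
  have qH: "q \<in> H3" using q by (rule wall_H3)
  have s: "0 < snd q" and sy: "0 < snd y" using qH yH by (auto simp: H3_def)
  have rq: "Re (fst q) = 0" using q by (simp add: wall_def)
  obtain \<delta> where \<delta>: "0 < \<delta>" "\<And>q'. dist q q' < \<delta> \<Longrightarrow> q' \<in> H3 \<and> hdist q q' < \<epsilon>"
    using dist_small_imp_hdist_small[OF qH e] by metis
  \<comment> \<open>Clearing denominators turns the hypothesis into equality of two quadratic polynomials in the
    coordinates of \<open>q'\<close>; three values determine the coefficients.\<close>
  define m where "m = fermi q t"
  have mH: "m \<in> H3" unfolding m_def by (rule fermi_H3[OF qH])
  have sm: "0 < snd m" using mH by (simp add: H3_def)
  have ct: "0 < cosh t" by simp
  have rel: "((cmod (fst y - fst q'))\<^sup>2 + (snd y)\<^sup>2 + (snd q')\<^sup>2) / snd y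
      = ((cmod (fst m - fst q'))\<^sup>2 + (snd m)\<^sup>2 + (snd q')\<^sup>2) / snd m"
    if q': "Re (fst q') = 0" "dist q q' < \<delta>" for q'
  proof -
    have q'H: "q' \<in> H3" "hdist q q' < \<epsilon>" using \<delta>(2) q' by auto
    have q'w: "q' \<in> wall" using q'H q' by (simp add: wall_def)
    have s': "0 < snd q'" using q'H by (simp add: H3_def)
    have "cosh (hdist m q') = cosh t * cosh (hdist q q')"
      using cosh_hdist_fermi[OF q q'w, of t 0] by (simp add: m_def)
    then have "cosh (hdist y q') = cosh (hdist m q')" using eq[OF q'w q'H(2)] by simp
    then have "2 * snd q' * cosh (hdist y q') = 2 * snd q' * cosh (hdist m q')" by simp
    moreover have "2 * snd q' * cosh (hdist y q') = ((cmod (fst y - fst q'))\<^sup>2 + (snd y)\<^sup>2 + (snd q')\<^sup>2) / snd y"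
      using cosh_hdist_expand[OF yH q'H(1)] sy by (simp add: field_simps)
    moreover have "2 * snd q' * cosh (hdist m q') = ((cmod (fst m - fst q'))\<^sup>2 + (snd m)\<^sup>2 + (snd q')\<^sup>2) / snd m"
      using cosh_hdist_expand[OF mH q'H(1)] sm by (simp add: field_simps)
    ultimately show ?thesis by simp
  qed
  define c where "c p b \<sigma> = ((Re (fst p))\<^sup>2 + (Im (fst p) - b)\<^sup>2 + (snd p)\<^sup>2 + \<sigma>\<^sup>2) / snd p" for p :: point3 and b \<sigma> :: real
  have rel': "c y b \<sigma> = c m b \<sigma>" if "\<bar>b - Im (fst q)\<bar> < \<delta> / 2" "\<bar>\<sigma> - snd q\<bar> < \<delta> / 2" for b \<sigma>
  proof -
    let ?q' = "(\<i> * of_real b, \<sigma>)"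
    have "dist q ?q' \<le> dist (fst q) (fst ?q') + dist (snd q) (snd ?q')"
      unfolding dist_prod_def by (rule sqrt_sum_squares_le_sum) auto
    also have "dist (fst q) (fst ?q') = \<bar>b - Im (fst q)\<bar>"
    proof -
      have "fst q - \<i> * of_real b = \<i> * of_real (Im (fst q) - b)" using rq by (simp add: complex_eq_iff)
      then have "dist (fst q) (fst ?q') = cmod (\<i> * of_real (Im (fst q) - b))" by (simp only: dist_norm fst_conv)
      also have "\<dots> = \<bar>Im (fst q) - b\<bar>" by (simp only: norm_mult norm_ii norm_of_real mult_1_left)
      finally show ?thesis by (simp only: abs_minus_commute)
    qed
    also have "dist (snd q) (snd ?q') = \<bar>\<sigma> - snd q\<bar>" by (simp add: dist_real_def)
    also have "\<bar>b - Im (fst q)\<bar> + \<bar>\<sigma> - snd q\<bar> < \<delta>" using that by linarith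
    finally have "dist q ?q' < \<delta>" .
    from rel[of ?q', OF _ this] show ?thesis by (simp add: c_def cmod_power2 add.assoc)
  qed
  define b0 where "b0 = Im (fst q)"
  define h where "h = \<delta> / 4"
  have h: "0 < h" "h < \<delta> / 2" using \<delta>(1) by (simp_all add: h_def)
  have e0: "c y b0 (snd q) = c m b0 (snd q)" by (rule rel') (use \<delta>(1) in \<open>simp_all add: b0_def\<close>)
  have e1: "c y b0 (snd q + h) = c m b0 (snd q + h)" by (rule rel') (use \<delta>(1) h in \<open>simp_all add: b0_def\<close>)
  have e2: "c y (b0 + h) (snd q) = c m (b0 + h) (snd q)" by (rule rel') (use \<delta>(1) h in \<open>simp_all add: b0_def\<close>)
  have d1: "c p b0 (snd q + h) - c p b0 (snd q) = (2 * snd q * h + h\<^sup>2) / snd p" for p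
    unfolding c_def by (simp add: power2_sum flip: diff_divide_distrib)
  have "(2 * snd q * h + h\<^sup>2) / snd y = (2 * snd q * h + h\<^sup>2) / snd m"
    using e0 e1 d1[of y] d1[of m] by linarith
  moreover have "2 * snd q * h + h\<^sup>2 > 0" using s h by (simp add: add_pos_pos)
  ultimately have snd_eq: "snd y = snd m" using sy sm by (simp add: field_simps)
  have "(Im (fst y) - (b0 + h))\<^sup>2 - (Im (fst y) - b0)\<^sup>2 = (Im (fst m) - (b0 + h))\<^sup>2 - (Im (fst m) - b0)\<^sup>2"
    using e0 e2 sm unfolding c_def snd_eq by (simp add: field_simps)
  then have "2 * h * Im (fst y) = 2 * h * Im (fst m)" by (auto simp: power2_eq_square algebra_simps)
  then have Im_eq: "Im (fst y) = Im (fst m)" using h by simp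
  have Re2: "(Re (fst y))\<^sup>2 = (Re (fst m))\<^sup>2"
    using e0 sm unfolding c_def snd_eq Im_eq by simp
  have "0 \<le> Re (fst y)" using y by (simp add: H3_half_def)
  moreover have "0 \<le> Re (fst m)" using s t rq by (simp add: m_def fermi_def)
  ultimately have "Re (fst y) = Re (fst m)" using Re2 by (simp add: power2_eq_iff_nonneg)
  then show ?thesis using snd_eq Im_eq by (simp add: m_def[symmetric] prod_eq_iff complex_eq_iff)
qed

section \<open>The volume of a tube over a piece of a geodesic plane\<close>

lemma hvol_open_pos:
  assumes "open U" "U \<subseteq> H3" "U \<noteq> {}"
  shows "0 < emeasure hvol U"
proof (rule ccontr)
  assume "\<not> 0 < emeasure hvol U"
  then have "emeasure hvol U = 0" by simp
  then have "(\<integral>\<^sup>+p. ennreal (indicator H3 p / snd p ^ 3) * indicator U p \<partial>lborel) = 0"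
    using emeasure_hvol[of U] assms(1) by simp
  moreover have "(\<lambda>p. ennreal (indicator H3 p / snd p ^ 3) * indicator U p) \<in> borel_measurable lborel"
    using assms(1) by (intro borel_measurable_times_ennreal borel_measurable_indicator) simp_all
  ultimately have "AE p in lborel. ennreal (indicator H3 p / snd p ^ 3) * indicator U p = 0"
    by (simp add: nn_integral_0_iff_AE)
  then have "AE p in lborel. p \<notin> U"
    by eventually_elim (use assms(2) in \<open>auto simp: indicator_def H3_def split: if_splits\<close>)
  then have "U \<in> null_sets lborel"
    using assms(1) AE_iff_null_sets[of U lborel] by simp
  then have "negligible U" using null_sets_completionI negligible_iff_null_sets by blast
  then show False using open_not_negligible[OF assms(1,3)] by simp
qed

lemma lborel_complex_eq: "lborel = distr (lborel \<Otimes>\<^sub>M lborel) borel (\<lambda>(x, y). Complex x y)"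
proof (rule lborel_eqI)
  have m: "(\<lambda>(x, y). Complex x y) \<in> measurable (lborel \<Otimes>\<^sub>M lborel) borel"
    unfolding lborel_prod measurable_lborel2
    by (intro borel_measurable_continuous_onI) (auto simp: case_prod_beta Complex_eq intro!: continuous_intros)
  fix l u :: complex assume le: "\<And>b. b \<in> Basis \<Longrightarrow> l \<bullet> b \<le> u \<bullet> b"
  have "Re l \<le> Re u" "Im l \<le> Im u" using le[of 1] le[of \<i>] by (auto simp: Basis_complex_def)
  moreover have "emeasure (distr (lborel \<Otimes>\<^sub>M lborel) borel (\<lambda>(x, y). Complex x y)) (box l u)
      = emeasure (lborel \<Otimes>\<^sub>M lborel) ({Re l<..<Re u} \<times> {Im l<..<Im u})"
    by (subst emeasure_distr[OF m]) (auto intro!: arg_cong2[where f=emeasure] simp: box_def Basis_complex_def space_pair_measure)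
  moreover have "\<dots> = emeasure lborel {Re l<..<Re u} * emeasure lborel {Im l<..<Im u}"
    by (rule lborel.emeasure_pair_measure_Times) auto
  ultimately show "emeasure (distr (lborel \<Otimes>\<^sub>M lborel) borel (\<lambda>(x, y). Complex x y)) (box l u) = ennreal (\<Prod>b\<in>Basis. (u - l) \<bullet> b)"
    by (simp add: Basis_complex_def ennreal_mult)
qed simp

lemma nn_integral_lborel_complex:
  assumes f: "f \<in> borel_measurable borel"
  shows "(\<integral>\<^sup>+z. f z \<partial>lborel) = (\<integral>\<^sup>+x. \<integral>\<^sup>+y. f (Complex x y) \<partial>lborel \<partial>lborel)"
proof -
  have m: "(\<lambda>(x, y). Complex x y) \<in> measurable (lborel \<Otimes>\<^sub>M lborel) borel"
    unfolding lborel_prod measurable_lborel2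
    by (intro borel_measurable_continuous_onI) (auto simp: case_prod_beta Complex_eq intro!: continuous_intros)
  have "(\<integral>\<^sup>+z. f z \<partial>lborel) = (\<integral>\<^sup>+z. f z \<partial>distr (lborel \<Otimes>\<^sub>M lborel) borel (\<lambda>(x, y). Complex x y))"
    by (simp only: lborel_complex_eq[symmetric])
  also have "\<dots> = (\<integral>\<^sup>+p. f (case p of (x, y) \<Rightarrow> Complex x y) \<partial>(lborel \<Otimes>\<^sub>M lborel))"
    by (rule nn_integral_distr[OF m]) (simp add: f)
  also have "\<dots> = (\<integral>\<^sup>+x. \<integral>\<^sup>+y. f (Complex x y) \<partial>lborel \<partial>lborel)"
    by (subst lborel.nn_integral_fst[symmetric]) (rule measurable_compose[OF m f], simp)
  finally show ?thesis .
qed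

lemma nn_integral_sqrt_arsinh:
  assumes "0 \<le> w"
  shows "(\<integral>\<^sup>+u. ennreal (sqrt (u\<^sup>2 + 1)) * indicator {0..<w} (arsinh u) \<partial>lborel) = ennreal ((w + sinh w * cosh w) / 2)"
proof -
  have "(\<integral>\<^sup>+u. ennreal (sqrt (u\<^sup>2 + 1)) * indicator {0..<w} (arsinh u) \<partial>lborel)
     = (\<integral>\<^sup>+u. ennreal (sqrt (u\<^sup>2 + 1)) * indicator {0..sinh w} u \<partial>lborel)"
  proof (rule nn_integral_cong_AE)
    have "AE u in lborel. u \<noteq> sinh w" by (rule AE_lborel_singleton)
    then show "AE u in lborel. ennreal (sqrt (u\<^sup>2 + 1)) * indicator {0..<w} (arsinh u) = ennreal (sqrt (u\<^sup>2 + 1)) * indicator {0..sinh w} u"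
    proof eventually_elim
      case (elim u)
      have "0 \<le> arsinh u \<longleftrightarrow> 0 \<le> u" using sinh_real_le_iff[of 0 "arsinh u"] by simp
      moreover have "arsinh u < w \<longleftrightarrow> u < sinh w" using sinh_real_less_iff[of "arsinh u" w] by simp
      ultimately show ?case using elim by (auto simp: indicator_def)
    qed
  qed
  also have "\<dots> = ennreal ((arsinh (sinh w) + sinh w * sqrt ((sinh w)\<^sup>2 + 1)) / 2 - (arsinh 0 + 0 * sqrt (0\<^sup>2 + 1)) / 2)"
  proof (rule nn_integral_FTC_Icc)
    show "(\<lambda>u::real. sqrt (u\<^sup>2 + 1)) \<in> borel_measurable borel" by measurable
    show "0 \<le> sinh w" using assms by simp
    fix u :: real assume "u \<in> {0..sinh w}"
    have p: "0 < u\<^sup>2 + 1" by (simp add: add_nonneg_pos)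
    have s: "sqrt (u\<^sup>2 + 1) * sqrt (u\<^sup>2 + 1) = u\<^sup>2 + 1" using p by simp
    have s0: "sqrt (u\<^sup>2 + 1) > 0" using p by simp
    have "((\<lambda>u. (arsinh u + u * sqrt (u\<^sup>2 + 1)) / 2) has_real_derivative
       (1 / sqrt (u\<^sup>2 + 1) + (1 * sqrt (u\<^sup>2 + 1) + (inverse (sqrt (u\<^sup>2 + 1)) / 2 * (2 * u)) * u)) / 2) (at u)"
      using p by (auto intro!: derivative_eq_intros)
    moreover have "(1 / sqrt (u\<^sup>2 + 1) + (1 * sqrt (u\<^sup>2 + 1) + (inverse (sqrt (u\<^sup>2 + 1)) / 2 * (2 * u)) * u)) / 2 = sqrt (u\<^sup>2 + 1)"
      using s s0 by (simp add: field_simps power2_eq_square)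
    ultimately show "((\<lambda>u. (arsinh u + u * sqrt (u\<^sup>2 + 1)) / 2) has_real_derivative sqrt (u\<^sup>2 + 1)) (at u)" by (simp only:)
  qed (auto simp: add_nonneg_nonneg)
  also have "sqrt ((sinh w)\<^sup>2 + 1) = cosh w" by (simp flip: cosh_square_eq)
  finally show ?thesis by (simp add: arsinh_sinh_real)
qed

text \<open>Hyperbolic area in the plane \<open>Re z = 0\<close>, with area element \<open>dy ds / s\<^sup>2\<close>.\<close>

definition wall_area :: "point3 set \<Rightarrow> ennreal" where
  "wall_area Q = (\<integral>\<^sup>+y. \<integral>\<^sup>+s. ennreal (indicator {0<..} s / s\<^sup>2) * indicator Q (Complex 0 y, s) \<partial>lborel \<partial>lborel)"

text \<open>Substitute \<open>x = h u\<close> with \<open>u = sinh t\<close> for fixed \<open>h\<close>, and then \<open>s = h sqrt (1 + u\<^sup>2)\<close> for fixed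
  \<open>u\<close>. Both substitutions are linear in the variable of integration, and the volume element
  \<open>dx dy dh / h^3\<close> becomes \<open>sqrt (1 + u\<^sup>2) du\<close> times the area element of the wall.\<close>

lemma hvol_tube:
  assumes Q [measurable]: "Q \<in> sets borel" and w: "0 \<le> w"
  shows "emeasure hvol {p \<in> H3. fermi_foot p \<in> Q \<and> fermi_time p \<in> {0..<w}} = wall_area Q * ennreal ((w + sinh w * cosh w) / 2)"
proof -
  let ?Y = "{p \<in> H3. fermi_foot p \<in> Q \<and> fermi_time p \<in> {0..<w}}"
  have Y: "?Y \<in> sets borel"
  proof -
    have "H3 \<inter> fermi_foot -` Q \<in> sets borel" "H3 \<inter> fermi_time -` {0..<w} \<in> sets borel"
      using open_H3 by (intro borel_vimage_continuous_on continuous_on_fermi_foot continuous_on_fermi_time; simp)+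
    then have "(H3 \<inter> fermi_foot -` Q) \<inter> (H3 \<inter> fermi_time -` {0..<w}) \<in> sets borel" by (rule sets.Int)
    moreover have "(H3 \<inter> fermi_foot -` Q) \<inter> (H3 \<inter> fermi_time -` {0..<w}) = ?Y" by blast
    ultimately show ?thesis by (simp only:)
  qed
  define T where "T x y h = ennreal (indicator {0<..} h / h ^ 3) * indicator Q (Complex 0 y, sqrt (x\<^sup>2 + h\<^sup>2)) * indicator {0..<w} (arsinh (x / h))" for x y h :: real
  define T' where "T' u y h = ennreal (indicator {0<..} h / h\<^sup>2) * indicator Q (Complex 0 y, h * sqrt (u\<^sup>2 + 1)) * indicator {0..<w} (arsinh u)" for u y h :: real
  define A where "A y s = ennreal (indicator {0<..} s / s\<^sup>2) * indicator Q (Complex 0 y, s)" for y s :: real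
  have ar [measurable]: "(arsinh :: real \<Rightarrow> real) \<in> borel_measurable borel"
    by (intro borel_measurable_continuous_onI continuous_on_arsinh)
  have C0 [measurable]: "(\<lambda>y. Complex 0 y) \<in> borel_measurable borel"
    by (intro borel_measurable_continuous_onI) (simp add: Complex_eq continuous_intros)
  have TQ: "(\<lambda>x. indicator Q (Complex 0 (f x), g x) :: ennreal) \<in> borel_measurable M"
    if [measurable]: "f \<in> borel_measurable M" "g \<in> borel_measurable M" for f g :: "'m \<Rightarrow> real" and M
  proof -
    have "(\<lambda>x. (Complex 0 (f x), g x)) \<in> measurable M borel"
      by (intro borel_measurable_Pair measurable_compose[OF _ C0]) measurable
    then show ?thesis by (rule measurable_compose) (simp add: borel_measurable_indicator)
  qed
  have Tm: "(\<lambda>v. T (f v) (g v) (k v)) \<in> borel_measurable M" 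
    if [measurable]: "f \<in> borel_measurable M" "g \<in> borel_measurable M" "k \<in> borel_measurable M" for f g k :: "'m \<Rightarrow> real" and M
    unfolding T_def by (intro borel_measurable_times_ennreal TQ) measurable
  have T'm: "(\<lambda>v. T' (f v) (g v) (k v)) \<in> borel_measurable M" 
    if [measurable]: "f \<in> borel_measurable M" "g \<in> borel_measurable M" "k \<in> borel_measurable M" for f g k :: "'m \<Rightarrow> real" and M
    unfolding T'_def by (intro borel_measurable_times_ennreal TQ) measurable
  have Am: "(\<lambda>v. A (f v) (g v)) \<in> borel_measurable M" 
    if [measurable]: "f \<in> borel_measurable M" "g \<in> borel_measurable M" for f g :: "'m \<Rightarrow> real" and M
    unfolding A_def by (intro borel_measurable_times_ennreal TQ) measurable
  let ?F = "\<lambda>p::point3. ennreal (indicator H3 p / snd p ^ 3) * indicator ?Y p"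
  have Fm: "?F \<in> borel_measurable borel"
    using Y by (intro borel_measurable_times_ennreal hvol_density_measurable borel_measurable_indicator) simp
  have FT: "?F (Complex x y, h) = T x y h" for x y h
    unfolding T_def
    by (auto simp: indicator_def H3_def fermi_foot_def fermi_time_def Complex_eq)
  have "emeasure hvol ?Y = (\<integral>\<^sup>+p. ?F p \<partial>lborel)" by (rule emeasure_hvol[OF Y])
  also have "\<dots> = (\<integral>\<^sup>+p. ?F p \<partial>(lborel \<Otimes>\<^sub>M lborel))" by (simp only: lborel_prod)
  also have "\<dots> = (\<integral>\<^sup>+z. \<integral>\<^sup>+h. ?F (z, h) \<partial>lborel \<partial>lborel)"
    by (rule lborel.nn_integral_fst[symmetric]) (simp only: lborel_prod measurable_lborel2 Fm)
  also have "\<dots> = (\<integral>\<^sup>+x. \<integral>\<^sup>+y. \<integral>\<^sup>+h. ?F (Complex x y, h) \<partial>lborel \<partial>lborel \<partial>lborel)"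
  proof (rule nn_integral_lborel_complex)
    have "?F \<in> borel_measurable (lborel \<Otimes>\<^sub>M lborel)" by (simp only: lborel_prod measurable_lborel2 Fm)
    from lborel.borel_measurable_nn_integral_fst[OF this]
    show "(\<lambda>z. \<integral>\<^sup>+h. ?F (z, h) \<partial>lborel) \<in> borel_measurable borel" by (simp only: measurable_lborel2)
  qed
  also have "\<dots> = (\<integral>\<^sup>+x. \<integral>\<^sup>+y. \<integral>\<^sup>+h. T x y h \<partial>lborel \<partial>lborel \<partial>lborel)" by (simp only: FT)
  also have "\<dots> = (\<integral>\<^sup>+y. \<integral>\<^sup>+x. \<integral>\<^sup>+h. T x y h \<partial>lborel \<partial>lborel \<partial>lborel)"
    by (rule lborel_pair.Fubini'[symmetric]) (unfold case_prod_beta, intro lborel.borel_measurable_nn_integral, unfold case_prod_beta, intro Tm; measurable)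
  also have "\<dots> = (\<integral>\<^sup>+y. \<integral>\<^sup>+h. \<integral>\<^sup>+x. T x y h \<partial>lborel \<partial>lborel \<partial>lborel)"
    by (rule nn_integral_cong, rule lborel_pair.Fubini'[symmetric]) (unfold case_prod_beta, intro Tm; measurable)
  also have "\<dots> = (\<integral>\<^sup>+y. \<integral>\<^sup>+h. \<integral>\<^sup>+u. T' u y h \<partial>lborel \<partial>lborel \<partial>lborel)"
  proof (rule nn_integral_cong, rule nn_integral_cong)
    fix y h :: real
    show "(\<integral>\<^sup>+x. T x y h \<partial>lborel) = (\<integral>\<^sup>+u. T' u y h \<partial>lborel)"
    proof (cases "0 < h")
      case True
      have "(\<integral>\<^sup>+x. T x y h \<partial>lborel) = ennreal \<bar>h\<bar> * (\<integral>\<^sup>+u. T (0 + h * u) y h \<partial>lborel)"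
        using True by (intro nn_integral_real_affine Tm) auto
      also have "\<dots> = (\<integral>\<^sup>+u. ennreal h * T (h * u) y h \<partial>lborel)"
        using True by (simp, subst nn_integral_cmult) (auto intro!: Tm)
      also have "\<dots> = (\<integral>\<^sup>+u. T' u y h \<partial>lborel)"
      proof (rule nn_integral_cong)
        fix u :: real
        have "sqrt ((h * u)\<^sup>2 + h\<^sup>2) = sqrt (h\<^sup>2 * (u\<^sup>2 + 1))" by (simp add: power_mult_distrib algebra_simps)
        also have "\<dots> = h * sqrt (u\<^sup>2 + 1)" using True by (simp add: real_sqrt_mult)
        finally have 1: "sqrt ((h * u)\<^sup>2 + h\<^sup>2) = h * sqrt (u\<^sup>2 + 1)" .
        have 2: "h * u / h = u" using True by simp
        have "ennreal h * ennreal (indicator {0<..} h / h ^ 3) = ennreal (h * (indicator {0<..} h / h ^ 3))"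
          using True by (intro ennreal_mult[symmetric]) auto
        also have "h * (indicator {0<..} h / h ^ 3) = indicator {0<..} h / h\<^sup>2"
          using True by (simp add: power2_eq_square power3_eq_cube)
        finally show "ennreal h * T (h * u) y h = T' u y h"
          unfolding T_def T'_def 1 2 by (simp only: mult.assoc[symmetric])
      qed
      finally show ?thesis .
    qed (simp add: T_def T'_def)
  qed
  also have "\<dots> = (\<integral>\<^sup>+y. \<integral>\<^sup>+u. \<integral>\<^sup>+h. T' u y h \<partial>lborel \<partial>lborel \<partial>lborel)"
    by (rule nn_integral_cong, rule lborel_pair.Fubini') (unfold case_prod_beta, intro T'm; measurable)
  also have "\<dots> = (\<integral>\<^sup>+u. \<integral>\<^sup>+y. \<integral>\<^sup>+h. T' u y h \<partial>lborel \<partial>lborel \<partial>lborel)"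
    by (rule lborel_pair.Fubini') (unfold case_prod_beta, intro lborel.borel_measurable_nn_integral, unfold case_prod_beta, intro T'm; measurable)
  also have "\<dots> = (\<integral>\<^sup>+u. \<integral>\<^sup>+y. ennreal (sqrt (u\<^sup>2 + 1)) * indicator {0..<w} (arsinh u) * (\<integral>\<^sup>+s. A y s \<partial>lborel) \<partial>lborel \<partial>lborel)"
  proof (rule nn_integral_cong, rule nn_integral_cong)
    fix u y :: real
    let ?c = "sqrt (u\<^sup>2 + 1)"
    have c: "0 < ?c" by (simp add: add_nonneg_pos)
    have "(\<integral>\<^sup>+s. A y s \<partial>lborel) = ennreal \<bar>?c\<bar> * (\<integral>\<^sup>+h. A y (0 + ?c * h) \<partial>lborel)"
      using c by (intro nn_integral_real_affine Am) auto
    then have "ennreal ?c * indicator {0..<w} (arsinh u) * (\<integral>\<^sup>+s. A y s \<partial>lborel)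
       = (ennreal ?c * indicator {0..<w} (arsinh u) * ennreal ?c) * (\<integral>\<^sup>+h. A y (?c * h) \<partial>lborel)"
      using c by (simp add: mult.assoc)
    also have "\<dots> = (\<integral>\<^sup>+h. (ennreal ?c * indicator {0..<w} (arsinh u) * ennreal ?c) * A y (?c * h) \<partial>lborel)"
      by (rule nn_integral_cmult[symmetric]) (intro Am; measurable)
    also have "\<dots> = (\<integral>\<^sup>+h. T' u y h \<partial>lborel)"
    proof (rule nn_integral_cong)
      fix h :: real
      have "ennreal ?c * ennreal ?c * ennreal (indicator {0<..} (?c * h) / (?c * h)\<^sup>2)
         = ennreal (?c * ?c * (indicator {0<..} (?c * h) / (?c * h)\<^sup>2))"
      proof -
        have "ennreal (?c * ?c * (indicator {0<..} (?c * h) / (?c * h)\<^sup>2))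
           = ennreal (?c * ?c) * ennreal (indicator {0<..} (?c * h) / (?c * h)\<^sup>2)" by (rule ennreal_mult) auto
        moreover have "ennreal (?c * ?c) = ennreal ?c * ennreal ?c" by (rule ennreal_mult) (use c in auto)
        ultimately show ?thesis by (simp only:)
      qed
      also have "?c * ?c * (indicator {0<..} (?c * h) / (?c * h)\<^sup>2) = indicator {0<..} h / h\<^sup>2"
      proof -
        have "k * k * (indicator {0<..} (k * h) / (k * h)\<^sup>2) = indicator {0<..} h / h\<^sup>2" if "0 < k" for k :: real
          using that by (auto simp: indicator_def power2_eq_square zero_less_mult_iff)
        from this[OF c] show ?thesis .
      qed
      finally have "ennreal ?c * ennreal ?c * ennreal (indicator {0<..} (?c * h) / (?c * h)\<^sup>2) = ennreal (indicator {0<..} h / h\<^sup>2)" .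
      then show "(ennreal ?c * indicator {0..<w} (arsinh u) * ennreal ?c) * A y (?c * h) = T' u y h"
        unfolding A_def T'_def by (simp add: mult.commute mult.left_commute mult.assoc)
    qed
    finally show "(\<integral>\<^sup>+h. T' u y h \<partial>lborel) = ennreal ?c * indicator {0..<w} (arsinh u) * (\<integral>\<^sup>+s. A y s \<partial>lborel)" by (rule sym)
  qed
  also have "\<dots> = (\<integral>\<^sup>+u. ennreal (sqrt (u\<^sup>2 + 1)) * indicator {0..<w} (arsinh u) * (\<integral>\<^sup>+y. \<integral>\<^sup>+s. A y s \<partial>lborel \<partial>lborel) \<partial>lborel)"
    by (rule nn_integral_cong, rule nn_integral_cmult, intro lborel.borel_measurable_nn_integral, unfold case_prod_beta, intro Am; measurable)
  also have "\<dots> = (\<integral>\<^sup>+u. ennreal (sqrt (u\<^sup>2 + 1)) * indicator {0..<w} (arsinh u) \<partial>lborel) * (\<integral>\<^sup>+y. \<integral>\<^sup>+s. A y s \<partial>lborel \<partial>lborel)"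
    by (rule nn_integral_multc) measurable
  also have "\<dots> = ennreal ((w + sinh w * cosh w) / 2) * wall_area Q"
    by (simp only: nn_integral_sqrt_arsinh[OF w] wall_area_def A_def)
  finally show ?thesis by (simp only: mult.commute)
qed

section \<open>Boundary charts\<close>

lemma boundary_chart_charts:
  assumes "boundary_chart p r \<phi>"
  shows "0 < r" "chart H3_half p r \<phi>" "hisometric (ball p r) \<phi>" "\<phi> p \<in> wall" "\<phi> p \<in> H3"
    "\<phi> ` ball p r = H3_half \<inter> hball (\<phi> p) r"
proof -
  show c: "chart H3_half p r \<phi>" using assms by (simp add: boundary_chart_def)
  show r: "0 < r" using c by (simp add: chart_def)
  show iso: "hisometric (ball p r) \<phi>" by (rule chart_hisometric[OF _ c]) simp
  show H: "\<phi> p \<in> H3" by (rule chart_centre_H3[OF _ c]) simp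
  show "\<phi> p \<in> wall" using H assms by (simp add: boundary_chart_def wall_def)
  show "\<phi> ` ball p r = H3_half \<inter> hball (\<phi> p) r" by (rule chart_image_Int[OF _ c]) simp
qed

lemma wall_subset_half: "wall \<subseteq> H3_half"
  by (auto simp: wall_def H3_half_def)

lemma boundary_chart_dist:
  assumes "boundary_chart p r \<phi>" "u \<in> ball p r" "v \<in> ball p r"
  shows "hdist (\<phi> u) (\<phi> v) = dist u v" "\<phi> u \<in> H3" "\<phi> u \<in> H3_half"
  using boundary_chart_charts(3,6)[OF assms(1)] assms(2,3) unfolding hisometric_def by blast+

text \<open>A point of the half-space off the wall has a neighbourhood that is open in \<^term>\<open>H3\<close>. By invariance
  of domain no continuous injection into the half-space takes such a point to the wall.\<close>

lemma bdry_iff_wall: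
  assumes c: "boundary_chart p r \<phi>" and u: "u \<in> ball p r"
  shows "u \<in> bdry \<longleftrightarrow> \<phi> u \<in> wall"
proof
  note b = boundary_chart_charts[OF c]
  assume w: "\<phi> u \<in> wall"
  obtain r' where "0 < r'" "r' \<le> 1" "chart H3_half u r' \<phi>" "ball u r' \<subseteq> ball p r"
    by (rule chart_restrict[OF _ b(2) u zero_less_one]) simp
  then have "boundary_chart u r' \<phi>" using w by (simp add: boundary_chart_def wall_def)
  then show "u \<in> bdry" by (auto simp: bdry_def)
next
  note b = boundary_chart_charts[OF c]
  assume "u \<in> bdry"
  then obtain r' \<xi> where c': "boundary_chart u r' \<xi>" by (auto simp: bdry_def)
  note b' = boundary_chart_charts[OF c']
  show "\<phi> u \<in> wall"
  proof (rule ccontr)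
    assume nw: "\<phi> u \<notin> wall"
    have uH: "\<phi> u \<in> H3" "\<phi> u \<in> H3_half" using boundary_chart_dist[OF c u u] by blast+
    let ?V = "hball (\<phi> p) r \<inter> {q. 0 < Re (fst q)}"
    let ?\<psi> = "inv_into (ball p r) \<phi>"
    have oV: "open ?V" by (intro open_Int open_hball[OF b(5)] open_Collect_less continuous_intros)
    have Vim: "?V \<subseteq> \<phi> ` ball p r" unfolding b(6) by (auto simp: H3_half_def)
    have "hdist (\<phi> p) (\<phi> u) < r" using b(6) u by blast
    moreover have "0 < Re (fst (\<phi> u))" using nw uH by (simp add: wall_def H3_half_def)
    ultimately have uV: "\<phi> u \<in> ?V" using uH by simp
    have inj: "inj_on \<phi> (ball p r)" by (rule hisometric_inj_on[OF b(3)])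
    have cV: "continuous_on ?V ?\<psi>" by (rule continuous_on_subset[OF hisometric_inverse[OF b(3)] Vim])
    have inv: "?\<psi> q \<in> ball p r" "\<phi> (?\<psi> q) = q" if "q \<in> ?V" for q
    proof -
      have "q \<in> \<phi> ` ball p r" using Vim that by blast
      then show "?\<psi> q \<in> ball p r" "\<phi> (?\<psi> q) = q" by (rule inv_into_into, rule f_inv_into_f)
    qed
    let ?W = "?V \<inter> ?\<psi> -` ball u r'"
    have oW: "open ?W" by (rule continuous_open_preimage[OF cV oV]) simp
    have \<psi>u: "?\<psi> (\<phi> u) = u" by (rule inv_into_f_f[OF inj u])
    have uW: "\<phi> u \<in> ?W" using uV \<psi>u b'(1) by simp
    have cf: "continuous_on ?W (\<lambda>q. \<xi> (?\<psi> q))"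
      by (rule continuous_on_compose2[OF hisometric_continuous_on[OF b'(3)] continuous_on_subset[OF cV]]) auto
    have injf: "inj_on (\<lambda>q. \<xi> (?\<psi> q)) ?W"
    proof (rule inj_onI)
      fix q q' assume q: "q \<in> ?W" "q' \<in> ?W" "\<xi> (?\<psi> q) = \<xi> (?\<psi> q')"
      then have e: "?\<psi> q = ?\<psi> q'" using inj_onD[OF hisometric_inj_on[OF b'(3)], of "?\<psi> q" "?\<psi> q'"] by simp
      have "q \<in> ?V" "q' \<in> ?V" using q(1,2) by blast+
      from inv(2)[OF this(1)] inv(2)[OF this(2)] show "q = q'" unfolding e by simp
    qed
    have "open ((\<lambda>q. \<xi> (?\<psi> q)) ` ?W)" by (rule invariance_of_domain[OF cf oW injf])
    moreover have "\<xi> u \<in> (\<lambda>q. \<xi> (?\<psi> q)) ` ?W" using uW \<psi>u by (intro image_eqI[of _ _ "\<phi> u"]) simp_all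
    ultimately obtain e where e: "0 < e" "ball (\<xi> u) e \<subseteq> (\<lambda>q. \<xi> (?\<psi> q)) ` ?W" by (meson openE)
    \<comment> \<open>A point of the open image that lies beyond the wall.\<close>
    let ?z = "(fst (\<xi> u) - of_real (e / 2), snd (\<xi> u))"
    have "dist (\<xi> u) ?z = e / 2"
      using e(1) by (simp add: dist_prod_def dist_norm)
    then have "?z \<in> ball (\<xi> u) e" using e(1) by simp
    then have "?z \<in> (\<lambda>q. \<xi> (?\<psi> q)) ` ?W" using e(2) by blast
    then obtain q where "?z = \<xi> (?\<psi> q)" "?\<psi> q \<in> ball u r'" by blast
    then have "?z \<in> H3_half" using b'(6) by blast
    moreover have "Re (fst (\<xi> u)) = 0" using b'(4) by (simp add: wall_def)
    ultimately show False using e(1) by (simp add: H3_half_def)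
  qed
qed

lemma local_isometric_curve_hyp_affine:
  assumes I: "connected I" and right: "\<And>x. x \<in> I \<Longrightarrow> \<exists>\<delta>>0. {x..<x + \<delta>} \<subseteq> I"
    and H: "\<And>s. s \<in> I \<Longrightarrow> \<gamma> s \<in> H3"
    and loc: "\<And>t. t \<in> I \<Longrightarrow> \<exists>\<epsilon>>0. \<forall>s\<in>I \<inter> ball t \<epsilon>. \<forall>s'\<in>I \<inter> ball t \<epsilon>. hdist (\<gamma> s) (\<gamma> s') = \<bar>s - s'\<bar>"
  shows "hyp_affine_on I (\<lambda>s. mink (\<gamma> s))"
proof (rule hyp_affine_on_connected[OF I right])
  fix t assume t: "t \<in> I"
  obtain \<epsilon> where \<epsilon>: "0 < \<epsilon>" "\<forall>s\<in>I \<inter> ball t \<epsilon>. \<forall>s'\<in>I \<inter> ball t \<epsilon>. hdist (\<gamma> s) (\<gamma> s') = \<bar>s - s'\<bar>"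
    using loc[OF t] by blast
  obtain \<delta> where \<delta>: "0 < \<delta>" "{t..<t + \<delta>} \<subseteq> I" using right[OF t] by blast
  let ?b = "t + min \<epsilon> \<delta> / 2"
  have b: "t < ?b" "?b < t + \<epsilon>" "?b < t + \<delta>" using \<epsilon>(1) \<delta>(1) by (auto simp: min_def)
  have "?b \<in> I" using b \<delta>(2) by auto
  then have bJ: "?b \<in> I \<inter> ball t \<epsilon>" using b by (simp add: dist_real_def)
  have tJ: "t \<in> I \<inter> ball t \<epsilon>" using t \<epsilon>(1) by simp
  have "hyp_affine_on (I \<inter> ball t \<epsilon>) (\<lambda>s. mink (\<gamma> s))"
    by (rule isometric_curve_hyp_affine[OF tJ bJ b(1)]) (use H \<epsilon>(2) in blast)+
  then show "\<exists>\<epsilon>>0. hyp_affine_on (I \<inter> ball t \<epsilon>) (\<lambda>s. mink (\<gamma> s))" using \<epsilon>(1) by blast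
qed

lemma hyp_bilinear_unique:
  fixes A B C D A' B' C' D' :: real
  assumes "a \<noteq> b"
    and eq: "\<And>s s'. s \<in> {a, b} \<Longrightarrow> s' \<in> {a, b} \<Longrightarrow>
      cosh s * cosh s' * A + cosh s * sinh s' * B + sinh s * cosh s' * C + sinh s * sinh s' * D
      = cosh s * cosh s' * A' + cosh s * sinh s' * B' + sinh s * cosh s' * C' + sinh s * sinh s' * D'"
  shows "A = A'" "B = B'" "C = C'" "D = D'"
proof -
  have 1: "cosh s' * A + sinh s' * B = cosh s' * A' + sinh s' * B'" "cosh s' * C + sinh s' * D = cosh s' * C' + sinh s' * D'"
    if s': "s' \<in> {a, b}" for s'
  proof -
    have "cosh s *\<^sub>R (cosh s' * A + sinh s' * B) + sinh s *\<^sub>R (cosh s' * C + sinh s' * D)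
        = cosh s *\<^sub>R (cosh s' * A' + sinh s' * B') + sinh s *\<^sub>R (cosh s' * C' + sinh s' * D')" if "s \<in> {a, b}" for s
      using eq[OF that s'] by (simp add: algebra_simps)
    from hyp_affine_unique[OF assms(1) this this]
    show "cosh s' * A + sinh s' * B = cosh s' * A' + sinh s' * B'" "cosh s' * C + sinh s' * D = cosh s' * C' + sinh s' * D'"
      by simp_all
  qed
  have "cosh s' *\<^sub>R A + sinh s' *\<^sub>R B = cosh s' *\<^sub>R A' + sinh s' *\<^sub>R B'"
    "cosh s' *\<^sub>R C + sinh s' *\<^sub>R D = cosh s' *\<^sub>R C' + sinh s' *\<^sub>R D'" if "s' \<in> {a, b}" for s'
    using 1[OF that] by simp_all
  from hyp_affine_unique[OF assms(1) this(1) this(1)] hyp_affine_unique[OF assms(1) this(2) this(2)]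
  show "A = A'" "B = B'" "C = C'" "D = D'" by simp_all
qed


section \<open>The normal exponential map\<close>

locale collar_embedding =
  fixes S :: "'a::metric_space set" and d :: real and E :: "'a \<Rightarrow> real \<Rightarrow> 'a"
  assumes manifold: "hyperbolic_3_manifold TYPE('a)"
    and S: "S \<in> components bdry" and d: "0 < d"
    and normal: "\<And>p. p \<in> S \<Longrightarrow> normal_geodesic d p (E p)"
    and emb: "embedding_map (top_of_set (S \<times> {0..<d})) euclidean (\<lambda>(p, t). E p t)"
begin

definition tube :: "'a set" where
  "tube = (\<lambda>(p, t). E p t) ` (S \<times> {0..<d})"

lemma length: "length_metric TYPE('a)"
  using manifold by (simp add: hyperbolic_3_manifold_def)

lemma charted: "charted TYPE('a)"
  by (rule hyperbolic_3_manifold_charted[OF manifold])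

lemma S_bdry: "S \<subseteq> bdry"
  by (rule in_components_subset[OF S])

lemma S_nonempty: "S \<noteq> {}"
  by (rule in_components_nonempty[OF S])

lemma compact_S: "compact S"
proof (rule closedin_compact)
  show "compact (bdry :: 'a set)" using manifold by (simp add: hyperbolic_3_manifold_def)
  show "closedin (top_of_set bdry) S" by (rule closedin_component[OF S])
qed

lemma E_0: "p \<in> S \<Longrightarrow> E p 0 = p"
  using normal by (simp add: normal_geodesic_def)

lemma E_local_isometric:
  assumes "p \<in> S" "t \<in> {0..<d}"
  shows "\<exists>\<epsilon>>0. \<forall>s\<in>{0..<d} \<inter> ball t \<epsilon>. \<forall>s'\<in>{0..<d} \<inter> ball t \<epsilon>. dist (E p s) (E p s') = \<bar>s - s'\<bar>"
proof -
  have "\<forall>t\<in>{0..<d}. \<exists>\<epsilon>>0. \<forall>s\<in>{0..<d} \<inter> ball t \<epsilon>. \<forall>s'\<in>{0..<d} \<inter> ball t \<epsilon>. dist (E p s) (E p s') = \<bar>s - s'\<bar>"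
    using normal[OF assms(1)] unfolding normal_geodesic_def by (elim conjE)
  then show ?thesis using assms(2) by (rule bspec)
qed

lemma E_dist_le:
  assumes p: "p \<in> S" and st: "0 \<le> s" "s \<le> t" "t < d"
  shows "dist (E p s) (E p t) \<le> t - s"
proof (rule local_Lipschitz_curve[OF st(2)])
  fix u assume u: "u \<in> {s..t}"
  then have "u \<in> {0..<d}" using st by auto
  from E_local_isometric[OF p this] obtain \<epsilon> where \<epsilon>: "0 < \<epsilon>"
    "\<forall>s\<in>{0..<d} \<inter> ball u \<epsilon>. \<forall>s'\<in>{0..<d} \<inter> ball u \<epsilon>. dist (E p s) (E p s') = \<bar>s - s'\<bar>" by blast
  have sub: "{s..t} \<inter> ball u \<epsilon> \<subseteq> {0..<d} \<inter> ball u \<epsilon>" using st by auto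
  show "\<exists>\<epsilon>>0. \<forall>s'\<in>{s..t} \<inter> ball u \<epsilon>. \<forall>s''\<in>{s..t} \<inter> ball u \<epsilon>. dist (E p s') (E p s'') \<le> \<bar>s' - s''\<bar>"
  proof (intro exI[of _ \<epsilon>] conjI ballI)
    fix v w assume "v \<in> {s..t} \<inter> ball u \<epsilon>" "w \<in> {s..t} \<inter> ball u \<epsilon>"
    then have "v \<in> {0..<d} \<inter> ball u \<epsilon>" "w \<in> {0..<d} \<inter> ball u \<epsilon>" using sub by blast+
    then have "dist (E p v) (E p w) = \<bar>v - w\<bar>" using \<epsilon>(2) by blast
    then show "dist (E p v) (E p w) \<le> \<bar>v - w\<bar>" by simp
  qed (rule \<epsilon>(1))
qed

lemma E_inverse:
  obtains e where "continuous_on tube e" "\<forall>x\<in>tube. e x \<in> S \<times> {0..<d}" "\<forall>p\<in>S. \<forall>t\<in>{0..<d}. e (E p t) = (p, t)"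
    "continuous_on (S \<times> {0..<d}) (\<lambda>(p, t). E p t)" "\<forall>x\<in>tube. E (fst (e x)) (snd (e x)) = x"
proof -
  have "homeomorphic_map (top_of_set (S \<times> {0..<d})) (top_of_set tube) (\<lambda>(p, t). E p t)"
    using emb by (simp add: embedding_map_def tube_def)
  then obtain e where "homeomorphic_maps (top_of_set (S \<times> {0..<d})) (top_of_set tube) (\<lambda>(p, t). E p t) e"
    unfolding homeomorphic_map_maps by blast
  then have e: "continuous_on (S \<times> {0..<d}) (\<lambda>(p, t). E p t)" "continuous_on tube e" "e \<in> tube \<rightarrow> S \<times> {0..<d}"
    "\<forall>x\<in>S \<times> {0..<d}. e ((\<lambda>(p, t). E p t) x) = x" "\<forall>y\<in>tube. (\<lambda>(p, t). E p t) (e y) = y"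
    by (simp_all add: homeomorphic_maps_def continuous_map_subtopology_eu)
  show thesis
    by (rule that[of e]) (use e in \<open>auto simp: case_prod_beta\<close>)
qed

lemma E_in_tube: "p \<in> S \<Longrightarrow> t \<in> {0..<d} \<Longrightarrow> E p t \<in> tube"
  unfolding tube_def by (rule image_eqI[of _ _ "(p, t)"]) auto

text \<open>The part of the wall seen by a chart is a Euclidean disc. Being connected, it belongs to the
  component \<open>S\<close>.\<close>

lemma S_iff_wall:
  assumes p: "p \<in> S" and c: "boundary_chart p r \<phi>" and u: "u \<in> ball p r"
  shows "u \<in> S \<longleftrightarrow> \<phi> u \<in> wall"
proof
  assume "u \<in> S"
  then show "\<phi> u \<in> wall" using bdry_iff_wall[OF c u] S_bdry by blast
next
  note b = boundary_chart_charts[OF c]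
  assume w: "\<phi> u \<in> wall"
  let ?D = "ball (fst (\<phi> p), snd (\<phi> p) * cosh r) (snd (\<phi> p) * sinh r) \<inter> {q. Re (fst q) = 0}"
  let ?\<psi> = "inv_into (ball p r) \<phi>"
  have Deq: "?D = hball (\<phi> p) r \<inter> {q. Re (fst q) = 0}"
    by (simp only: hball_eq_ball[OF b(5,1)])
  have "convex {q::point3. Re (fst q) = 0}"
    unfolding convex_def by simp
  then have "connected ?D" by (intro convex_connected convex_Int convex_ball)
  moreover have Dsub: "?D \<subseteq> \<phi> ` ball p r" unfolding Deq b(6) by (auto simp: H3_half_def)
  ultimately have "connected (?\<psi> ` ?D)"
    by (intro connected_continuous_image continuous_on_subset[OF hisometric_inverse[OF b(3)]])
  moreover have "?\<psi> ` ?D \<subseteq> bdry"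
  proof
    fix x assume "x \<in> ?\<psi> ` ?D"
    then obtain q where q: "q \<in> ?D" "x = ?\<psi> q" by blast
    have "q \<in> \<phi> ` ball p r" using q(1) Dsub by blast
    then have "x \<in> ball p r" "\<phi> x = q" unfolding q(2) by (rule inv_into_into, rule f_inv_into_f)
    moreover have "q \<in> wall" using q(1) unfolding Deq by (simp add: wall_def)
    ultimately show "x \<in> bdry" using bdry_iff_wall[OF c] by blast
  qed
  moreover have inj: "inj_on \<phi> (ball p r)" by (rule hisometric_inj_on[OF b(3)])
  have in_D: "v \<in> ?\<psi> ` ?D" if v: "v \<in> ball p r" "\<phi> v \<in> wall" for v
  proof (rule image_eqI)
    show "v = ?\<psi> (\<phi> v)" using inv_into_f_f[OF inj v(1)] by simp
    show "\<phi> v \<in> ?D" unfolding Deq using v b(6) by (auto simp: wall_def)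
  qed
  have "p \<in> S \<inter> ?\<psi> ` ?D" using p in_D[of p] b(1,4) by simp
  ultimately have "?\<psi> ` ?D \<subseteq> S" by (intro components_maximal[OF S]) auto
  then show "u \<in> S" using in_D[OF u w] by blast
qed

text \<open>Near its foot point a normal geodesic agrees with the Fermi coordinate line of a boundary chart
  centred elsewhere; the agreement propagates as far as the chart reaches because both are geodesics.\<close>

lemma E_in_boundary_chart:
  assumes p: "p \<in> S" and c: "boundary_chart p r \<phi>" and q: "q \<in> S" "q \<in> ball p (r / 2)"
    and t: "0 \<le> t" "t < min (r / 2) d"
  shows "E q t \<in> ball p r" "\<phi> (E q t) = fermi (\<phi> q) t"
proof -
  note b = boundary_chart_charts[OF c]
  let ?m = "min (r / 2) d"
  have m: "0 < ?m" using b(1) d by simp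
  have qr: "q \<in> ball p r" using q(2) b(1) by simp
  have inball: "E q s \<in> ball p r" if s: "0 \<le> s" "s < ?m" for s
  proof -
    have "dist q (E q s) \<le> s" using E_dist_le[OF q(1), of 0 s] s E_0[OF q(1)] by simp
    moreover have "dist p (E q s) \<le> dist p q + dist q (E q s)" by (rule dist_triangle)
    ultimately show ?thesis using q(2) s by simp
  qed
  have qw: "\<phi> q \<in> wall" using S_iff_wall[OF p c qr] q(1) by simp
  let ?I = "{0..<?m}"
  have aff: "hyp_affine_on ?I (\<lambda>s. mink (\<phi> (E q s)))"
  proof (rule local_isometric_curve_hyp_affine)
    show "connected ?I" by simp
    show "\<exists>\<delta>>0. {x..<x + \<delta>} \<subseteq> ?I" if "x \<in> ?I" for x
      using that by (intro exI[of _ "?m - x"]) auto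
    show "\<phi> (E q s) \<in> H3" if "s \<in> ?I" for s
      using boundary_chart_dist(2)[OF c inball inball, of s s] that by simp
    fix u assume u: "u \<in> ?I"
    then have "u \<in> {0..<d}" by simp
    from E_local_isometric[OF q(1) this] obtain \<epsilon> where \<epsilon>: "0 < \<epsilon>"
      "\<forall>s\<in>{0..<d} \<inter> ball u \<epsilon>. \<forall>s'\<in>{0..<d} \<inter> ball u \<epsilon>. dist (E q s) (E q s') = \<bar>s - s'\<bar>" by blast
    show "\<exists>\<epsilon>>0. \<forall>s\<in>?I \<inter> ball u \<epsilon>. \<forall>s'\<in>?I \<inter> ball u \<epsilon>. hdist (\<phi> (E q s)) (\<phi> (E q s')) = \<bar>s - s'\<bar>"
    proof (intro exI[of _ \<epsilon>] conjI ballI)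
      fix v w assume vw: "v \<in> ?I \<inter> ball u \<epsilon>" "w \<in> ?I \<inter> ball u \<epsilon>"
      then have "v \<in> {0..<d} \<inter> ball u \<epsilon>" "w \<in> {0..<d} \<inter> ball u \<epsilon>" by auto
      then have "dist (E q v) (E q w) = \<bar>v - w\<bar>" using \<epsilon>(2) by blast
      moreover have "hdist (\<phi> (E q v)) (\<phi> (E q w)) = dist (E q v) (E q w)"
        using vw by (intro boundary_chart_dist(1)[OF c] inball) auto
      ultimately show "hdist (\<phi> (E q v)) (\<phi> (E q w)) = \<bar>v - w\<bar>" by simp
    qed (rule \<epsilon>(1))
  qed
  obtain r' \<xi> where c': "boundary_chart q r' \<xi>" and
    E\<xi>: "\<forall>t. 0 \<le> t \<and> t < r' \<and> t < d \<longrightarrow>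
           \<xi> (E q t) = (fst (\<xi> q) + of_real (snd (\<xi> q) * tanh t), snd (\<xi> q) / cosh t)"
    using normal[OF q(1)] unfolding normal_geodesic_def by (elim conjE exE) (rule that)
  note b' = boundary_chart_charts[OF c']
  have start: "\<phi> (E q s) = fermi (\<phi> q) s" if s: "0 \<le> s" "s < min r' ?m" for s
  proof -
    have sm: "s < ?m" "s < r'" "s < d" using s by auto
    have Er': "E q s \<in> ball q r'" using E_dist_le[OF q(1), of 0 s] s sm E_0[OF q(1)] by simp
    have E\<xi>': "\<xi> (E q s) = fermi (\<xi> q) s" using E\<xi> s sm by (simp add: fermi_def)
    obtain r1 where r1: "0 < r1" "r1 \<le> r'" "chart H3_half q r1 \<phi>" "ball q r1 \<subseteq> ball p r"
      by (rule chart_restrict[OF _ b(2) qr b'(1)]) simp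
    show ?thesis
    proof (rule fermi_characterization[OF _ qw s(1) r1(1)])
      show "\<phi> (E q s) \<in> H3_half" using boundary_chart_dist(3)[OF c inball inball] s(1) sm(1) by blast
      fix w assume w: "w \<in> wall" "hdist (\<phi> q) w < r1"
      have "w \<in> {q' \<in> H3_half. hdist (\<phi> q) q' < r1}" using w wall_subset_half by blast
      then have "w \<in> \<phi> ` ball q r1" using chart_image[OF r1(3)] by simp
      then obtain u where u: "w = \<phi> u" "u \<in> ball q r1" by blast
      have ur: "u \<in> ball p r" using u r1(4) by blast
      have uS: "u \<in> S" using S_iff_wall[OF p c ur] w u by simp
      have ur': "u \<in> ball q r'" using u r1(2) by simp
      have qr': "q \<in> ball q r'" using b'(1) by simp
      have uw: "\<xi> u \<in> wall" using S_iff_wall[OF q(1) c' ur'] uS by simp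
      have "cosh (hdist (\<phi> (E q s)) w) = cosh (dist (E q s) u)"
        unfolding u(1) using boundary_chart_dist(1)[OF c inball[OF s(1) sm(1)] ur] by simp
      also have "\<dots> = cosh (hdist (\<xi> (E q s)) (\<xi> u))"
        using boundary_chart_dist(1)[OF c' Er' ur'] by simp
      also have "\<dots> = cosh (hdist (fermi (\<xi> q) s) (fermi (\<xi> u) 0))" by (simp add: E\<xi>')
      also have "\<dots> = cosh s * cosh (hdist (\<xi> q) (\<xi> u))"
        by (subst cosh_hdist_fermi[OF b'(4) uw]) simp
      also have "hdist (\<xi> q) (\<xi> u) = dist q u" by (rule boundary_chart_dist(1)[OF c' qr' ur'])
      also have "dist q u = hdist (\<phi> q) w" unfolding u(1) by (rule boundary_chart_dist(1)[OF c qr ur, symmetric])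
      finally show "cosh (hdist (\<phi> (E q s)) w) = cosh s * cosh (hdist (\<phi> q) w)" .
    qed
  qed
  obtain P Q where PQ: "\<forall>s\<in>?I. mink (\<phi> (E q s)) = cosh s *\<^sub>R P + sinh s *\<^sub>R Q"
    using aff unfolding hyp_affine_on_def by blast
  have agree: "cosh s *\<^sub>R P + sinh s *\<^sub>R Q = cosh s *\<^sub>R mink (\<phi> q) + sinh s *\<^sub>R (0, 1, 0)" if s: "0 \<le> s" "s < min r' ?m" for s
  proof -
    have "s \<in> ?I" using s by simp
    then have "cosh s *\<^sub>R P + sinh s *\<^sub>R Q = mink (\<phi> (E q s))" using PQ by simp
    then show ?thesis by (simp only: start[OF s] mink_fermi[OF qw])
  qed
  have n2: "0 < min r' ?m / 2" using b'(1) m by simp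
  have n: "(0::real) \<noteq> min r' ?m / 2" by (rule less_imp_neq[OF n2])
  have n3: "min r' ?m / 2 < min r' ?m" using n2 by linarith
  have n4: "0 < min r' ?m" using n2 by linarith
  have "P = mink (\<phi> q)" "Q = (0, 1, 0)"
    by (rule hyp_affine_unique[OF n agree[OF order_refl n4] agree[OF less_imp_le[OF n2] n3]])+
  then have "mink (\<phi> (E q t)) = mink (fermi (\<phi> q) t)" using PQ t by (simp add: mink_fermi[OF qw])
  moreover have "\<phi> (E q t) \<in> H3" using boundary_chart_dist(2)[OF c inball[OF t] inball[OF t]] .
  moreover have "fermi (\<phi> q) t \<in> H3" by (rule fermi_H3[OF wall_H3[OF qw]])
  ultimately show "\<phi> (E q t) = fermi (\<phi> q) t" by (metis mink_inj)
  show "E q t \<in> ball p r" by (rule inball[OF t])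
qed

text \<open>The formula is that of \<open>cosh_hdist_fermi\<close>: near the point with coordinates \<open>(p, t)\<close> the normal
  exponential map is isometric to Fermi coordinates of \<^term>\<open>H3\<close>.\<close>

definition fermi_metric_near :: "'a \<Rightarrow> real \<Rightarrow> bool" where
  "fermi_metric_near p t \<longleftrightarrow> (\<exists>N>0. \<forall>q\<in>S \<inter> ball p N. \<forall>q'\<in>S \<inter> ball p N.
     \<forall>s\<in>{0..<d} \<inter> ball t N. \<forall>s'\<in>{0..<d} \<inter> ball t N.
       cosh (dist (E q s) (E q' s')) = cosh s * cosh s' * cosh (dist q q') - sinh s * sinh s')"

lemma fermi_metric_near_0:
  assumes p: "p \<in> S"
  shows "fermi_metric_near p 0"
proof -
  obtain r \<phi> where c: "boundary_chart p r \<phi>" using p S_bdry by (auto simp: bdry_def)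
  note b = boundary_chart_charts[OF c]
  show ?thesis unfolding fermi_metric_near_def
  proof (intro exI[of _ "r / 2"] conjI ballI)
    show "0 < r / 2" using b(1) by simp
    fix q q' s s' assume q: "q \<in> S \<inter> ball p (r / 2)" "q' \<in> S \<inter> ball p (r / 2)"
      and s: "s \<in> {0..<d} \<inter> ball 0 (r / 2)" "s' \<in> {0..<d} \<inter> ball 0 (r / 2)"
    have s1: "0 \<le> s" "s < min (r / 2) d" and s2: "0 \<le> s'" "s' < min (r / 2) d" using s by auto
    have q1: "q \<in> S" "q \<in> ball p (r / 2)" "q \<in> ball p r" and q2: "q' \<in> S" "q' \<in> ball p (r / 2)" "q' \<in> ball p r"
      using q b(1) by auto
    have w: "\<phi> q \<in> wall" "\<phi> q' \<in> wall" using S_iff_wall[OF p c] q1 q2 by auto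
    note E1 = E_in_boundary_chart[OF p c q1(1,2) s1] and E2 = E_in_boundary_chart[OF p c q2(1,2) s2]
    have "dist (E q s) (E q' s') = hdist (fermi (\<phi> q) s) (fermi (\<phi> q') s')"
      using boundary_chart_dist(1)[OF c E1(1) E2(1)] E1(2) E2(2) by simp
    moreover have "hdist (\<phi> q) (\<phi> q') = dist q q'" by (rule boundary_chart_dist(1)[OF c q1(3) q2(3)])
    ultimately show "cosh (dist (E q s) (E q' s')) = cosh s * cosh s' * cosh (dist q q') - sinh s * sinh s'"
      using cosh_hdist_fermi[OF w, of s s'] by simp
  qed
qed

lemma E_continuous_near:
  assumes p: "p \<in> S" and t: "t \<in> {0..<d}" and r: "0 < r"
  obtains N where "0 < N" "\<forall>q\<in>S \<inter> ball p N. \<forall>s\<in>{0..<d} \<inter> ball t N. E q s \<in> ball (E p t) r"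
proof -
  have ct: "continuous_on (S \<times> {0..<d}) (\<lambda>(p, t). E p t)"
    by (rule E_inverse)
  have pt: "(p, t) \<in> S \<times> {0..<d}" using p t by simp
  obtain \<delta> where \<delta>: "0 < \<delta>" "\<forall>x\<in>S \<times> {0..<d}. dist x (p, t) < \<delta> \<longrightarrow> dist (case x of (p, t) \<Rightarrow> E p t) (case (p, t) of (p, t) \<Rightarrow> E p t) < r"
    using ct[unfolded continuous_on_iff, rule_format, OF pt r] by blast
  show thesis
  proof (rule that[of "\<delta> / 2"])
    show "0 < \<delta> / 2" using \<delta> by simp
    show "\<forall>q\<in>S \<inter> ball p (\<delta> / 2). \<forall>s\<in>{0..<d} \<inter> ball t (\<delta> / 2). E q s \<in> ball (E p t) r"
    proof (intro ballI)
      fix q s assume q: "q \<in> S \<inter> ball p (\<delta> / 2)" and s: "s \<in> {0..<d} \<inter> ball t (\<delta> / 2)"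
      have "dist (q, s) (p, t) \<le> dist q p + dist s t"
        unfolding dist_prod_def fst_conv snd_conv by (rule sqrt_sum_squares_le_sum) auto
      also have "\<dots> < \<delta>" using q s by (simp add: dist_commute)
      finally show "E q s \<in> ball (E p t) r" using \<delta>(2) q s by (auto simp: dist_commute)
    qed
  qed
qed

text \<open>Continuation: inside one chart all normal geodesics are combinations of cosh and sinh in
  Minkowski space, so the cosh of the distance between two of them is bilinear in cosh and sinh of the
  two times, and is determined by its values on any small square.\<close>

lemma fermi_metric_near_propagates:
  assumes p: "p \<in> S" and t0: "t0 \<in> {0..<d}"
  shows "\<exists>N>0. \<forall>x\<in>{0..<d} \<inter> ball t0 N. \<forall>y\<in>{0..<d} \<inter> ball t0 N. fermi_metric_near p x \<longrightarrow> fermi_metric_near p y"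
proof -
  obtain W r \<psi> where c: "W \<in> {H3, H3_half}" "chart W (E p t0) r \<psi>" by (rule charted_at[OF charted])
  have r: "0 < r" using c(2) by (simp add: chart_def)
  have iso: "hisometric (ball (E p t0) r) \<psi>" by (rule chart_hisometric[OF c])
  then have d\<psi>: "hdist (\<psi> u) (\<psi> v) = dist u v" "\<psi> u \<in> H3" if "u \<in> ball (E p t0) r" "v \<in> ball (E p t0) r" for u v
    using that unfolding hisometric_def by blast+
  obtain N where N: "0 < N" "\<forall>q\<in>S \<inter> ball p N. \<forall>s\<in>{0..<d} \<inter> ball t0 N. E q s \<in> ball (E p t0) r"
    by (rule E_continuous_near[OF p t0 r])
  let ?I = "{0..<d} \<inter> ball t0 N"
  have Iconn: "connected ?I" by (intro convex_connected convex_Int) auto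
  have Iright: "\<exists>\<delta>>0. {x..<x + \<delta>} \<subseteq> ?I" if "x \<in> ?I" for x
  proof (intro exI[of _ "min (d - x) (t0 + N - x)"] conjI)
    show "0 < min (d - x) (t0 + N - x)" using that by (auto simp: dist_real_def)
    show "{x..<x + min (d - x) (t0 + N - x)} \<subseteq> ?I" using that by (auto simp: dist_real_def abs_if split: if_splits)
  qed
  have aff: "hyp_affine_on ?I (\<lambda>s. mink (\<psi> (E q s)))" if q: "q \<in> S \<inter> ball p N" for q
  proof (rule local_isometric_curve_hyp_affine[OF Iconn Iright])
    have Eb: "E q s \<in> ball (E p t0) r" if "s \<in> ?I" for s using N(2) q that by blast
    show "\<psi> (E q s) \<in> H3" if "s \<in> ?I" for s using d\<psi>(2)[OF Eb Eb] that by blast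
    fix t assume t: "t \<in> ?I"
    then have "q \<in> S" "t \<in> {0..<d}" using q by auto
    from E_local_isometric[OF this] obtain \<epsilon> where \<epsilon>: "0 < \<epsilon>"
      "\<forall>s\<in>{0..<d} \<inter> ball t \<epsilon>. \<forall>s'\<in>{0..<d} \<inter> ball t \<epsilon>. dist (E q s) (E q s') = \<bar>s - s'\<bar>" by blast
    show "\<exists>\<epsilon>>0. \<forall>s\<in>?I \<inter> ball t \<epsilon>. \<forall>s'\<in>?I \<inter> ball t \<epsilon>. hdist (\<psi> (E q s)) (\<psi> (E q s')) = \<bar>s - s'\<bar>"
    proof (intro exI[of _ \<epsilon>] conjI ballI)
      fix v w assume vw: "v \<in> ?I \<inter> ball t \<epsilon>" "w \<in> ?I \<inter> ball t \<epsilon>"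
      then have "v \<in> {0..<d} \<inter> ball t \<epsilon>" "w \<in> {0..<d} \<inter> ball t \<epsilon>" by auto
      then have "dist (E q v) (E q w) = \<bar>v - w\<bar>" using \<epsilon>(2) by blast
      moreover have "hdist (\<psi> (E q v)) (\<psi> (E q w)) = dist (E q v) (E q w)"
        by (rule d\<psi>(1)[OF Eb Eb]) (use vw in blast)+
      ultimately show "hdist (\<psi> (E q v)) (\<psi> (E q w)) = \<bar>v - w\<bar>" by simp
    qed (rule \<epsilon>(1))
  qed
  have "fermi_metric_near p y" if x: "x \<in> ?I" and y: "y \<in> ?I" and near: "fermi_metric_near p x" for x y
  proof -
    obtain N1 where N1: "0 < N1" "\<forall>q\<in>S \<inter> ball p N1. \<forall>q'\<in>S \<inter> ball p N1.
     \<forall>s\<in>{0..<d} \<inter> ball x N1. \<forall>s'\<in>{0..<d} \<inter> ball x N1.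
       cosh (dist (E q s) (E q' s')) = cosh s * cosh s' * cosh (dist q q') - sinh s * sinh s'"
      using near unfolding fermi_metric_near_def by blast
    obtain \<delta> where \<delta>: "0 < \<delta>" "{x..<x + \<delta>} \<subseteq> ?I" using Iright[OF x] by blast
    define b where "b = x + min \<delta> N1 / 2"
    have b: "x < b" "b < x + \<delta>" "b < x + N1" using \<delta>(1) N1(1) by (auto simp: b_def min_def)
    have "b \<in> {x..<x + \<delta>}" using b by simp
    then have bI: "b \<in> ?I" using \<delta>(2) by blast
    have xb: "s \<in> ?I \<inter> ({0..<d} \<inter> ball x N1)" if "s \<in> {x, b}" for s
      using that x bI b N1(1) by (auto simp: dist_real_def)
    obtain \<rho> where \<rho>: "0 < \<rho>" "ball y \<rho> \<subseteq> ball t0 N" using y by (meson IntD2 openE open_ball)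
    have formula: "cosh (dist (E q s) (E q' s')) = cosh s * cosh s' * cosh (dist q q') - sinh s * sinh s'"
      if q: "q \<in> S \<inter> ball p (min N N1)" "q' \<in> S \<inter> ball p (min N N1)" and s: "s \<in> ?I" "s' \<in> ?I" for q q' s s'
    proof -
      have qN: "q \<in> S \<inter> ball p N" "q' \<in> S \<inter> ball p N" and qN1: "q \<in> S \<inter> ball p N1" "q' \<in> S \<inter> ball p N1" using q by auto
      obtain P Q where PQ: "\<forall>s\<in>?I. mink (\<psi> (E q s)) = cosh s *\<^sub>R P + sinh s *\<^sub>R Q"
        using aff[OF qN(1)] unfolding hyp_affine_on_def by blast
      obtain P' Q' where PQ': "\<forall>s\<in>?I. mink (\<psi> (E q' s)) = cosh s *\<^sub>R P' + sinh s *\<^sub>R Q'"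
        using aff[OF qN(2)] unfolding hyp_affine_on_def by blast
      have G: "cosh (dist (E q s) (E q' s')) = cosh s * cosh s' * mform P P' + cosh s * sinh s' * mform P Q'
          + sinh s * cosh s' * mform Q P' + sinh s * sinh s' * mform Q Q'" if s: "s \<in> ?I" "s' \<in> ?I" for s s'
      proof -
        have Eb: "E q s \<in> ball (E p t0) r" "E q' s' \<in> ball (E p t0) r" using N(2) qN s by blast+
        have "cosh (dist (E q s) (E q' s')) = mform (mink (\<psi> (E q s))) (mink (\<psi> (E q' s')))"
          using d\<psi>(1)[OF Eb] mform_mink[OF d\<psi>(2)[OF Eb(1) Eb(1)] d\<psi>(2)[OF Eb(2) Eb(2)]] by simp
        also have "\<dots> = mform (cosh s *\<^sub>R P + sinh s *\<^sub>R Q) (cosh s' *\<^sub>R P' + sinh s' *\<^sub>R Q')"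
          using PQ PQ' s by simp
        finally show ?thesis unfolding mform_linear by (simp add: algebra_simps)
      qed
      have eq: "cosh s * cosh s' * mform P P' + cosh s * sinh s' * mform P Q'
          + sinh s * cosh s' * mform Q P' + sinh s * sinh s' * mform Q Q'
          = cosh s * cosh s' * cosh (dist q q') + cosh s * sinh s' * 0 + sinh s * cosh s' * 0 + sinh s * sinh s' * (- 1)"
        if s: "s \<in> {x, b}" "s' \<in> {x, b}" for s s'
      proof -
        have "s \<in> ?I" "s' \<in> ?I" "s \<in> {0..<d} \<inter> ball x N1" "s' \<in> {0..<d} \<inter> ball x N1" using xb s by blast+
        moreover from this(3,4) have "cosh (dist (E q s) (E q' s')) = cosh s * cosh s' * cosh (dist q q') - sinh s * sinh s'"
          using N1(2) qN1 by blast
        ultimately show ?thesis using G[of s s'] by simp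
      qed
      have "x \<noteq> b" using b by simp
      from hyp_bilinear_unique[OF this eq]
      have "mform P P' = cosh (dist q q')" "mform P Q' = 0" "mform Q P' = 0" "mform Q Q' = - 1" by auto
      then show ?thesis using G[OF s] by simp
    qed
    show ?thesis unfolding fermi_metric_near_def
    proof (intro exI[of _ "min (min N N1) \<rho>"] conjI ballI)
      show "0 < min (min N N1) \<rho>" using N N1 \<rho> by simp
      fix q q' s s' assume "q \<in> S \<inter> ball p (min (min N N1) \<rho>)" "q' \<in> S \<inter> ball p (min (min N N1) \<rho>)"
        and s: "s \<in> {0..<d} \<inter> ball y (min (min N N1) \<rho>)" "s' \<in> {0..<d} \<inter> ball y (min (min N N1) \<rho>)"
      then have "q \<in> S \<inter> ball p (min N N1)" "q' \<in> S \<inter> ball p (min N N1)" by auto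
      moreover have "s \<in> ball y \<rho>" "s' \<in> ball y \<rho>" using s by auto
      then have "s \<in> ?I" "s' \<in> ?I" using s \<rho>(2) by blast+
      ultimately show "cosh (dist (E q s) (E q' s')) = cosh s * cosh s' * cosh (dist q q') - sinh s * sinh s'"
        by (rule formula)
    qed
  qed
  then show ?thesis using N(1) by blast
qed

lemma fermi_metric:
  assumes p: "p \<in> S" and t: "t \<in> {0..<d}"
  shows "fermi_metric_near p t"
proof (rule connected_induction_simple[of "{0..<d}" 0])
  show "connected {0..<d}" by simp
  show "0 \<in> {0..<d}" using d by simp
  show "t \<in> {0..<d}" by (rule t)
  show "fermi_metric_near p 0" by (rule fermi_metric_near_0[OF p])
  fix a assume a: "a \<in> {0..<d}"
  obtain N where N: "0 < N" "\<forall>x\<in>{0..<d} \<inter> ball a N. \<forall>y\<in>{0..<d} \<inter> ball a N. fermi_metric_near p x \<longrightarrow> fermi_metric_near p y"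
    using fermi_metric_near_propagates[OF p a] by blast
  show "\<exists>T. openin (top_of_set {0..<d}) T \<and> a \<in> T \<and> (\<forall>x\<in>T. \<forall>y\<in>T. fermi_metric_near p x \<longrightarrow> fermi_metric_near p y)"
  proof (intro exI conjI)
    show "openin (top_of_set {0..<d}) ({0..<d} \<inter> ball a N)" by (rule openin_open_Int) simp
    show "a \<in> {0..<d} \<inter> ball a N" using a N(1) by simp
  qed (rule N(2))
qed

end

section \<open>The image of the normal exponential map\<close>

lemma vol_open_pos:
  assumes ch: "charted TYPE('a::metric_space)" and U: "open (U :: 'a set)" "U \<noteq> {}"
  shows "0 < vol U"
proof -
  obtain x where x: "x \<in> U" using U by blast
  obtain \<epsilon> where \<epsilon>: "0 < \<epsilon>" "ball x \<epsilon> \<subseteq> U" using U(1) x by (meson openE)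
  obtain W r0 \<phi> where c0: "W \<in> {H3, H3_half}" "chart W x r0 \<phi>" by (rule charted_at[OF ch])
  have "x \<in> ball x r0" using c0(2) by (simp add: chart_def)
  then obtain r where r: "0 < r" "r \<le> \<epsilon>" "chart W x r \<phi>" "ball x r \<subseteq> ball x r0"
    by (rule chart_restrict[OF c0 _ \<epsilon>(1)])
  have H: "\<phi> x \<in> H3" by (rule chart_centre_H3[OF c0])
  let ?B = "hball (\<phi> x) r"
  have im: "\<phi> ` ball x r = W \<inter> ?B" by (rule chart_image_Int[OF c0(1) r(3)])
  have oB: "open ?B" by (rule open_hball[OF H])
  have o: "open (?B \<inter> {q. 0 < Re (fst q)})" by (intro open_Int oB open_Collect_less continuous_intros)
  have xB: "\<phi> x \<in> ?B" using H r(1) by simp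
  obtain e where e: "0 < e" "ball (\<phi> x) e \<subseteq> ?B" using oB xB by (meson openE)
  have "0 < emeasure hvol (\<phi> ` ball x r)"
  proof (cases "W = H3")
    case True
    then have "\<phi> ` ball x r = ?B" using im by blast
    moreover have "0 < emeasure hvol ?B" by (rule hvol_open_pos[OF oB]) (use xB in blast)+
    ultimately show ?thesis by simp
  next
    case False
    then have W: "W = H3_half" using c0(1) by simp
    let ?z = "(fst (\<phi> x) + of_real (e / 2), snd (\<phi> x))"
    have "dist (\<phi> x) ?z = e / 2" using e(1) by (simp add: dist_prod_def dist_norm)
    then have "?z \<in> ball (\<phi> x) e" using e(1) by simp
    then have "?z \<in> ?B" using e(2) by blast
    moreover have "0 \<le> Re (fst (\<phi> x))" using im W r(1) by (auto simp: H3_half_def)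
    ultimately have "?z \<in> ?B \<inter> {q. 0 < Re (fst q)}" using e(1) by simp
    then have "0 < emeasure hvol (?B \<inter> {q. 0 < Re (fst q)})" by (intro hvol_open_pos[OF o]) blast+
    also have "\<dots> \<le> emeasure hvol (\<phi> ` ball x r)"
      by (rule emeasure_mono) (use chart_image_borel[OF c0(1) r(3)] in \<open>auto simp: im W H3_half_def\<close>)
    finally show ?thesis .
  qed
  also have "emeasure hvol (\<phi> ` ball x r) = vol (ball x r)"
    by (rule vol_isometric_piece[OF ch _ c0(1) r(3) order_refl chart_hisometric[OF c0(1) r(3)] chart_image_borel[OF c0(1) r(3)], symmetric]) simp
  also have "\<dots> \<le> vol U" using \<epsilon>(2) r(2) by (intro vol_mono) auto
  finally show ?thesis .
qed

definition fermi_box :: "point3 \<Rightarrow> real \<Rightarrow> real \<Rightarrow> point3 set" where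
  "fermi_box q t N = {y \<in> H3. hdist q (fermi_foot y) < N \<and> \<bar>fermi_time y - t\<bar> < N}"

lemma open_fermi_box:
  assumes "q \<in> H3"
  shows "open (fermi_box q t N)"
proof -
  have "open (H3 \<inter> fermi_foot -` hball q N)"
    by (rule continuous_open_preimage[OF continuous_on_fermi_foot open_H3 open_hball[OF assms]])
  moreover have "open (H3 \<inter> fermi_time -` ball t N)"
    by (rule continuous_open_preimage[OF continuous_on_fermi_time[OF order_refl] open_H3 open_ball])
  ultimately have "open ((H3 \<inter> fermi_foot -` hball q N) \<inter> (H3 \<inter> fermi_time -` ball t N))" by (rule open_Int)
  moreover have "(H3 \<inter> fermi_foot -` hball q N) \<inter> (H3 \<inter> fermi_time -` ball t N) = fermi_box q t N"
    using wall_H3[OF fermi_foot_wall] by (auto simp: fermi_box_def dist_real_def abs_minus_commute)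
  ultimately show ?thesis by (simp only:)
qed

context collar_embedding
begin

definition tube_param :: "'a \<Rightarrow> real \<Rightarrow> ('a \<Rightarrow> point3) \<Rightarrow> point3 \<Rightarrow> 'a" where
  "tube_param p r \<phi> y = E (inv_into (ball p r) \<phi> (fermi_foot y)) (fermi_time y)"

lemma tube_param_fermi:
  assumes c: "boundary_chart p r \<phi>" and u: "u \<in> ball p r" "\<phi> u = fermi_foot y"
  shows "tube_param p r \<phi> y = E u (fermi_time y)"
  unfolding tube_param_def u(2)[symmetric]
  by (simp only: inv_into_f_f[OF hisometric_inj_on[OF boundary_chart_charts(3)[OF c]] u(1)])

text \<open>Distances in \<^term>\<open>H3\<close> and in the tube are given by the same formula in Fermi coordinates, and the
  chart \<open>\<phi>\<close> preserves the distances between foot points.\<close>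

lemma tube_param_local:
  assumes p: "p \<in> S" and c: "boundary_chart p r \<phi>" and u0: "u0 \<in> S" "u0 \<in> ball p r"
    and t0: "t0 \<in> {0..<d}" and e: "0 < e"
  obtains N where "0 < N" "N \<le> e"
    "\<forall>y\<in>fermi_box (\<phi> u0) t0 N. \<exists>u\<in>S \<inter> ball p r \<inter> ball u0 N. \<phi> u = fermi_foot y"
    "\<forall>y\<in>fermi_box (\<phi> u0) t0 N. \<forall>y'\<in>fermi_box (\<phi> u0) t0 N. fermi_time y \<in> {0..<d} \<longrightarrow> fermi_time y' \<in> {0..<d} \<longrightarrow>
       dist (tube_param p r \<phi> y) (tube_param p r \<phi> y') = hdist y y'"
proof -
  note b = boundary_chart_charts[OF c]
  obtain N1 where N1: "0 < N1" "\<forall>q\<in>S \<inter> ball u0 N1. \<forall>q'\<in>S \<inter> ball u0 N1.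
     \<forall>s\<in>{0..<d} \<inter> ball t0 N1. \<forall>s'\<in>{0..<d} \<inter> ball t0 N1.
       cosh (dist (E q s) (E q' s')) = cosh s * cosh s' * cosh (dist q q') - sinh s * sinh s'"
    using fermi_metric[OF u0(1) t0] unfolding fermi_metric_near_def by blast
  have "0 < min e N1" using e N1(1) by simp
  then obtain N where N: "0 < N" "N \<le> min e N1" "chart H3_half u0 N \<phi>" "ball u0 N \<subseteq> ball p r"
    by (rule chart_restrict[OF insertI2[OF singletonI] b(2) u0(2)])
  have foot: "\<exists>u\<in>S \<inter> ball p r \<inter> ball u0 N. \<phi> u = fermi_foot y" if y: "y \<in> fermi_box (\<phi> u0) t0 N" for y
  proof -
    have yH: "y \<in> H3" "hdist (\<phi> u0) (fermi_foot y) < N" using y by (auto simp: fermi_box_def)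
    have w: "fermi_foot y \<in> wall" by (rule fermi_foot_wall[OF yH(1)])
    then have "fermi_foot y \<in> {q \<in> H3_half. hdist (\<phi> u0) q < N}" using yH wall_subset_half by blast
    then have "fermi_foot y \<in> \<phi> ` ball u0 N" using chart_image[OF N(3)] by simp
    then obtain u where u: "\<phi> u = fermi_foot y" "u \<in> ball u0 N" by force
    have "u \<in> ball p r" using u N(4) by blast
    moreover have "u \<in> S" using S_iff_wall[OF p c \<open>u \<in> ball p r\<close>] w u by simp
    ultimately show ?thesis using u by blast
  qed
  show thesis
  proof (rule that[OF N(1)])
    show "N \<le> e" using N(2) by simp
    show "\<forall>y\<in>fermi_box (\<phi> u0) t0 N. \<exists>u\<in>S \<inter> ball p r \<inter> ball u0 N. \<phi> u = fermi_foot y" using foot by blast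
    show "\<forall>y\<in>fermi_box (\<phi> u0) t0 N. \<forall>y'\<in>fermi_box (\<phi> u0) t0 N. fermi_time y \<in> {0..<d} \<longrightarrow> fermi_time y' \<in> {0..<d} \<longrightarrow>
       dist (tube_param p r \<phi> y) (tube_param p r \<phi> y') = hdist y y'"
    proof (intro ballI impI)
      fix y y' assume y: "y \<in> fermi_box (\<phi> u0) t0 N" "y' \<in> fermi_box (\<phi> u0) t0 N"
        and t: "fermi_time y \<in> {0..<d}" "fermi_time y' \<in> {0..<d}"
      have yH: "y \<in> H3" "y' \<in> H3" using y by (auto simp: fermi_box_def)
      obtain u where u: "u \<in> S \<inter> ball p r \<inter> ball u0 N" "\<phi> u = fermi_foot y" using foot[OF y(1)] by blast
      obtain u' where u': "u' \<in> S \<inter> ball p r \<inter> ball u0 N" "\<phi> u' = fermi_foot y'" using foot[OF y(2)] by blast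
      have ur: "u \<in> ball p r" "u' \<in> ball p r" using u u' by auto
      have uN: "u \<in> S \<inter> ball u0 N1" "u' \<in> S \<inter> ball u0 N1" using u u' N(2) by auto
      have tN: "fermi_time y \<in> {0..<d} \<inter> ball t0 N1" "fermi_time y' \<in> {0..<d} \<inter> ball t0 N1"
        using t y N(2) by (auto simp: fermi_box_def dist_real_def abs_minus_commute)
      let ?s = "fermi_time y" and ?s' = "fermi_time y'"
      have "cosh (dist (E u ?s) (E u' ?s')) = cosh ?s * cosh ?s' * cosh (dist u u') - sinh ?s * sinh ?s'"
        using N1(2) uN tN by blast
      also have "dist u u' = hdist (fermi_foot y) (fermi_foot y')"
        using boundary_chart_dist(1)[OF c ur] u u' by simp
      also have "cosh ?s * cosh ?s' * cosh (hdist (fermi_foot y) (fermi_foot y')) - sinh ?s * sinh ?s' = cosh (hdist y y')"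
        using cosh_hdist_fermi[OF fermi_foot_wall[OF yH(1)] fermi_foot_wall[OF yH(2)], of ?s ?s']
        by (simp only: fermi_foot_time[OF yH(1)] fermi_foot_time[OF yH(2)])
      finally have "hdist y y' = dist (E u ?s) (E u' ?s')"
        by (rule iffD2[OF hdist_eq_iff_cosh[OF yH zero_le_dist] sym])
      then show "dist (tube_param p r \<phi> y) (tube_param p r \<phi> y') = hdist y y'"
        using tube_param_fermi[OF c ur(1) u(2)] tube_param_fermi[OF c ur(2) u'(2)] by simp
    qed
  qed
qed

lemma obtain_boundary_chart:
  assumes "p \<in> S"
  obtains r \<phi> where "boundary_chart p r \<phi>"
  using assms S_bdry by (auto simp: bdry_def)

lemma ball_in_tube:
  assumes p: "p \<in> S"
  shows "\<exists>\<epsilon>>0. ball p \<epsilon> \<subseteq> tube"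
proof -
  obtain r \<phi> where c: "boundary_chart p r \<phi>" by (rule obtain_boundary_chart[OF p])
  note b = boundary_chart_charts[OF c]
  let ?m = "min (r / 2) d"
  have "ball p ?m \<subseteq> tube"
  proof
    fix v assume v: "v \<in> ball p ?m"
    have vr: "v \<in> ball p r" and pr: "p \<in> ball p r" using v b(1) by auto
    have vH: "\<phi> v \<in> H3" "\<phi> v \<in> H3_half" using boundary_chart_dist[OF c vr vr] by blast+
    let ?q = "fermi_foot (\<phi> v)" and ?t = "fermi_time (\<phi> v)"
    have qw: "?q \<in> wall" by (rule fermi_foot_wall[OF vH(1)])
    have D: "hdist (\<phi> p) (\<phi> v) = dist p v" by (rule boundary_chart_dist(1)[OF c pr vr])
    have "cosh (hdist (fermi (\<phi> p) 0) (fermi ?q ?t)) = cosh 0 * cosh ?t * cosh (hdist (\<phi> p) ?q) - sinh 0 * sinh ?t"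
      by (rule cosh_hdist_fermi[OF b(4) qw])
    then have prod: "cosh (dist p v) = cosh ?t * cosh (hdist (\<phi> p) ?q)"
      by (simp add: fermi_foot_time[OF vH(1)] D)
    have t0: "0 \<le> ?t" using fermi_time_nonneg_iff[OF vH(1)] vH(2) by (simp add: H3_half_def)
    have h0: "0 \<le> hdist (\<phi> p) ?q" by (rule hdist_nonneg[OF b(5) wall_H3[OF qw]])
    have "cosh ?t * 1 \<le> cosh (dist p v)" "1 * cosh (hdist (\<phi> p) ?q) \<le> cosh (dist p v)"
      unfolding prod using cosh_real_ge_1[of ?t] cosh_real_ge_1[of "hdist (\<phi> p) ?q"]
      by (auto intro!: mult_left_mono mult_right_mono)
    then have tD: "?t \<le> dist p v" and qD: "hdist (\<phi> p) ?q \<le> dist p v"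
      using cosh_le_iff[OF t0, of "dist p v"] cosh_le_iff[OF h0, of "dist p v"] by simp_all
    have "?q \<in> \<phi> ` ball p r" unfolding b(6) using qw wall_subset_half wall_H3[OF qw] qD v b(1) by auto
    then obtain u where u: "?q = \<phi> u" "u \<in> ball p r" by blast
    have uS: "u \<in> S" using S_iff_wall[OF p c u(2)] qw u(1) by simp
    have "dist p u \<le> dist p v" using qD boundary_chart_dist(1)[OF c pr u(2)] u(1) by simp
    then have u2: "u \<in> ball p (r / 2)" using v by simp
    have tm: "?t < ?m" using tD v by simp
    note Eu = E_in_boundary_chart[OF p c uS u2 t0 tm]
    have "\<phi> (E u ?t) = \<phi> v" using Eu(2) u(1) fermi_foot_time[OF vH(1)] by simp
    then have "E u ?t = v" using inj_onD[OF hisometric_inj_on[OF b(3)]] Eu(1) vr by blast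
    then show "v \<in> tube" using E_in_tube[OF uS, of ?t] t0 tm by simp
  qed
  moreover have "0 < ?m" using b(1) d by simp
  ultimately show ?thesis by blast
qed

text \<open>The tube is open in the whole manifold: at the boundary by inspecting a boundary chart, elsewhere
  by invariance of domain.\<close>

lemma open_tube: "open tube"
proof (subst open_contains_ball, intro ballI)
  fix x assume "x \<in> tube"
  then obtain p t0 where p: "p \<in> S" and t0: "t0 \<in> {0..<d}" and x: "x = E p t0" by (auto simp: tube_def)
  show "\<exists>e>0. ball x e \<subseteq> tube"
  proof (cases "t0 = 0")
    case True
    then show ?thesis using ball_in_tube[OF p] x E_0[OF p] by simp
  next
    case False
    then have t0': "0 < t0" "t0 < d" using t0 by auto
    obtain r \<phi> where c: "boundary_chart p r \<phi>" by (rule obtain_boundary_chart[OF p])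
    note b = boundary_chart_charts[OF c]
    have pr: "p \<in> ball p r" using b(1) by simp
    obtain W r' \<psi> where c': "W \<in> {H3, H3_half}" "chart W (E p t0) r' \<psi>" by (rule charted_at[OF charted])
    have r': "0 < r'" using c'(2) by (simp add: chart_def)
    have iso: "hisometric (ball (E p t0) r') \<psi>" by (rule chart_hisometric[OF c'])
    obtain N0 where N0: "0 < N0" "\<forall>q\<in>S \<inter> ball p N0. \<forall>s\<in>{0..<d} \<inter> ball t0 N0. E q s \<in> ball (E p t0) r'"
      by (rule E_continuous_near[OF p t0 r'])
    have "0 < min N0 (min t0 (d - t0))" using N0 t0' by simp
    then obtain N where N: "0 < N" "N \<le> min N0 (min t0 (d - t0))"
      "\<forall>y\<in>fermi_box (\<phi> p) t0 N. \<exists>u\<in>S \<inter> ball p r \<inter> ball p N. \<phi> u = fermi_foot y"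
      "\<forall>y\<in>fermi_box (\<phi> p) t0 N. \<forall>y'\<in>fermi_box (\<phi> p) t0 N. fermi_time y \<in> {0..<d} \<longrightarrow> fermi_time y' \<in> {0..<d} \<longrightarrow>
       dist (tube_param p r \<phi> y) (tube_param p r \<phi> y') = hdist y y'"
      by (rule tube_param_local[OF p c p pr t0])
    let ?O = "fermi_box (\<phi> p) t0 N" and ?G = "tube_param p r \<phi>"
    have OH: "?O \<subseteq> H3" by (auto simp: fermi_box_def)
    have time: "fermi_time y \<in> {0..<d} \<inter> ball t0 N0" if "y \<in> ?O" for y
      using that N(2) by (auto simp: fermi_box_def dist_real_def)
    have G: "?G y \<in> tube" "?G y \<in> ball (E p t0) r'" if y: "y \<in> ?O" for y
    proof -
      obtain u where u: "u \<in> S \<inter> ball p r \<inter> ball p N" "\<phi> u = fermi_foot y" using N(3) y by blast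
      have ur: "u \<in> ball p r" "u \<in> S" "u \<in> S \<inter> ball p N0" using u N(2) by auto
      have G: "?G y = E u (fermi_time y)" by (rule tube_param_fermi[OF c ur(1) u(2)])
      show "?G y \<in> tube" unfolding G using time[OF y] by (intro E_in_tube ur(2)) blast
      show "?G y \<in> ball (E p t0) r'" unfolding G using N0(2) ur(3) time[OF y] by blast
    qed
    have Giso: "dist (?G y) (?G y') = hdist y y'" if y: "y \<in> ?O" "y' \<in> ?O" for y y'
      using N(4) y time[OF y(1)] time[OF y(2)] by blast
    have Gc: "continuous_on ?O ?G" by (rule continuous_on_from_hdist[OF OH]) (simp add: Giso)
    let ?h = "\<lambda>y. \<psi> (?G y)"
    have hc: "continuous_on ?O ?h"
      by (rule continuous_on_compose2[OF hisometric_continuous_on[OF iso] Gc]) (use G(2) in blast)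
    have hinj: "inj_on ?h ?O"
    proof (rule inj_onI)
      fix y y' assume y: "y \<in> ?O" "y' \<in> ?O" "?h y = ?h y'"
      then have "?G y = ?G y'" using inj_onD[OF hisometric_inj_on[OF iso]] G(2) by blast
      then have "hdist y y' = 0" using Giso[OF y(1,2)] by simp
      moreover have "y \<in> H3" "y' \<in> H3" using y OH by blast+
      ultimately show "y = y'" using hdist_eq_0_iff by blast
    qed
    have oh: "open (?h ` ?O)" by (rule invariance_of_domain[OF hc open_fermi_box[OF b(5)] hinj])
    let ?U = "ball (E p t0) r' \<inter> \<psi> -` (?h ` ?O)"
    have oU: "open ?U" by (rule continuous_open_preimage[OF hisometric_continuous_on[OF iso] open_ball oh])
    have "?U \<subseteq> tube"
    proof
      fix z assume z: "z \<in> ?U"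
      then obtain y where y: "y \<in> ?O" "\<psi> z = \<psi> (?G y)" by blast
      have "z = ?G y" using inj_onD[OF hisometric_inj_on[OF iso] y(2)] G(2)[OF y(1)] z by blast
      then show "z \<in> tube" using G(1)[OF y(1)] by simp
    qed
    moreover have "x \<in> ?U"
    proof -
      let ?y = "fermi (\<phi> p) t0"
      have y: "?y \<in> ?O"
        unfolding fermi_box_def using N(1) fermi_H3[OF b(5)] fermi_foot_fermi[OF b(4)] fermi_time_fermi[OF b(4)] by simp
      have "?G ?y = E p t0"
        using tube_param_fermi[OF c pr, of ?y] fermi_foot_fermi[OF b(4)] fermi_time_fermi[OF b(4)] by simp
      then have "\<psi> x \<in> ?h ` ?O" using x by (intro image_eqI[OF _ y]) simp
      then show ?thesis using x r' by simp
    qed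
    ultimately show ?thesis using oU by (meson openE subset_trans)
  qed
qed

text \<open>Radial control for the time coordinate. By \<open>fermi_metric\<close>, for nearby points \<open>u\<close> and \<open>v\<close> at
  times \<open>s\<close> and \<open>s'\<close>, \<open>cosh (dist u v)\<close> is at least \<open>cosh s cosh s' - sinh s sinh s' = cosh (s - s')\<close>. Slabs
  are images of compact sets because \<open>S\<close> is compact.\<close>

lemma tube_radial:
  assumes p: "p \<in> S" and t0: "0 \<le> t0" "t0 < d" and x: "dist (E p t0) x < \<eta>" and \<eta>: "t0 + \<eta> \<le> d"
  obtains q t where "q \<in> S" "t \<in> {0..<d}" "x = E q t" "\<bar>t - t0\<bar> \<le> dist (E p t0) x"
proof -
  obtain e where e: "continuous_on tube e" "\<forall>x\<in>tube. e x \<in> S \<times> {0..<d}" "\<forall>p\<in>S. \<forall>t\<in>{0..<d}. e (E p t) = (p, t)"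
    "continuous_on (S \<times> {0..<d}) (\<lambda>(p, t). E p t)" "\<forall>x\<in>tube. E (fst (e x)) (snd (e x)) = x"
    by (rule E_inverse)
  define R where "R x = snd (e x)" for x
  have RE: "R (E q t) = t" if "q \<in> S" "t \<in> {0..<d}" for q t using e(3) that by (simp add: R_def)
  have t0': "t0 \<in> {0..<d}" using t0 by simp
  have x0: "E p t0 \<in> tube" by (rule E_in_tube[OF p t0'])
  have loc: "\<exists>\<epsilon>>0. \<forall>u\<in>ball y \<epsilon>. \<forall>v\<in>ball y \<epsilon>. u \<in> tube \<and> v \<in> tube \<longrightarrow> \<bar>R u - R v\<bar> \<le> dist u v" if y: "y \<in> tube" for y
  proof -
    have ey: "fst (e y) \<in> S" "snd (e y) \<in> {0..<d}" using e(2) y by (auto simp: mem_Times_iff)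
    obtain N where N: "0 < N" "\<forall>q\<in>S \<inter> ball (fst (e y)) N. \<forall>q'\<in>S \<inter> ball (fst (e y)) N.
     \<forall>s\<in>{0..<d} \<inter> ball (snd (e y)) N. \<forall>s'\<in>{0..<d} \<inter> ball (snd (e y)) N.
       cosh (dist (E q s) (E q' s')) = cosh s * cosh s' * cosh (dist q q') - sinh s * sinh s'"
      using fermi_metric[OF ey] unfolding fermi_metric_near_def by blast
    obtain \<delta> where \<delta>: "0 < \<delta>" "\<forall>z\<in>tube. dist z y < \<delta> \<longrightarrow> dist (e z) (e y) < N"
      using e(1)[unfolded continuous_on_iff, rule_format, OF y N(1)] by blast
    have "\<bar>R u - R v\<bar> \<le> dist u v" if uv: "u \<in> ball y \<delta>" "v \<in> ball y \<delta>" "u \<in> tube" "v \<in> tube" for u v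
    proof -
      have in_box: "fst (e z) \<in> S \<inter> ball (fst (e y)) N" "snd (e z) \<in> {0..<d} \<inter> ball (snd (e y)) N"
        if z: "z \<in> ball y \<delta>" "z \<in> tube" for z
      proof -
        have "dist z y < \<delta>" using z(1) by (simp add: dist_commute)
        then have "dist (e z) (e y) < N" using \<delta>(2) z(2) by blast
        then have "dist (fst (e z)) (fst (e y)) < N" "dist (snd (e z)) (snd (e y)) < N"
          using dist_fst_le[of "e z" "e y"] dist_snd_le[of "e z" "e y"] by linarith+
        moreover have "fst (e z) \<in> S" "snd (e z) \<in> {0..<d}" using e(2) z by (auto simp: mem_Times_iff)
        ultimately show "fst (e z) \<in> S \<inter> ball (fst (e y)) N" "snd (e z) \<in> {0..<d} \<inter> ball (snd (e y)) N"
          by (simp_all add: dist_commute)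
      qed
      have "cosh (dist (E (fst (e u)) (R u)) (E (fst (e v)) (R v)))
          = cosh (R u) * cosh (R v) * cosh (dist (fst (e u)) (fst (e v))) - sinh (R u) * sinh (R v)"
        unfolding R_def using N(2) in_box[OF uv(1,3)] in_box[OF uv(2,4)] by blast
      then have "cosh (dist u v) = cosh (R u) * cosh (R v) * cosh (dist (fst (e u)) (fst (e v))) - sinh (R u) * sinh (R v)"
        using e(5) uv(3,4) by (simp add: R_def)
      also have "\<dots> \<ge> cosh (R u) * cosh (R v) * 1 - sinh (R u) * sinh (R v)"
        using cosh_real_ge_1[of "dist (fst (e u)) (fst (e v))"] by (intro diff_right_mono mult_left_mono) auto
      finally have "cosh \<bar>R u - R v\<bar> \<le> cosh (dist u v)" by (simp add: cosh_diff)
      then show ?thesis using cosh_le_iff[of "\<bar>R u - R v\<bar>" "dist u v"] by simp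
    qed
    then show ?thesis using \<delta>(1) by blast
  qed
  have cl: "closed {x \<in> tube. \<bar>R x - R (E p t0)\<bar> \<le> \<eta>'}" if e': "0 < \<eta>'" "\<eta>' < \<eta>" for \<eta>'
  proof -
    let ?K = "S \<times> {max 0 (t0 - \<eta>')..t0 + \<eta>'}"
    have Ksub: "?K \<subseteq> S \<times> {0..<d}" using e' \<eta> by auto
    have "compact ((\<lambda>(p, t). E p t) ` ?K)"
      by (intro compact_continuous_image continuous_on_subset[OF e(4) Ksub] compact_Times compact_S) simp
    moreover have "{x \<in> tube. \<bar>R x - R (E p t0)\<bar> \<le> \<eta>'} = (\<lambda>(p, t). E p t) ` ?K"
    proof (intro equalityI subsetI)
      fix y assume "y \<in> {x \<in> tube. \<bar>R x - R (E p t0)\<bar> \<le> \<eta>'}"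
      then have y: "y \<in> tube" "\<bar>R y - t0\<bar> \<le> \<eta>'" using RE[OF p t0'] by auto
      have "e y \<in> S \<times> {0..<d}" using e(2) y(1) by blast
      then have "e y \<in> ?K" using y(2) unfolding R_def by (auto simp: mem_Times_iff)
      moreover have "y = (\<lambda>(p, t). E p t) (e y)" using e(5) y(1) by (simp add: case_prod_beta)
      ultimately show "y \<in> (\<lambda>(p, t). E p t) ` ?K" by (rule rev_image_eqI)
    next
      fix y assume "y \<in> (\<lambda>(p, t). E p t) ` ?K"
      then obtain q t where qt: "q \<in> S" "t \<in> {max 0 (t0 - \<eta>')..t0 + \<eta>'}" "y = E q t" by auto
      have t: "t \<in> {0..<d}" using qt(1,2) Ksub by blast
      show "y \<in> {x \<in> tube. \<bar>R x - R (E p t0)\<bar> \<le> \<eta>'}"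
        unfolding mem_Collect_eq qt(3) RE[OF qt(1) t] RE[OF p t0'] using E_in_tube[OF qt(1) t] qt(2) by auto
    qed
    ultimately show ?thesis by (simp only: compact_imp_closed)
  qed
  have xt: "x \<in> tube" by (rule radial_control(1)[OF length open_tube x0 loc cl x])
  have xR: "\<bar>R x - R (E p t0)\<bar> \<le> dist (E p t0) x" by (rule radial_control(2)[OF length open_tube x0 loc cl x])
  show thesis
  proof (rule that[of "fst (e x)" "snd (e x)"])
    show "fst (e x) \<in> S" "snd (e x) \<in> {0..<d}" using e(2) xt by (auto simp: mem_Times_iff)
    show "x = E (fst (e x)) (snd (e x))" using e(5) xt by simp
    show "\<bar>snd (e x) - t0\<bar> \<le> dist (E p t0) x" using xR RE[OF p t0'] by (simp add: R_def)
  qed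
qed

definition tube_over :: "'a set \<Rightarrow> real \<Rightarrow> 'a set" where
  "tube_over A w = (\<lambda>(p, t). E p t) ` ((S \<inter> A) \<times> {0..<w})"

lemma infdist_less_iff_dist: "infdist x S < w \<longleftrightarrow> (\<exists>p\<in>S. dist x p < w)"
  unfolding infdist_def using S_nonempty by (simp add: cINF_less_iff)

lemma infdist_less_eq_tube:
  assumes w: "0 \<le> w" "w \<le> d"
  shows "{x. infdist x S < w} = tube_over UNIV w"
proof (intro equalityI subsetI)
  fix x assume "x \<in> {x. infdist x S < w}"
  then obtain p where p: "p \<in> S" "dist x p < w" by (auto simp: infdist_less_iff_dist)
  have "dist (E p 0) x < w" using p E_0 by (simp add: dist_commute)
  then obtain q t where qt: "q \<in> S" "t \<in> {0..<d}" "x = E q t" "\<bar>t - 0\<bar> \<le> dist (E p 0) x"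
    by (rule tube_radial[OF p(1) order_refl d]) (use w in simp)
  have "t \<in> {0..<w}" using qt(2,4) \<open>dist (E p 0) x < w\<close> by simp
  then show "x \<in> tube_over UNIV w" unfolding tube_over_def using qt(1,3) by (intro image_eqI[of _ _ "(q, t)"]) auto
next
  fix x assume "x \<in> tube_over UNIV w"
  then obtain q t where qt: "q \<in> S" "0 \<le> t" "t < w" "x = E q t" by (auto simp: tube_over_def)
  have "dist q x \<le> t" using E_dist_le[OF qt(1), of 0 t] qt w E_0[OF qt(1)] by simp
  then have "dist x q < w" using qt(3) by (simp add: dist_commute)
  then show "x \<in> {x. infdist x S < w}" using qt(1) unfolding mem_Collect_eq infdist_less_iff_dist by blast
qed

end

section \<open>The volume of collars\<close>

text \<open>The integral of \<open>cosh\<^sup>2\<close> from \<open>0\<close> to \<open>w\<close>: the volume of a collar per unit area of the boundary.\<close>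

definition collar_profile :: "real \<Rightarrow> real" where
  "collar_profile w = (w + sinh w * cosh w) / 2"

lemma collar_profile_0 [simp]: "collar_profile 0 = 0"
  by (simp add: collar_profile_def)

lemma collar_profile_strict_mono:
  assumes "0 \<le> v" "v < w"
  shows "collar_profile v < collar_profile w"
proof -
  have "sinh v * cosh v \<le> sinh w * cosh w"
    using assms by (intro mult_mono) (auto simp: cosh_le_iff)
  then show ?thesis using assms by (simp add: collar_profile_def)
qed

lemma collar_profile_midpoint_convex:
  assumes "0 < w" "\<tau> \<noteq> 0"
  shows "2 * collar_profile w < collar_profile (w + \<tau>) + collar_profile (w + - \<tau>)"
proof -
  have prof: "collar_profile v = v / 2 + sinh (2 * v) / 4" for v
    by (simp only: collar_profile_def sinh_double) (simp add: field_simps)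
  have sum: "sinh (2 * w + 2 * \<tau>) + sinh (2 * w - 2 * \<tau>) = 2 * (sinh (2 * w) * cosh (2 * \<tau>))"
    by (simp add: sinh_add sinh_diff)
  have "1 < cosh (2 * \<tau>)"
    using assms(2) cosh_less_iff[of 0 "\<bar>2 * \<tau>\<bar>"] by simp
  then have less: "sinh (2 * w) * 1 < sinh (2 * w) * cosh (2 * \<tau>)"
    using assms(1) by (intro mult_strict_left_mono) auto
  have arg: "2 * (w + \<tau>) = 2 * w + 2 * \<tau>" "2 * (w + - \<tau>) = 2 * w - 2 * \<tau>" by simp_all
  have "2 * (w / 2 + c / 4) < (w + \<tau>) / 2 + a / 4 + ((w + - \<tau>) / 2 + b / 4)"
    if "a + b = 2 * m" "c * 1 < m" for a b c m :: real
    using that by (simp add: field_simps)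
  from this[OF sum less] show ?thesis unfolding prof arg .
qed

context collar_embedding
begin

text \<open>Over a subset of one chart the tube is parametrised isometrically by Fermi coordinates in
  \<^term>\<open>H3\<close>, where \<open>hvol_tube\<close> computes the volume.\<close>

lemma vol_tube_over_chart:
  assumes p: "p \<in> S" and c: "boundary_chart p r \<phi>" and A: "A \<in> sets borel" "A \<subseteq> ball p r"
    and w: "0 \<le> w" "w \<le> d"
  shows "vol (tube_over A w) = wall_area (\<phi> ` (S \<inter> A)) * ennreal (collar_profile w)"
    "tube_over A w \<in> sets borel"
proof -
  note b = boundary_chart_charts[OF c]
  obtain e where e: "continuous_on tube e" "\<forall>x\<in>tube. e x \<in> S \<times> {0..<d}" "\<forall>p\<in>S. \<forall>t\<in>{0..<d}. e (E p t) = (p, t)"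
    "continuous_on (S \<times> {0..<d}) (\<lambda>(p, t). E p t)" "\<forall>x\<in>tube. E (fst (e x)) (snd (e x)) = x"
    by (rule E_inverse)
  let ?Q = "\<phi> ` (S \<inter> A)" and ?G = "tube_param p r \<phi>"
  have SB: "S \<in> sets borel" using compact_S by (intro borel_closed compact_imp_closed)
  have QB: "?Q \<in> sets borel"
  proof -
    have "\<phi> ` (ball p r \<inter> (S \<inter> A)) \<in> sets borel"
      using SB A(1) chart_image_borel[OF _ b(2)] by (intro hisometric_image_borel[OF b(3)]) auto
    moreover have "ball p r \<inter> (S \<inter> A) = S \<inter> A" using A(2) by blast
    ultimately show ?thesis by (simp only:)
  qed
  let ?Y = "{y \<in> H3. fermi_foot y \<in> ?Q \<and> fermi_time y \<in> {0..<w}}"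
  have YB: "?Y \<in> sets borel"
  proof -
    have "H3 \<inter> fermi_foot -` ?Q \<in> sets borel" "H3 \<inter> fermi_time -` {0..<w} \<in> sets borel"
      using open_H3 QB by (intro borel_vimage_continuous_on continuous_on_fermi_foot continuous_on_fermi_time; simp)+
    then have "(H3 \<inter> fermi_foot -` ?Q) \<inter> (H3 \<inter> fermi_time -` {0..<w}) \<in> sets borel" by (rule sets.Int)
    moreover have "(H3 \<inter> fermi_foot -` ?Q) \<inter> (H3 \<inter> fermi_time -` {0..<w}) = ?Y" by blast
    ultimately show ?thesis by (simp only:)
  qed
  have Gu: "\<exists>u\<in>S \<inter> A. \<phi> u = fermi_foot y \<and> ?G y = E u (fermi_time y)" if y: "fermi_foot y \<in> ?Q" for y
  proof -
    obtain u where u: "u \<in> S \<inter> A" "\<phi> u = fermi_foot y" using y by force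
    have "u \<in> ball p r" using u A(2) by blast
    then have "?G y = E u (fermi_time y)" by (rule tube_param_fermi[OF c _ u(2)])
    then show ?thesis using u by blast
  qed
  have Gfermi: "?G (fermi (\<phi> u) t) = E u t" "fermi_foot (fermi (\<phi> u) t) = \<phi> u" "fermi_time (fermi (\<phi> u) t) = t" "fermi (\<phi> u) t \<in> H3"
    if u: "u \<in> S \<inter> A" for u t
  proof -
    have ur: "u \<in> ball p r" using u A(2) by blast
    have uw: "\<phi> u \<in> wall" using S_iff_wall[OF p c ur] u by simp
    show ff: "fermi_foot (fermi (\<phi> u) t) = \<phi> u" and ft: "fermi_time (fermi (\<phi> u) t) = t"
      by (rule fermi_foot_fermi[OF uw], rule fermi_time_fermi[OF uw])
    show "?G (fermi (\<phi> u) t) = E u t" using tube_param_fermi[OF c ur, of "fermi (\<phi> u) t"] ff ft by simp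
    show "fermi (\<phi> u) t \<in> H3" by (rule fermi_H3[OF wall_H3[OF uw]])
  qed
  have GY: "?G ` (?Y \<inter> B) = {x \<in> tube. fst (e x) \<in> A \<and> snd (e x) < w \<and> fermi (\<phi> (fst (e x))) (snd (e x)) \<in> B}" for B
  proof (intro equalityI subsetI)
    fix x assume "x \<in> ?G ` (?Y \<inter> B)"
    then obtain y where y: "y \<in> ?Y" "y \<in> B" "x = ?G y" by blast
    obtain u where u: "u \<in> S \<inter> A" "\<phi> u = fermi_foot y" "?G y = E u (fermi_time y)" using Gu[of y] y(1) by blast
    have t: "fermi_time y \<in> {0..<d}" using y(1) w(2) by auto
    have ex: "e x = (u, fermi_time y)" using e(3) u(1) t unfolding y(3) u(3) by blast
    have "x \<in> tube" unfolding y(3) u(3) using u(1) t by (intro E_in_tube) auto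
    moreover have "fermi (\<phi> u) (fermi_time y) = y" unfolding u(2) by (rule fermi_foot_time) (use y(1) in blast)
    ultimately show "x \<in> {x \<in> tube. fst (e x) \<in> A \<and> snd (e x) < w \<and> fermi (\<phi> (fst (e x))) (snd (e x)) \<in> B}"
      using ex u(1) y(1,2) by simp
  next
    fix x assume "x \<in> {x \<in> tube. fst (e x) \<in> A \<and> snd (e x) < w \<and> fermi (\<phi> (fst (e x))) (snd (e x)) \<in> B}"
    then have x: "x \<in> tube" "fst (e x) \<in> A" "snd (e x) < w" "fermi (\<phi> (fst (e x))) (snd (e x)) \<in> B" by auto
    have uA: "fst (e x) \<in> S \<inter> A" "0 \<le> snd (e x)" using e(2) x(1,2) by (auto simp: mem_Times_iff)
    let ?y = "fermi (\<phi> (fst (e x))) (snd (e x))"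
    note G = Gfermi[OF uA(1), of "snd (e x)"]
    have "x = ?G ?y" using G(1) e(5) x(1) by simp
    moreover have "?y \<in> ?Y \<inter> B" using G uA x(3,4) by simp
    ultimately show "x \<in> ?G ` (?Y \<inter> B)" by (rule image_eqI)
  qed
  have GB: "?G ` (?Y \<inter> B) \<in> sets borel" if B: "B \<in> sets borel" for B
  proof -
    have c1: "continuous_on tube (\<lambda>x. fst (e x))" "continuous_on tube (\<lambda>x. snd (e x))"
      by (rule continuous_on_fst[OF e(1)], rule continuous_on_snd[OF e(1)])
    let ?T = "tube \<inter> (\<lambda>x. fst (e x)) -` ball p r"
    have oT: "open ?T" by (rule continuous_open_preimage[OF c1(1) open_tube open_ball])
    have c2: "continuous_on ?T (\<lambda>x. fst (e x))" "continuous_on ?T (\<lambda>x. snd (e x))"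
      using c1 by (auto intro: continuous_on_subset)
    have c3: "continuous_on ?T (\<lambda>x. \<phi> (fst (e x)))"
      by (rule continuous_on_compose2[OF hisometric_continuous_on[OF b(3)] c2(1)]) auto
    have "continuous_on ?T (\<lambda>x. (\<lambda>(q, t). fermi q t) (\<phi> (fst (e x)), snd (e x)))"
      by (rule continuous_on_compose2[OF continuous_on_fermi[of UNIV] continuous_on_Pair[OF c3 c2(2)]]) auto
    then have c4: "continuous_on ?T (\<lambda>x. fermi (\<phi> (fst (e x))) (snd (e x)))" by simp
    have TB: "?T \<in> sets borel" using oT by (rule borel_open)
    have b1: "?T \<inter> (\<lambda>x. fst (e x)) -` A \<in> sets borel" by (rule borel_vimage_continuous_on[OF c2(1) TB A(1)])
    have b2: "?T \<inter> (\<lambda>x. snd (e x)) -` {..<w} \<in> sets borel" by (rule borel_vimage_continuous_on[OF c2(2) TB]) simp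
    have b3: "?T \<inter> (\<lambda>x. fermi (\<phi> (fst (e x))) (snd (e x))) -` B \<in> sets borel"
      by (rule borel_vimage_continuous_on[OF c4 TB B])
    note sets.Int[OF b1 sets.Int[OF b2 b3]]
    moreover have "(?T \<inter> (\<lambda>x. fst (e x)) -` A) \<inter> ((?T \<inter> (\<lambda>x. snd (e x)) -` {..<w}) \<inter> (?T \<inter> (\<lambda>x. fermi (\<phi> (fst (e x))) (snd (e x))) -` B))
        = {x \<in> tube. fst (e x) \<in> A \<and> snd (e x) < w \<and> fermi (\<phi> (fst (e x))) (snd (e x)) \<in> B}"
      using A(2) by blast
    ultimately show ?thesis unfolding GY by (simp only:)
  qed
  have im: "?G ` ?Y = tube_over A w"
  proof (intro equalityI subsetI)
    fix x assume "x \<in> ?G ` ?Y"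
    then obtain y where y: "y \<in> ?Y" "x = ?G y" by blast
    obtain u where u: "u \<in> S \<inter> A" "?G y = E u (fermi_time y)" using Gu[of y] y(1) by blast
    show "x \<in> tube_over A w" unfolding tube_over_def y(2) u(2)
      using u(1) y(1) by (intro image_eqI[of _ _ "(u, fermi_time y)"]) auto
  next
    fix x assume "x \<in> tube_over A w"
    then obtain u t where ut: "u \<in> S \<inter> A" "t \<in> {0..<w}" "x = E u t" unfolding tube_over_def by auto
    note G = Gfermi[OF ut(1), of t]
    show "x \<in> ?G ` ?Y" by (rule image_eqI[of _ _ "fermi (\<phi> u) t"]) (use G ut in auto)
  qed
  have inj: "inj_on ?G ?Y"
  proof (rule inj_onI)
    fix y y' assume y: "y \<in> ?Y" "y' \<in> ?Y" "?G y = ?G y'"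
    obtain u where u: "u \<in> S \<inter> A" "\<phi> u = fermi_foot y" "?G y = E u (fermi_time y)" using Gu[of y] y(1) by blast
    obtain u' where u': "u' \<in> S \<inter> A" "\<phi> u' = fermi_foot y'" "?G y' = E u' (fermi_time y')" using Gu[of y'] y(2) by blast
    have t: "fermi_time y \<in> {0..<d}" "fermi_time y' \<in> {0..<d}" using y(1,2) w(2) by auto
    have e1: "e (E u (fermi_time y)) = (u, fermi_time y)" using bspec[OF bspec[OF e(3), of u] t(1)] u(1) by simp
    have e2: "e (E u' (fermi_time y')) = (u', fermi_time y')" using bspec[OF bspec[OF e(3), of u'] t(2)] u'(1) by simp
    have "E u (fermi_time y) = E u' (fermi_time y')" by (rule trans[OF u(3)[symmetric] trans[OF y(3) u'(3)]])
    then have "(u, fermi_time y) = (u', fermi_time y')" by (rule trans[OF e1[symmetric] trans[OF arg_cong[of _ _ e] e2]])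
    then have "u = u'" "fermi_time y = fermi_time y'" by blast+
    moreover have "y \<in> H3" "y' \<in> H3" using y by blast+
    ultimately show "y = y'" using fermi_foot_time u(2) u'(2) by metis
  qed
  have loc: "\<exists>V. open V \<and> y \<in> V \<and> (\<forall>u\<in>?Y \<inter> V. \<forall>v\<in>?Y \<inter> V. dist (?G u) (?G v) = hdist u v) \<and>
        (\<forall>Q\<in>sets borel. ?G ` (?Y \<inter> V \<inter> Q) \<in> sets borel)" if y: "y \<in> ?Y" for y
  proof -
    obtain u where u: "u \<in> S \<inter> A" "\<phi> u = fermi_foot y" using Gu[of y] y by blast
    have ur: "u \<in> S" "u \<in> ball p r" using u A(2) by blast+
    have t: "fermi_time y \<in> {0..<d}" using y w(2) by auto
    obtain N where N: "0 < N" "N \<le> 1"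
      "\<forall>z\<in>fermi_box (\<phi> u) (fermi_time y) N. \<exists>u'\<in>S \<inter> ball p r \<inter> ball u N. \<phi> u' = fermi_foot z"
      "\<forall>z\<in>fermi_box (\<phi> u) (fermi_time y) N. \<forall>z'\<in>fermi_box (\<phi> u) (fermi_time y) N. fermi_time z \<in> {0..<d} \<longrightarrow> fermi_time z' \<in> {0..<d} \<longrightarrow>
       dist (?G z) (?G z') = hdist z z'"
      by (rule tube_param_local[OF p c ur t zero_less_one])
    let ?V = "fermi_box (\<phi> u) (fermi_time y) N"
    have uH: "\<phi> u \<in> H3" by (rule boundary_chart_dist(2)[OF c ur(2) ur(2)])
    have oV: "open ?V" by (rule open_fermi_box[OF uH])
    moreover have "y \<in> ?V" unfolding fermi_box_def using y N(1) u(2) by simp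
    moreover have "dist (?G z) (?G z') = hdist z z'" if z: "z \<in> ?Y \<inter> ?V" "z' \<in> ?Y \<inter> ?V" for z z'
    proof -
      have "fermi_time z \<in> {0..<d}" "fermi_time z' \<in> {0..<d}" using z w(2) by auto
      then show ?thesis using N(4) z by blast
    qed
    moreover have "?G ` (?Y \<inter> ?V \<inter> Q) \<in> sets borel" if "Q \<in> sets borel" for Q
      unfolding Int_assoc by (rule GB) (use oV that in auto)
    ultimately show ?thesis by (intro exI[of _ ?V] conjI ballI)
  qed
  have YH: "?Y \<subseteq> H3" by blast
  show "tube_over A w \<in> sets borel"
    using vol_locally_isometric_image(2)[OF charted YB YH inj loc] by (simp only: im)
  have "vol (tube_over A w) = emeasure hvol ?Y"
    using vol_locally_isometric_image(1)[OF charted YB YH inj loc] by (simp only: im)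
  also have "\<dots> = wall_area ?Q * ennreal (collar_profile w)"
    unfolding collar_profile_def by (rule hvol_tube[OF QB w(1)])
  finally show "vol (tube_over A w) = wall_area ?Q * ennreal (collar_profile w)" .
qed

lemma tube_over_Un: "tube_over (A \<union> B) w = tube_over A w \<union> tube_over B w"
  unfolding tube_over_def by blast

lemma tube_over_disjoint:
  assumes "A \<inter> B = {}" "w \<le> d"
  shows "tube_over A w \<inter> tube_over B w = {}"
proof -
  obtain e where e: "continuous_on tube e" "\<forall>x\<in>tube. e x \<in> S \<times> {0..<d}" "\<forall>p\<in>S. \<forall>t\<in>{0..<d}. e (E p t) = (p, t)"
    "continuous_on (S \<times> {0..<d}) (\<lambda>(p, t). E p t)" "\<forall>x\<in>tube. E (fst (e x)) (snd (e x)) = x"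
    by (rule E_inverse)
  have "fst (e x) \<in> C" if x: "x \<in> tube_over C w" for x C
  proof -
    obtain u t where ut: "u \<in> S \<inter> C" "t \<in> {0..<w}" "x = E u t" using x unfolding tube_over_def by auto
    have "t \<in> {0..<d}" using ut(2) assms(2) by auto
    then have "e x = (u, t)" using e(3) ut(1,3) by blast
    then show ?thesis using ut by simp
  qed
  then show ?thesis using assms(1) by blast
qed

text \<open>The area of the boundary component enters only as a factor, so it suffices to add up the pieces of
  a finite cover by charts.\<close>

lemma vol_tube_over_finite_cover:
  assumes "finite F" "F \<subseteq> S" "\<forall>p\<in>F. boundary_chart p (r p) (\<phi> p)"
    "A \<in> sets borel" "A \<subseteq> (\<Union>p\<in>F. ball p (r p))"
  shows "\<exists>a. \<forall>w. 0 \<le> w \<and> w \<le> d \<longrightarrow> vol (tube_over A w) = a * ennreal (collar_profile w) \<and> tube_over A w \<in> sets borel"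
  using assms
proof (induction F arbitrary: A rule: finite_induct)
  case empty
  then have "tube_over A w = {}" for w by (simp add: tube_over_def)
  then show ?case using vol_empty[OF charted] by (intro exI[of _ 0]) simp
next
  case (insert p F)
  have pS: "p \<in> S" and c: "boundary_chart p (r p) (\<phi> p)" using insert.prems by auto
  let ?B = "A \<inter> ball p (r p)" and ?C = "A - ball p (r p)"
  have B: "?B \<in> sets borel" "?B \<subseteq> ball p (r p)" using insert.prems(3) by auto
  have "F \<subseteq> S" "\<forall>p\<in>F. boundary_chart p (r p) (\<phi> p)" "?C \<in> sets borel" "?C \<subseteq> (\<Union>p\<in>F. ball p (r p))"
    using insert.prems by auto
  from insert.IH[OF this] obtain a where a: "\<forall>w. 0 \<le> w \<and> w \<le> d \<longrightarrow> vol (tube_over ?C w) = a * ennreal (collar_profile w) \<and> tube_over ?C w \<in> sets borel"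
    by blast
  let ?a = "wall_area (\<phi> p ` (S \<inter> ?B)) + a"
  have "vol (tube_over A w) = ?a * ennreal (collar_profile w) \<and> tube_over A w \<in> sets borel" if w: "0 \<le> w \<and> w \<le> d" for w
  proof -
    have w': "0 \<le> w" "w \<le> d" using w by auto
    note vB = vol_tube_over_chart[OF pS c B w']
    have vC: "vol (tube_over ?C w) = a * ennreal (collar_profile w)" "tube_over ?C w \<in> sets borel" using a w by blast+
    have "A = ?B \<union> ?C" by blast
    then have AU: "tube_over A w = tube_over ?B w \<union> tube_over ?C w" using tube_over_Un[of ?B ?C w] by simp
    have dis: "tube_over ?B w \<inter> tube_over ?C w = {}" by (rule tube_over_disjoint[OF _ w'(2)]) blast
    have bor: "tube_over A w \<in> sets borel" unfolding AU using vB(2) vC(2) by (rule sets.Un)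
    have "vol (tube_over A w) = emeasure volume (tube_over ?B w \<union> tube_over ?C w)"
      using emeasure_volume[OF charted bor] AU by simp
    also have "\<dots> = emeasure volume (tube_over ?B w) + emeasure volume (tube_over ?C w)"
      using vB(2) vC(2) dis by (intro plus_emeasure[symmetric]) auto
    also have "\<dots> = vol (tube_over ?B w) + vol (tube_over ?C w)"
      using emeasure_volume[OF charted vB(2)] emeasure_volume[OF charted vC(2)] by simp
    also have "\<dots> = ?a * ennreal (collar_profile w)" unfolding vB(1) vC(1) by (rule distrib_right[symmetric])
    finally show ?thesis using bor by blast
  qed
  then show ?case by blast
qed

text \<open>The area \<open>\<alpha>\<close> is finite because the manifold has finite volume, and positive because the collar is a
  nonempty open set.\<close>

lemma vol_collar_interior:
  obtains \<alpha> where "0 < \<alpha>" "\<forall>w. 0 \<le> w \<and> w \<le> d \<longrightarrow> vol {x. infdist x S < w} = ennreal (\<alpha> * collar_profile w)"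
proof -
  have "\<forall>p\<in>S. \<exists>r \<phi>. boundary_chart p r \<phi>" using S_bdry by (auto simp: bdry_def)
  then obtain r \<phi> where c: "\<forall>p\<in>S. boundary_chart p (r p) (\<phi> p)" by metis
  have "S \<subseteq> (\<Union>p\<in>S. ball p (r p))" using boundary_chart_charts(1) c by force
  then obtain F where F: "F \<subseteq> S" "finite F" "S \<subseteq> (\<Union>p\<in>F. ball p (r p))"
    using compactE_image[OF compact_S, of S "\<lambda>p. ball p (r p)"] by blast
  let ?A = "\<Union>p\<in>F. ball p (r p)"
  have A: "?A \<in> sets borel" by (intro borel_open) blast
  have c': "\<forall>p\<in>F. boundary_chart p (r p) (\<phi> p)" using c F(1) by blast
  obtain a where a: "\<forall>w. 0 \<le> w \<and> w \<le> d \<longrightarrow> vol (tube_over ?A w) = a * ennreal (collar_profile w) \<and> tube_over ?A w \<in> sets borel"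
    using vol_tube_over_finite_cover[OF F(2,1) c' A order_refl] by blast
  have eq: "tube_over ?A w = {x. infdist x S < w}" if "0 \<le> w" "w \<le> d" for w
  proof -
    have "tube_over ?A w = tube_over UNIV w" using F(3) unfolding tube_over_def by (simp add: Int_absorb2)
    then show ?thesis using infdist_less_eq_tube[OF that] by simp
  qed
  have V: "vol {x. infdist x S < w} = a * ennreal (collar_profile w)" if "0 \<le> w" "w \<le> d" for w
  proof -
    have "vol (tube_over ?A w) = a * ennreal (collar_profile w)" using a that by blast
    then show ?thesis by (simp only: eq[OF that])
  qed
  have Pd: "0 < collar_profile d" using collar_profile_strict_mono[of 0 d] d by simp
  have "vol {x. infdist x S < d} \<le> vol (UNIV :: 'a set)" by (rule vol_mono) simp
  also have "\<dots> < \<infinity>" using manifold by (simp add: hyperbolic_3_manifold_def)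
  finally have fin: "a * ennreal (collar_profile d) < \<infinity>" using V[of d] d by simp
  have o: "open {x. infdist x S < d}" by (intro open_Collect_less continuous_intros)
  have ne: "{x. infdist x S < d} \<noteq> {}"
  proof -
    obtain p where "p \<in> S" using S_nonempty by blast
    then have "infdist p S < d" using d by simp
    then show ?thesis by blast
  qed
  have "0 < a * ennreal (collar_profile d)" using vol_open_pos[OF charted o ne] V[of d] d by simp
  then have a0: "a \<noteq> 0" by auto
  have "a \<noteq> \<infinity>"
  proof
    assume "a = \<infinity>"
    then have "a * ennreal (collar_profile d) = \<infinity>" using Pd by (simp add: ennreal_top_mult)
    then show False using fin by simp
  qed
  then obtain \<alpha> where \<alpha>: "a = ennreal \<alpha>" "0 \<le> \<alpha>" by (cases a) auto
  have "0 < \<alpha>" using a0 \<alpha> by (cases "\<alpha> = 0") auto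
  moreover have "vol {x. infdist x S < w} = ennreal (\<alpha> * collar_profile w)" if w: "0 \<le> w \<and> w \<le> d" for w
  proof -
    have "0 \<le> collar_profile w" using w by (simp add: collar_profile_def)
    then show ?thesis using V[of w] w \<alpha> by (simp add: ennreal_mult)
  qed
  ultimately show thesis using that by blast
qed

text \<open>The closed collar lies in all wider open collars, and the volume of these depends continuously on
  the width.\<close>

lemma vol_collar:
  obtains \<alpha> where "0 < \<alpha>" "\<forall>w. 0 \<le> w \<and> w < d \<longrightarrow> vol (pc (Boundary S) w) = ennreal (\<alpha> * collar_profile w)"
proof -
  obtain \<alpha> where \<alpha>: "0 < \<alpha>" "\<forall>w. 0 \<le> w \<and> w \<le> d \<longrightarrow> vol {x. infdist x S < w} = ennreal (\<alpha> * collar_profile w)"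
    by (rule vol_collar_interior)
  have "vol (pc (Boundary S) w) = ennreal (\<alpha> * collar_profile w)" if w: "0 \<le> w" "w < d" for w
  proof (rule antisym)
    have pos: "0 \<le> \<alpha> * collar_profile v" if "0 \<le> v" for v using \<alpha>(1) that by (simp add: collar_profile_def)
    have "ennreal (\<alpha> * collar_profile w) = vol {x. infdist x S < w}" using \<alpha>(2) w by simp
    also have "\<dots> \<le> vol (pc (Boundary S) w)" by (rule vol_mono) auto
    finally show "ennreal (\<alpha> * collar_profile w) \<le> vol (pc (Boundary S) w)" .
    have up: "vol (pc (Boundary S) w) \<le> ennreal (\<alpha> * collar_profile v)" if v: "w < v" "v \<le> d" for v
    proof -
      have "vol (pc (Boundary S) w) \<le> vol {x. infdist x S < v}" using v by (intro vol_mono) auto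
      then show ?thesis using \<alpha>(2) v w by simp
    qed
    obtain V where V: "vol (pc (Boundary S) w) = ennreal V" "0 \<le> V"
      using up[OF w(2) order_refl] by (cases "vol (pc (Boundary S) w)") (auto simp: top_unique)
    have "isCont (\<lambda>v. \<alpha> * collar_profile v) w" unfolding collar_profile_def by (intro continuous_intros) auto
    then have lim: "((\<lambda>v. \<alpha> * collar_profile v) \<longlongrightarrow> \<alpha> * collar_profile w) (at_right w)"
      unfolding isCont_def by (rule filterlim_mono) (auto simp: at_le)
    have "\<forall>\<^sub>F v in at_right w. V \<le> \<alpha> * collar_profile v"
      unfolding eventually_at_right[OF w(2)]
    proof (intro exI[of _ d] conjI allI impI)
      fix v assume v: "w < v" "v < d"
      have "ennreal V \<le> ennreal (\<alpha> * collar_profile v)" using up[of v] v V(1) by simp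
      then show "V \<le> \<alpha> * collar_profile v" using pos[of v] v w by simp
    qed (rule w(2))
    then have "V \<le> \<alpha> * collar_profile w" by (rule tendsto_lowerbound[OF lim]) simp
    then show "vol (pc (Boundary S) w) \<le> ennreal (\<alpha> * collar_profile w)" unfolding V(1) by (rule ennreal_leI)
  qed
  then show thesis using that \<alpha>(1) by blast
qed

end

lemma normal_geodesic_restrict:
  assumes "normal_geodesic d p \<gamma>" "d' \<le> d"
  shows "normal_geodesic d' p \<gamma>"
proof -
  have loc: "\<forall>t\<in>{0..<d}. \<exists>\<epsilon>>0. \<forall>s\<in>{0..<d} \<inter> ball t \<epsilon>. \<forall>s'\<in>{0..<d} \<inter> ball t \<epsilon>. dist (\<gamma> s) (\<gamma> s') = \<bar>s - s'\<bar>"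
    using assms(1) unfolding normal_geodesic_def by (elim conjE)
  have sub: "{0..<d'} \<subseteq> {0..<d}" using assms(2) by auto
  have "\<forall>t\<in>{0..<d'}. \<exists>\<epsilon>>0. \<forall>s\<in>{0..<d'} \<inter> ball t \<epsilon>. \<forall>s'\<in>{0..<d'} \<inter> ball t \<epsilon>. dist (\<gamma> s) (\<gamma> s') = \<bar>s - s'\<bar>"
  proof
    fix t assume "t \<in> {0..<d'}"
    then have "t \<in> {0..<d}" using sub by blast
    from bspec[OF loc this] obtain \<epsilon> where \<epsilon>: "0 < \<epsilon>" "\<forall>s\<in>{0..<d} \<inter> ball t \<epsilon>. \<forall>s'\<in>{0..<d} \<inter> ball t \<epsilon>. dist (\<gamma> s) (\<gamma> s') = \<bar>s - s'\<bar>"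
      by blast
    show "\<exists>\<epsilon>>0. \<forall>s\<in>{0..<d'} \<inter> ball t \<epsilon>. \<forall>s'\<in>{0..<d'} \<inter> ball t \<epsilon>. dist (\<gamma> s) (\<gamma> s') = \<bar>s - s'\<bar>"
    proof (intro exI[of _ \<epsilon>] conjI ballI)
      fix s s' assume "s \<in> {0..<d'} \<inter> ball t \<epsilon>" "s' \<in> {0..<d'} \<inter> ball t \<epsilon>"
      then have "s \<in> {0..<d} \<inter> ball t \<epsilon>" "s' \<in> {0..<d} \<inter> ball t \<epsilon>" using sub by blast+
      then show "dist (\<gamma> s) (\<gamma> s') = \<bar>s - s'\<bar>" using \<epsilon>(2) by blast
    qed (rule \<epsilon>(1))
  qed
  moreover have "\<gamma> 0 = p" using assms(1) by (simp add: normal_geodesic_def)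
  moreover obtain r \<phi> where c: "boundary_chart p r \<phi>" "\<forall>t. 0 \<le> t \<and> t < r \<and> t < d \<longrightarrow>
           \<phi> (\<gamma> t) = (fst (\<phi> p) + of_real (snd (\<phi> p) * tanh t), snd (\<phi> p) / cosh t)"
    using assms(1) unfolding normal_geodesic_def by (elim conjE exE) (rule that)
  have "\<forall>t. 0 \<le> t \<and> t < r \<and> t < d' \<longrightarrow>
           \<phi> (\<gamma> t) = (fst (\<phi> p) + of_real (snd (\<phi> p) * tanh t), snd (\<phi> p) / cosh t)"
    using c(2) assms(2) by simp
  then have "\<exists>r \<phi>. boundary_chart p r \<phi> \<and> (\<forall>t. 0 \<le> t \<and> t < r \<and> t < d' \<longrightarrow>
           \<phi> (\<gamma> t) = (fst (\<phi> p) + of_real (snd (\<phi> p) * tanh t), snd (\<phi> p) / cosh t))"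
    using c(1) by (intro exI[of _ r] exI[of _ \<phi>] conjI)
  ultimately show ?thesis unfolding normal_geodesic_def by (intro conjI)
qed

lemma embedded_collar_restrict:
  assumes "embedded_collar S d" "d' \<le> d"
  shows "embedded_collar S d'"
proof -
  obtain E where E: "\<forall>p\<in>S. normal_geodesic d p (E p)"
    "embedding_map (top_of_set (S \<times> {0..<d})) euclidean (\<lambda>(p, t). E p t)"
    using assms(1) unfolding embedded_collar_def by (elim exE conjE) (rule that)
  have "\<forall>p\<in>S. normal_geodesic d' p (E p)" using E(1) normal_geodesic_restrict[OF _ assms(2)] by blast
  moreover have "embedding_map (top_of_set (S \<times> {0..<d'})) euclidean (\<lambda>(p, t). E p t)"
  proof -
    let ?f = "\<lambda>(p, t). E p t" and ?X = "S \<times> {0..<d}" and ?X' = "S \<times> {0..<d'}"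
    have sub: "?X' \<subseteq> ?X" using assms(2) by auto
    have "homeomorphic_map (top_of_set ?X) (top_of_set (?f ` ?X)) ?f" using E(2) by (simp add: embedding_map_def)
    then have "homeomorphic_map (subtopology (top_of_set ?X) ?X') (subtopology (top_of_set (?f ` ?X)) (?f ` ?X')) ?f"
    proof (rule homeomorphic_map_subtopologies)
      have "?X \<inter> ?X' = ?X'" "?f ` ?X \<inter> ?f ` ?X' = ?f ` ?X'" using sub image_mono[OF sub, of ?f] by blast+
      then show "?f ` (topspace (top_of_set ?X) \<inter> ?X') = topspace (top_of_set (?f ` ?X)) \<inter> ?f ` ?X'"
        by (simp only: topspace_euclidean_subtopology)
    qed
    moreover have "subtopology (top_of_set ?X) ?X' = top_of_set ?X'"
      "subtopology (top_of_set (?f ` ?X)) (?f ` ?X') = top_of_set (?f ` ?X')"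
      using sub by (simp_all add: subtopology_subtopology Int_absorb1 image_mono)
    ultimately show ?thesis by (simp add: embedding_map_def)
  qed
  ultimately show ?thesis unfolding embedded_collar_def by blast
qed

lemma collar_embedding_of_peripheral:
  assumes "hyperbolic_3_manifold TYPE('a::metric_space)" "(S :: 'a set) \<in> components bdry"
    "peripheral (Boundary S) y" "0 < y"
  obtains E where "collar_embedding S y E"
proof -
  have "embedded_collar S y" using assms(3) by simp
  then obtain E where "\<forall>p\<in>S. normal_geodesic y p (E p)"
    "embedding_map (top_of_set (S \<times> {0..<y})) euclidean (\<lambda>(p, t). E p t)"
    unfolding embedded_collar_def by (elim exE conjE) (rule that)
  then have "collar_embedding S y E" using assms by unfold_locales auto
  then show thesis by (rule that)
qed

lemma collar_mono:
  assumes "peripheral (Boundary S) y" "0 \<le> x" "x \<le> y"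
  shows "peripheral (Boundary S) x" "pc_interior (Boundary S) x \<subseteq> pc_interior (Boundary S) y" "pc (Boundary S) x \<subseteq> pc (Boundary S) y"
  using assms embedded_collar_restrict[of S y x] by auto

lemma collar_shiftable:
  assumes M: "hyperbolic_3_manifold TYPE('a::metric_space)" and S: "(S :: 'a set) \<in> components bdry"
    and y: "peripheral (Boundary S) y" and x: "0 < x" "x < y"
  shows "shiftable (Boundary S) x"
proof -
  obtain E where "collar_embedding S y E"
    by (rule collar_embedding_of_peripheral[OF M S y]) (use x in simp)
  then interpret collar_embedding S y E .
  obtain \<alpha> where \<alpha>: "0 < \<alpha>" "\<forall>w. 0 \<le> w \<and> w < y \<longrightarrow> vol (pc (Boundary S) w) = ennreal (\<alpha> * collar_profile w)"
    by (rule vol_collar)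
  define \<eta> where "\<eta> = min x (y - x)"
  have range: "0 \<le> x + \<tau>" "x + \<tau> < y" if "\<bar>\<tau>\<bar> < \<eta>" for \<tau> using that by (auto simp: \<eta>_def)
  show ?thesis unfolding shiftable_def
  proof (rule exI[of _ "\<lambda>\<tau>. x + \<tau>"], rule exI[of _ "\<lambda>\<tau>. \<alpha> * collar_profile (x + \<tau>)"], rule exI[of _ \<eta>],
      intro conjI allI impI ballI)
    show "0 < \<eta>" using x by (simp add: \<eta>_def)
    show "x + 0 = x" by simp
    have "isCont (\<lambda>\<tau>. x + \<tau>) 0" by (intro continuous_intros)
    then show "(\<lambda>\<tau>. x + \<tau>) \<midarrow>0\<rightarrow> x" by (simp add: isCont_def)
  next
    fix \<tau> assume \<tau>: "\<bar>\<tau>\<bar> < \<eta>"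
    show "peripheral (Boundary S) (x + \<tau>)" using range[OF \<tau>] by (intro collar_mono(1)[OF y]) auto
    show "0 \<le> \<alpha> * collar_profile (x + \<tau>)" using \<alpha>(1) range[OF \<tau>] by (simp add: collar_profile_def)
    show "vol (pc (Boundary S) (x + \<tau>)) = ennreal (\<alpha> * collar_profile (x + \<tau>))" using \<alpha>(2) range[OF \<tau>] by blast
  next
    fix \<tau> assume \<tau>: "0 < \<tau> \<and> \<tau> < \<eta>"
    have "\<alpha> * (2 * collar_profile x) < \<alpha> * (collar_profile (x + \<tau>) + collar_profile (x + - \<tau>))"
      using collar_profile_midpoint_convex[OF x(1), of \<tau>] \<tau> \<alpha>(1) by (intro mult_strict_left_mono) auto
    then show "2 * (\<alpha> * collar_profile (x + 0)) < \<alpha> * collar_profile (x + \<tau>) + \<alpha> * collar_profile (x + - \<tau>)"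
      by (simp add: algebra_simps)
  next
    fix \<tau> u assume \<tau>: "0 < \<tau> \<and> \<tau> < \<eta>" and u: "u \<in> pc_interior (Boundary S) (x + \<tau>)"
    have xy: "0 \<le> x + \<tau>" "x + \<tau> \<le> y" using range[of \<tau>] \<tau> by auto
    have "u \<in> tube_over UNIV (x + \<tau>)" using u infdist_less_eq_tube[OF xy] by simp
    then obtain q t where qt: "q \<in> S" "0 \<le> t" "t < x + \<tau>" "u = E q t" unfolding tube_over_def by auto
    \<comment> \<open>Move back along the normal geodesic through \<open>u\<close> to a time between \<open>t - \<tau>\<close> and \<open>x\<close>.\<close>
    define s where "s = (if t < x then t else (max 0 (t - \<tau>) + x) / 2)"
    have s: "0 \<le> s" "s < x" "s \<le> t" "t - s < \<tau>"
      using qt(2,3) \<tau> x(1) by (auto simp: s_def max_def field_simps split: if_splits)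
    have sy: "s < y" "t < y" using s x(2) qt(3) xy by auto
    have "dist q (E q s) \<le> s" using E_dist_le[OF qt(1), of 0 s] s sy E_0[OF qt(1)] by simp
    then have "dist (E q s) q < x" using s(2) by (simp add: dist_commute)
    then have "E q s \<in> pc_interior (Boundary S) x" using qt(1) unfolding pc_interior.simps mem_Collect_eq infdist_less_iff_dist by blast
    moreover have "dist u (E q s) < \<tau>" using E_dist_le[OF qt(1) s(1,3) sy(2)] s(4) qt(4) by (simp add: dist_commute)
    ultimately show "\<exists>v\<in>pc_interior (Boundary S) x. dist u v < \<tau>" by blast
  next
    fix \<tau> u v assume \<tau>: "0 < \<tau> \<and> \<tau> < \<eta>" and u: "u \<in> pc_interior (Boundary S) (x + - \<tau>)" and v: "dist u v < \<tau>"
    have "infdist v S \<le> infdist u S + dist v u" by (rule infdist_triangle)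
    then show "v \<in> pc_interior (Boundary S) x" using u v by (simp add: dist_commute)
  qed
qed

section \<open>Peripheral components at an arbitrary site\<close>

lemma manifold_metric:
  assumes "hyperbolic_3_manifold TYPE('a::metric_space)"
  shows "length_metric TYPE('a)" "complete (UNIV :: 'a set)" "charted TYPE('a)" "vol (A :: 'a set) < \<infinity>"
proof -
  show "length_metric TYPE('a)" "complete (UNIV :: 'a set)" using assms by (simp_all add: hyperbolic_3_manifold_def)
  show "charted TYPE('a)" by (rule hyperbolic_3_manifold_charted[OF assms])
  have "vol A \<le> vol (UNIV :: 'a set)" by (rule vol_mono) simp
  also have "\<dots> < \<infinity>" using assms by (simp add: hyperbolic_3_manifold_def)
  finally show "vol A < \<infinity>" .
qed

lemma site_mono:
  assumes M: "hyperbolic_3_manifold TYPE('a::metric_space)" and e: "(e :: 'a site) \<in> sites"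
    and x: "peripheral e x" and y: "peripheral e y" and z: "x \<le> z" "z \<le> y"
  shows "peripheral e z" "pc_interior e z \<subseteq> pc_interior e y" "pc e z \<subseteq> pc e y"
proof -
  note m = manifold_metric[OF M]
  have "peripheral e z \<and> pc_interior e z \<subseteq> pc_interior e y \<and> pc e z \<subseteq> pc e y"
  proof (cases e)
    case (Boundary S)
    have "0 \<le> z" using x z(1) by (simp add: Boundary)
    then show ?thesis unfolding Boundary using collar_mono[OF y[unfolded Boundary] _ z(2)] by blast
  next
    case (Cusp T)
    have T: "T \<in> cusps" using e by (auto simp: sites_def Cusp)
    have "0 < z" using x z(1) by (simp add: Cusp)
    then show ?thesis unfolding Cusp using cusp_mono[OF m(1-3) T y[unfolded Cusp] _ z(2)] by blast
  qed
  then show "peripheral e z" "pc_interior e z \<subseteq> pc_interior e y" "pc e z \<subseteq> pc e y" by blast+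
qed

lemma site_vol_strict_mono:
  assumes M: "hyperbolic_3_manifold TYPE('a::metric_space)" and e: "(e :: 'a site) \<in> sites"
    and x: "peripheral e x" and y: "peripheral e y" and z: "x < z" "z < y"
  shows "vol (pc e x) < vol (pc e z)"
proof (cases e)
  case (Boundary S)
  have S: "S \<in> components bdry" using e by (auto simp: sites_def Boundary)
  have x0: "0 \<le> x" using x by (simp add: Boundary)
  obtain E where "collar_embedding S y E"
    by (rule collar_embedding_of_peripheral[OF M S y[unfolded Boundary]]) (use x0 z in simp)
  then interpret collar_embedding S y E .
  obtain \<alpha> where \<alpha>: "0 < \<alpha>" "\<forall>w. 0 \<le> w \<and> w < y \<longrightarrow> vol (pc (Boundary S) w) = ennreal (\<alpha> * collar_profile w)"
    by (rule vol_collar)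
  have "\<alpha> * collar_profile x < \<alpha> * collar_profile z"
    using collar_profile_strict_mono[OF x0 z(1)] \<alpha>(1) by simp
  moreover have "0 \<le> \<alpha> * collar_profile x" using \<alpha>(1) x0 by (simp add: collar_profile_def)
  moreover have "vol (pc e x) = ennreal (\<alpha> * collar_profile x)" "vol (pc e z) = ennreal (\<alpha> * collar_profile z)"
    unfolding Boundary using \<alpha>(2) x0 z by simp_all
  ultimately show ?thesis by (simp add: ennreal_less_iff)
next
  case (Cusp T)
  have T: "T \<in> cusps" using e by (auto simp: sites_def Cusp)
  have x0: "0 < x" using x by (simp add: Cusp)
  note v = cusp_vol_pc[OF manifold_metric(1-3)[OF M] T y[unfolded Cusp]]
  have "vol (pc e x) = ennreal x" "vol (pc e z) = ennreal z" unfolding Cusp using v x0 z by simp_all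
  then show ?thesis using x0 z by (simp add: ennreal_less_iff)
qed

lemma site_shiftable:
  assumes M: "hyperbolic_3_manifold TYPE('a::metric_space)" and e: "(e :: 'a site) \<in> sites"
    and x: "peripheral e x" and y: "peripheral e y" "x < y" and ne: "pc_interior e x \<noteq> {}"
  shows "shiftable e x"
proof (cases e)
  case (Boundary S)
  have S: "S \<in> components bdry" using e by (auto simp: sites_def Boundary)
  \<comment> \<open>A collar of width zero has empty interior.\<close>
  have "x \<noteq> 0" using ne infdist_nonneg[of _ S] by (auto simp: Boundary not_less[symmetric])
  then have "0 < x" using x by (simp add: Boundary)
  then show ?thesis unfolding Boundary by (rule collar_shiftable[OF M S y(1)[unfolded Boundary] _ y(2)])
next
  case (Cusp T)
  have T: "T \<in> cusps" using e by (auto simp: sites_def Cusp)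
  have "0 < x" using x by (simp add: Cusp)
  then show ?thesis unfolding Cusp
    by (rule cusp_shiftable[OF manifold_metric(1-3)[OF M] T y(1)[unfolded Cusp] _ y(2)])
qed


section \<open>Local maxima of the total volume\<close>

text \<open>Local maximality on a square around the parameters, a form that is symmetric in the two sites.\<close>

definition local_max :: "'a::metric_space site \<Rightarrow> 'a site \<Rightarrow> real \<Rightarrow> real \<Rightarrow> bool" where
  "local_max e1 e2 x1 x2 \<longleftrightarrow> configuration e1 e2 x1 x2 \<and>
     (\<exists>\<delta>>0. \<forall>y1 y2. \<bar>y1 - x1\<bar> < \<delta> \<longrightarrow> \<bar>y2 - x2\<bar> < \<delta> \<longrightarrow> configuration e1 e2 y1 y2 \<longrightarrow>
        vol (pc e1 y1) + vol (pc e2 y2) \<le> vol (pc e1 x1) + vol (pc e2 x2))"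

lemma configuration_commute: "configuration e1 e2 x1 x2 \<longleftrightarrow> configuration e2 e1 x2 x1"
  by (auto simp: configuration_def)

lemma local_max_commute: "local_max e1 e2 x1 x2 \<Longrightarrow> local_max e2 e1 x2 x1"
  unfolding local_max_def configuration_commute[of e1 e2] add.commute[of "vol (pc e1 _)"] by blast

text \<open>If a larger parameter were admissible, then so would be all parameters in between, since interiors
  shrink with the parameter; those just above \<open>x1\<close> would yield a larger total volume.\<close>

lemma local_max_imp_maximal_given:
  assumes M: "hyperbolic_3_manifold TYPE('a::metric_space)" and e1: "(e1 :: 'a site) \<in> sites"
    and lm: "local_max e1 e2 x1 x2"
  shows "maximal_given e1 x1 e2 x2"
proof -
  have conf: "configuration e1 e2 x1 x2" using lm by (simp add: local_max_def)
  obtain \<delta> where \<delta>: "0 < \<delta>" "\<forall>y1 y2. \<bar>y1 - x1\<bar> < \<delta> \<longrightarrow> \<bar>y2 - x2\<bar> < \<delta> \<longrightarrow> configuration e1 e2 y1 y2 \<longrightarrow>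
        vol (pc e1 y1) + vol (pc e2 y2) \<le> vol (pc e1 x1) + vol (pc e2 x2)"
    using lm unfolding local_max_def by blast
  have x: "peripheral e1 x1" "peripheral e2 x2" using conf by (auto simp: configuration_def)
  have "vol (pc e1 y) \<le> vol (pc e1 x1)" if y: "configuration e1 e2 y x2" for y
  proof (cases "y \<le> x1")
    case True
    have "peripheral e1 y" using y by (simp add: configuration_def)
    then show ?thesis using True by (intro vol_mono site_mono(3)[OF M e1 _ x(1)]) auto
  next
    case False
    have yp: "peripheral e1 y" using y by (simp add: configuration_def)
    define z where "z = x1 + min \<delta> (y - x1) / 2"
    have z: "x1 < z" "z < y" "\<bar>z - x1\<bar> < \<delta>" using False \<delta>(1) by (auto simp: z_def min_def field_simps)
    note zm = site_mono[OF M e1 x(1) yp less_imp_le[OF z(1)] less_imp_le[OF z(2)]]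
    have "configuration e1 e2 z x2" using y zm x(2) by (auto simp: configuration_def)
    then have "vol (pc e1 z) + vol (pc e2 x2) \<le> vol (pc e1 x1) + vol (pc e2 x2)" using \<delta> z(3) by simp
    then have "vol (pc e1 z) \<le> vol (pc e1 x1)"
      using manifold_metric(4)[OF M, of "pc e2 x2"]
      by (simp add: add.commute[of _ "vol (pc e2 x2)"] ennreal_add_left_cancel_le less_top[symmetric])
    then show ?thesis using site_vol_strict_mono[OF M e1 x(1) yp z(1,2)] by simp
  qed
  then show ?thesis using conf by (simp add: maximal_given_def)
qed

text \<open>Here \<open>A'\<close> arises from \<open>A\<close> by widening by \<open>\<tau>\<close>, and \<open>B'\<close> from \<open>B\<close> by narrowing by \<open>\<tau>\<close>. A
  common point of \<open>A'\<close> and \<open>B'\<close> is within \<open>\<tau>\<close> of a point of \<open>A\<close>, which then belongs to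
  \<open>B\<close>.\<close>

lemma exchange_disjoint:
  assumes "A \<inter> B = {}" "\<forall>u\<in>A'. \<exists>v\<in>A. dist u v < \<tau>" "\<forall>u\<in>B'. \<forall>v. dist u v < \<tau> \<longrightarrow> v \<in> B"
  shows "A' \<inter> B' = {}"
  using assms by blast

text \<open>Exchange the width \<open>\<tau>\<close> in both directions. Neither exchange increases the total volume, but the
  sum of the two inequalities contradicts strict midpoint convexity.\<close>

lemma local_max_not_both_shiftable:
  assumes lm: "local_max e1 e2 x1 x2" and s1: "shiftable e1 x1" and s2: "shiftable e2 x2"
  shows False
proof -
  have dis: "pc_interior e1 x1 \<inter> pc_interior e2 x2 = {}" using lm by (simp add: local_max_def configuration_def)
  obtain \<delta> where \<delta>: "0 < \<delta>" "\<forall>y1 y2. \<bar>y1 - x1\<bar> < \<delta> \<longrightarrow> \<bar>y2 - x2\<bar> < \<delta> \<longrightarrow> configuration e1 e2 y1 y2 \<longrightarrow>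
        vol (pc e1 y1) + vol (pc e2 y2) \<le> vol (pc e1 x1) + vol (pc e2 x2)"
    using lm unfolding local_max_def by blast
  obtain \<sigma>1 f1 \<eta>1 where 1: "0 < \<eta>1" "\<sigma>1 0 = x1" "(\<sigma>1 \<longlongrightarrow> x1) (at 0)"
     "\<forall>\<tau>. \<bar>\<tau>\<bar> < \<eta>1 \<longrightarrow> peripheral e1 (\<sigma>1 \<tau>) \<and> 0 \<le> f1 \<tau> \<and> vol (pc e1 (\<sigma>1 \<tau>)) = ennreal (f1 \<tau>)"
     "\<forall>\<tau>. 0 < \<tau> \<and> \<tau> < \<eta>1 \<longrightarrow> 2 * f1 0 < f1 \<tau> + f1 (- \<tau>) \<and>
        (\<forall>u\<in>pc_interior e1 (\<sigma>1 \<tau>). \<exists>v\<in>pc_interior e1 x1. dist u v < \<tau>) \<and>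
        (\<forall>u\<in>pc_interior e1 (\<sigma>1 (- \<tau>)). \<forall>v. dist u v < \<tau> \<longrightarrow> v \<in> pc_interior e1 x1)"
    using s1 unfolding shiftable_def by (elim exE conjE) (rule that)
  obtain \<sigma>2 f2 \<eta>2 where 2: "0 < \<eta>2" "\<sigma>2 0 = x2" "(\<sigma>2 \<longlongrightarrow> x2) (at 0)"
     "\<forall>\<tau>. \<bar>\<tau>\<bar> < \<eta>2 \<longrightarrow> peripheral e2 (\<sigma>2 \<tau>) \<and> 0 \<le> f2 \<tau> \<and> vol (pc e2 (\<sigma>2 \<tau>)) = ennreal (f2 \<tau>)"
     "\<forall>\<tau>. 0 < \<tau> \<and> \<tau> < \<eta>2 \<longrightarrow> 2 * f2 0 < f2 \<tau> + f2 (- \<tau>) \<and>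
        (\<forall>u\<in>pc_interior e2 (\<sigma>2 \<tau>). \<exists>v\<in>pc_interior e2 x2. dist u v < \<tau>) \<and>
        (\<forall>u\<in>pc_interior e2 (\<sigma>2 (- \<tau>)). \<forall>v. dist u v < \<tau> \<longrightarrow> v \<in> pc_interior e2 x2)"
    using s2 unfolding shiftable_def by (elim exE conjE) (rule that)
  have "\<forall>\<^sub>F \<tau> in at 0. dist (\<sigma>1 \<tau>) x1 < \<delta> \<and> dist (\<sigma>2 \<tau>) x2 < \<delta>"
    by (intro eventually_conj tendstoD[OF 1(3) \<delta>(1)] tendstoD[OF 2(3) \<delta>(1)])
  then obtain \<rho> where \<rho>: "0 < \<rho>" "\<forall>\<tau>. \<tau> \<noteq> 0 \<and> dist \<tau> 0 < \<rho> \<longrightarrow> dist (\<sigma>1 \<tau>) x1 < \<delta> \<and> dist (\<sigma>2 \<tau>) x2 < \<delta>"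
    unfolding eventually_at by auto
  define \<tau> where "\<tau> = min (min \<eta>1 \<eta>2) \<rho> / 2"
  have \<tau>: "0 < \<tau>" "\<tau> < \<eta>1" "\<tau> < \<eta>2" "\<tau> < \<rho>" using 1(1) 2(1) \<rho>(1) by (auto simp: \<tau>_def min_def)
  have close: "\<bar>\<sigma>1 t - x1\<bar> < \<delta>" "\<bar>\<sigma>2 t - x2\<bar> < \<delta>" if "t = \<tau> \<or> t = - \<tau>" for t
  proof -
    have "t \<noteq> 0 \<and> dist t 0 < \<rho>" using that \<tau> by (auto simp: dist_real_def)
    then have "dist (\<sigma>1 t) x1 < \<delta> \<and> dist (\<sigma>2 t) x2 < \<delta>" using \<rho>(2) by blast
    then show "\<bar>\<sigma>1 t - x1\<bar> < \<delta>" "\<bar>\<sigma>2 t - x2\<bar> < \<delta>" by (simp_all add: dist_real_def)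
  qed
  have p1: "peripheral e1 (\<sigma>1 t)" "0 \<le> f1 t" "vol (pc e1 (\<sigma>1 t)) = ennreal (f1 t)" if "t = \<tau> \<or> t = - \<tau> \<or> t = 0" for t
    using 1(4)[rule_format, of t] that \<tau> 1(1) by auto
  have p2: "peripheral e2 (\<sigma>2 t)" "0 \<le> f2 t" "vol (pc e2 (\<sigma>2 t)) = ennreal (f2 t)" if "t = \<tau> \<or> t = - \<tau> \<or> t = 0" for t
    using 2(4)[rule_format, of t] that \<tau> 2(1) by auto
  have n1: "2 * f1 0 < f1 \<tau> + f1 (- \<tau>)" "\<forall>u\<in>pc_interior e1 (\<sigma>1 \<tau>). \<exists>v\<in>pc_interior e1 x1. dist u v < \<tau>"
    "\<forall>u\<in>pc_interior e1 (\<sigma>1 (- \<tau>)). \<forall>v. dist u v < \<tau> \<longrightarrow> v \<in> pc_interior e1 x1"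
    using 1(5)[rule_format, OF conjI[OF \<tau>(1,2)]] by blast+
  have n2: "2 * f2 0 < f2 \<tau> + f2 (- \<tau>)" "\<forall>u\<in>pc_interior e2 (\<sigma>2 \<tau>). \<exists>v\<in>pc_interior e2 x2. dist u v < \<tau>"
    "\<forall>u\<in>pc_interior e2 (\<sigma>2 (- \<tau>)). \<forall>v. dist u v < \<tau> \<longrightarrow> v \<in> pc_interior e2 x2"
    using 2(5)[rule_format, OF conjI[OF \<tau>(1,3)]] by blast+
  have dis': "pc_interior e2 x2 \<inter> pc_interior e1 x1 = {}" using dis by blast
  have "configuration e1 e2 (\<sigma>1 \<tau>) (\<sigma>2 (- \<tau>))"
    unfolding configuration_def using p1(1) p2(1) exchange_disjoint[OF dis n1(2) n2(3)] by blast
  moreover have "configuration e1 e2 (\<sigma>1 (- \<tau>)) (\<sigma>2 \<tau>)"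
    unfolding configuration_def using p1(1) p2(1) exchange_disjoint[OF dis' n2(2) n1(3)] by blast
  ultimately have "vol (pc e1 (\<sigma>1 \<tau>)) + vol (pc e2 (\<sigma>2 (- \<tau>))) \<le> vol (pc e1 (\<sigma>1 0)) + vol (pc e2 (\<sigma>2 0))"
    "vol (pc e1 (\<sigma>1 (- \<tau>))) + vol (pc e2 (\<sigma>2 \<tau>)) \<le> vol (pc e1 (\<sigma>1 0)) + vol (pc e2 (\<sigma>2 0))"
    using \<delta>(2) close 1(2) 2(2) by simp_all
  then have "f1 \<tau> + f2 (- \<tau>) \<le> f1 0 + f2 0" "f1 (- \<tau>) + f2 \<tau> \<le> f1 0 + f2 0"
    using p1(2) p2(2) by (simp_all add: p1(3) p2(3) flip: ennreal_plus)
  then show False using n1(1) n2(1) by linarith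
qed

lemma not_maximal_imp_larger:
  assumes M: "hyperbolic_3_manifold TYPE('a::metric_space)" and e: "(e :: 'a site) \<in> sites"
    and x: "peripheral e x" and nm: "\<not> maximal e x"
  obtains y where "peripheral e y" "x < y" "vol (pc e x) < vol (pc e y)"
proof -
  obtain y where y: "peripheral e y" "vol (pc e x) < vol (pc e y)"
    using x nm by (auto simp: maximal_def not_le)
  have "x < y"
  proof (rule ccontr)
    assume "\<not> x < y"
    then have "vol (pc e y) \<le> vol (pc e x)" by (intro vol_mono site_mono(3)[OF M e y(1) x]) auto
    then show False using y(2) by simp
  qed
  then show thesis using that y by blast
qed

text \<open>A component without interior, that is a collar of width zero, does not constrain the other one.\<close>

lemma maximal_given_empty_interior:
  assumes "maximal_given e2 x2 e1 x1" "pc_interior e1 x1 = {}"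
  shows "maximal e2 x2"
  using assms unfolding maximal_def maximal_given_def configuration_def by simp

theorem proposition0p1:
  fixes e1 e2 :: "'a::metric_space site" and x1 x2 :: real
  assumes "hyperbolic_3_manifold TYPE('a)"
    and "sites = {e1, e2}" and "e1 \<noteq> e2"
    and "configuration e1 e2 x1 x2"
    and "\<forall>\<^sub>F (y1, y2) in at (x1, x2) within {(y1, y2). configuration e1 e2 y1 y2}.
           vol (pc e1 y1) + vol (pc e2 y2) \<le> vol (pc e1 x1) + vol (pc e2 x2)"
  shows "(maximal e1 x1 \<and> maximal_given e2 x2 e1 x1) \<or>
         (maximal e2 x2 \<and> maximal_given e1 x1 e2 x2)"
proof -
  note M = assms(1)
  have e: "e1 \<in> sites" "e2 \<in> sites" using assms(2) by auto
  have lm: "local_max e1 e2 x1 x2"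
  proof -
    obtain \<delta> where \<delta>: "0 < \<delta>" "\<forall>y\<in>{(y1, y2). configuration e1 e2 y1 y2}. y \<noteq> (x1, x2) \<and> dist y (x1, x2) < \<delta> \<longrightarrow>
        (case y of (y1, y2) \<Rightarrow> vol (pc e1 y1) + vol (pc e2 y2) \<le> vol (pc e1 x1) + vol (pc e2 x2))"
      using assms(5) unfolding eventually_at by blast
    have "vol (pc e1 y1) + vol (pc e2 y2) \<le> vol (pc e1 x1) + vol (pc e2 x2)"
      if y: "\<bar>y1 - x1\<bar> < \<delta> / 2" "\<bar>y2 - x2\<bar> < \<delta> / 2" "configuration e1 e2 y1 y2" for y1 y2
    proof (cases "(y1, y2) = (x1, x2)")
      case False
      have "dist (y1, y2) (x1, x2) \<le> dist y1 x1 + dist y2 x2"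
        unfolding dist_prod_def fst_conv snd_conv by (rule sqrt_sum_squares_le_sum) auto
      also have "\<dots> < \<delta>" using y(1,2) by (simp add: dist_real_def)
      finally show ?thesis using \<delta>(2) False y(3) by auto
    qed simp
    then show ?thesis unfolding local_max_def using assms(4) \<delta>(1) by (intro conjI exI[of _ "\<delta> / 2"]) auto
  qed
  have given: "maximal_given e1 x1 e2 x2" "maximal_given e2 x2 e1 x1"
    using local_max_imp_maximal_given[OF M e(1) lm] local_max_imp_maximal_given[OF M e(2) local_max_commute[OF lm]] by blast+
  have x: "peripheral e1 x1" "peripheral e2 x2" using assms(4) by (auto simp: configuration_def)
  have "maximal e1 x1 \<or> maximal e2 x2"
  proof (rule ccontr)
    assume "\<not> ?thesis"
    then have nm: "\<not> maximal e1 x1" "\<not> maximal e2 x2" by auto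
    obtain y1 where y1: "peripheral e1 y1" "x1 < y1" "vol (pc e1 x1) < vol (pc e1 y1)"
      by (rule not_maximal_imp_larger[OF M e(1) x(1) nm(1)])
    obtain y2 where y2: "peripheral e2 y2" "x2 < y2" "vol (pc e2 x2) < vol (pc e2 y2)"
      by (rule not_maximal_imp_larger[OF M e(2) x(2) nm(2)])
    have ne: "pc_interior e1 x1 \<noteq> {}" "pc_interior e2 x2 \<noteq> {}"
      using maximal_given_empty_interior given nm by blast+
    show False
      by (rule local_max_not_both_shiftable[OF lm site_shiftable[OF M e(1) x(1) y1(1,2) ne(1)]
            site_shiftable[OF M e(2) x(2) y2(1,2) ne(2)]])
  qed
  then show ?thesis using given by blast
qed

end
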